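(* Let $n\ge1$ and let $\mathbf d=(d_1<d_2<\cdots<d_s)$ be positive integers with $d_s\le n$. Let $\lambda=\omega_{2d_1-1}+\omega_{2d_2-1}+\cdots+\omega_{2d_s-1}$. There exists a $T$-equivariant isomorphism $$\zeta:\mathcal{F}l^a_{\mathbf d}\xrightarrow{\ \simeq\ }X_{\sigma_{\mathbf d}}\subset SL_{2n}/P_\lambda,$$ where, with the conventions $d_0:=0$ and $d_{s+1}:=n+1$, $\sigma_{\mathbf d}\in\mathrm{Sym}_{2n}$ is the permutation $$\sigma_{\mathbf d}(k)=\begin{cases}k-d_i&\text{if }k\in\{2d_i,\dots,d_i+d_{i+1}-1\},\\ n+1+k-d_{i+1}&\text{if }k\in\{d_i+d_{i+1},\dots,2d_{i+1}-1\}\end{cases}\qquad(1\le k\le 2n,\ 0\le i\le s).$$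
   Context: All varieties are over $\mathbb{C}$. Partial degenerate flag variety. Let $V\simeq\mathbb{C}^{n+1}$ with ordered basis $f_1,\dots,f_{n+1}$, $\mathrm{pr}_k(\sum_i a_if_i)=\sum_{i\neq k}a_if_i$, and $\mathrm{pr}_{i,j}=\mathrm{pr}_{j-1}\circ\cdots\circ\mathrm{pr}_{i+1}\circ\mathrm{pr}_i$ for $1\le i<j\le n$. Then $$\mathcal{F}l^a_{\mathbf d}=\Big\{(V_1,\dots,V_s)\in\prod_{l=1}^s\mathrm{Gr}_{d_l}(V)\ \Big|\ \mathrm{pr}_{d_l,d_{l+1}}(V_l)\subset V_{l+1}\ \text{for }l=1,\dots,s-1\Big\}.$$ Schubert variety. Let $W\simeq\mathbb{C}^{2n}$ with ordered basis $e_1,\dots,e_{2n}$, $B\subset SL_{2n}$ the upper triangular matrices, $T\subset B$ the diagonal matrices, $\omega_1,\dots,\omega_{2n-1}$ the fundamental weights, and $P_\lambda\supseteq B$ the parabolic subgroup that is the stabilizer of $\lambda$. $SL_{2n}/P_\lambda$ is identified with the variety of partial flags $W_1\subset\cdots\subset W_s\subset W$ with $\dim W_i=2d_i-1$. For $\tau\in\mathrm{Sym}_{2n}$, $X_\tau=\overline{B\tau P_\lambda/P_\lambda}$ is the closure of the $B$-orbit of the flag whose $i$-th subspace is $\langle e_{\tau(1)},\dots,e_{\tau(2d_i-1)}\rangle$. Torus actions. $\underline\lambda=\mathrm{diag}(\lambda_1,\dots,\lambda_{2n})\in T$ acts on $W$ by $\underline\lambda e_k=\lambda_ke_k$, hence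 on $SL_{2n}/P_\lambda$. It acts on the factor $\mathrm{Gr}_{d_l}(V)$ through the linear action on $V$ given by $f_k\mapsto\lambda_kf_k$ if $d_l\le k\le n+1$ and $f_k\mapsto\lambda_{n+1+k}f_k$ if $1\le k\le d_l-1$; this gives an action of $T$ on $\prod_l\mathrm{Gr}_{d_l}(V)$ that preserves $\mathcal{F}l^a_{\mathbf d}$. *)

theory Defs
  imports
    "HOL-Analysis.Abstract_Topology"
    "HOL-Library.Function_Algebras"
    "HOL-Library.FuncSet"
    "Jordan_Normal_Form.Determinant"
begin

section \<open>Coordinate spaces and Grassmannians\<close>

text \<open>
  A vector of \<open>\<complex>\<^sup>N\<close> is a function \<open>nat \<Rightarrow> complex\<close> that vanishes outside \<open>{1..N}\<close>; coordinates are
  numbered from 1.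
\<close>

type_synonym cvec = "nat \<Rightarrow> complex"

definition cscale :: "complex \<Rightarrow> cvec \<Rightarrow> cvec" where
  "cscale c v = (\<lambda>i. c * v i)"

global_interpretation cvs: vector_space cscale
  by standard (auto simp: cscale_def fun_eq_iff algebra_simps)

definition cspace :: "nat \<Rightarrow> cvec set" where
  "cspace N = {v. \<forall>i. i \<notin> {1..N} \<longrightarrow> v i = 0}"

definition basis_vec :: "nat \<Rightarrow> cvec" where
  "basis_vec k = (\<lambda>i. if i = k then 1 else 0)"

definition Gr :: "nat \<Rightarrow> nat \<Rightarrow> cvec set set" where
  "Gr N r = {U. cvs.subspace U \<and> U \<subseteq> cspace N \<and> cvs.dim U = r}"

text \<open>
  Points of a product of \<open>s\<close> Grassmannians of subspaces of \<open>\<complex>\<^sup>N\<close>, of dimensions \<open>r 1, \<dots>, r s\<close>.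
\<close>

type_synonym gpoint = "nat \<Rightarrow> cvec set"

definition Gr_prod :: "nat \<Rightarrow> nat \<Rightarrow> (nat \<Rightarrow> nat) \<Rightarrow> gpoint set" where
  "Gr_prod N s r = (\<Pi>\<^sub>E l\<in>{1..s}. Gr N (r l))"


section \<open>Subvarieties of a product of projective spaces\<close>

text \<open>
  The polynomial functions in the coordinates \<open>P l i\<close> (\<open>1 \<le> l \<le> s\<close>, \<open>i \<in> J l\<close>) of a product of
  \<open>s\<close> projective spaces that are multihomogeneous, of degree \<open>a l\<close> in the \<open>l\<close>-th group of coordinates.
\<close>

inductive multihom ::
  "nat \<Rightarrow> (nat \<Rightarrow> 'i set) \<Rightarrow> (nat \<Rightarrow> nat) \<Rightarrow> ((nat \<Rightarrow> 'i \<Rightarrow> complex) \<Rightarrow> complex) \<Rightarrow> bool"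
  for s :: nat and J :: "nat \<Rightarrow> 'i set"
where
  zero: "multihom s J a (\<lambda>_. 0)"
| const: "multihom s J (\<lambda>_. 0) (\<lambda>_. c)"
| coord: "l \<in> {1..s} \<Longrightarrow> i \<in> J l \<Longrightarrow> multihom s J (\<lambda>m. if m = l then 1 else 0) (\<lambda>P. P l i)"
| add: "multihom s J a F \<Longrightarrow> multihom s J a G \<Longrightarrow> multihom s J a (\<lambda>P. F P + G P)"
| mult: "multihom s J a F \<Longrightarrow> multihom s J b G \<Longrightarrow> multihom s J (\<lambda>m. a m + b m) (\<lambda>P. F P * G P)"

text \<open>
  The \<open>l\<close>-th group of homogeneous coordinates of a point \<open>x\<close> of \<open>Gr_prod N s r\<close> consists of the Pluecker
  coordinates of \<open>x l\<close>: the maximal minors of the matrix whose rows are the vectors of an ordered basis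
  of \<open>x l\<close>, indexed by the \<open>r l\<close>-element subsets of \<open>{1..N}\<close>. They depend on the basis through a nonzero
  factor only; \<open>hcoords\<close> collects the coordinates for all choices of ordered bases, and what is said
  below about multihomogeneous functions and their quotients of degree zero is independent of the choice.
\<close>

definition plucker_index :: "nat \<Rightarrow> (nat \<Rightarrow> nat) \<Rightarrow> nat \<Rightarrow> nat set set" where
  "plucker_index N r l = {I. I \<subseteq> {1..N} \<and> card I = r l}"

definition ordered_basis :: "nat \<Rightarrow> (nat \<Rightarrow> cvec) \<Rightarrow> cvec set \<Rightarrow> bool" where
  "ordered_basis m b U \<longleftrightarrow>
     inj_on b {1..m} \<and> cvs.independent (b ` {1..m}) \<and> cvs.span (b ` {1..m}) = U"

definition plucker :: "nat \<Rightarrow> (nat \<Rightarrow> cvec) \<Rightarrow> nat set \<Rightarrow> complex" where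
  "plucker m b I = det (mat m m (\<lambda>(i, j). b (Suc i) (sorted_list_of_set I ! j)))"

definition hcoords :: "nat \<Rightarrow> (nat \<Rightarrow> nat) \<Rightarrow> gpoint \<Rightarrow> (nat \<Rightarrow> nat set \<Rightarrow> complex) set" where
  "hcoords s r x =
     {P. \<exists>b. \<forall>l\<in>{1..s}. ordered_basis (r l) (b l) (x l) \<and> P l = plucker (r l) (b l)}"

text \<open>
  The Zariski topology on a set \<open>X\<close> of points of \<open>Gr_prod N s r\<close>, generated by the sets where one
  multihomogeneous polynomial does not vanish.
\<close>

definition zariski :: "nat \<Rightarrow> nat \<Rightarrow> (nat \<Rightarrow> nat) \<Rightarrow> gpoint set \<Rightarrow> gpoint topology" where
  "zariski N s r X = topology_generated_by
     {{x \<in> X. \<forall>P\<in>hcoords s r x. F P \<noteq> 0} | F a. multihom s (plucker_index N r) a F}"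

lemma topspace_zariski: "topspace (zariski N s r X) = X"
proof -
  let ?D = "\<lambda>F. {x \<in> X. \<forall>P\<in>hcoords s r x. F P \<noteq> 0}"
  have "X \<subseteq> ?D (\<lambda>_. 1 :: complex)" by auto
  moreover have "multihom s (plucker_index N r) (\<lambda>_. 0) (\<lambda>_. 1)" by (rule multihom.const)
  ultimately have "X \<subseteq> \<Union>{?D F | F a. multihom s (plucker_index N r) a F}" by blast
  then show ?thesis unfolding zariski_def topology_generated_by_topspace by blast
qed

text \<open>
  Regular functions on an open subset \<open>U\<close> of \<open>X\<close> are locally quotients of multihomogeneous polynomials of
  the same multidegree.
\<close>

definition regular_on ::
  "nat \<Rightarrow> nat \<Rightarrow> (nat \<Rightarrow> nat) \<Rightarrow> gpoint set \<Rightarrow> gpoint set \<Rightarrow> (gpoint \<Rightarrow> complex) \<Rightarrow> bool" where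
  "regular_on N s r X U \<phi> \<longleftrightarrow>
     (\<forall>x\<in>U. \<exists>O' a G H. openin (zariski N s r X) O' \<and> x \<in> O' \<and> O' \<subseteq> U \<and>
        multihom s (plucker_index N r) a G \<and> multihom s (plucker_index N r) a H \<and>
        (\<forall>y\<in>O'. \<forall>P\<in>hcoords s r y. H P \<noteq> 0 \<and> \<phi> y = G P / H P))"

text \<open>
  In the following two definitions \<open>X\<close> consists of points of \<open>Gr_prod N s r\<close> and \<open>Y\<close> of points of
  \<open>Gr_prod N' s' r'\<close>.
\<close>

definition variety_morphism ::
  "nat \<Rightarrow> nat \<Rightarrow> (nat \<Rightarrow> nat) \<Rightarrow> gpoint set \<Rightarrow> nat \<Rightarrow> nat \<Rightarrow> (nat \<Rightarrow> nat) \<Rightarrow> gpoint set \<Rightarrow>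
   (gpoint \<Rightarrow> gpoint) \<Rightarrow> bool" where
  "variety_morphism N s r X N' s' r' Y f \<longleftrightarrow>
     continuous_map (zariski N s r X) (zariski N' s' r' Y) f \<and>
     (\<forall>U \<phi>. openin (zariski N' s' r' Y) U \<longrightarrow> regular_on N' s' r' Y U \<phi> \<longrightarrow>
        regular_on N s r X {x \<in> X. f x \<in> U} (\<phi> \<circ> f))"

definition variety_isomorphism ::
  "nat \<Rightarrow> nat \<Rightarrow> (nat \<Rightarrow> nat) \<Rightarrow> gpoint set \<Rightarrow> nat \<Rightarrow> nat \<Rightarrow> (nat \<Rightarrow> nat) \<Rightarrow> gpoint set \<Rightarrow>
   (gpoint \<Rightarrow> gpoint) \<Rightarrow> bool" where
  "variety_isomorphism N s r X N' s' r' Y f \<longleftrightarrow>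
     variety_morphism N s r X N' s' r' Y f \<and>
     (\<exists>g. variety_morphism N' s' r' Y N s r X g \<and>
        (\<forall>x\<in>X. g (f x) = x) \<and> (\<forall>y\<in>Y. f (g y) = y))"


section \<open>The partial degenerate flag variety\<close>

definition pr :: "nat \<Rightarrow> cvec \<Rightarrow> cvec" where
  "pr k v = v(k := 0)"

text \<open>\<open>pr_comp i j\<close> is \<open>pr (j - 1) \<circ> \<dots> \<circ> pr (i + 1) \<circ> pr i\<close>.\<close>

definition pr_comp :: "nat \<Rightarrow> nat \<Rightarrow> cvec \<Rightarrow> cvec" where
  "pr_comp i j = fold pr [i..<j]"

definition degenerate_flags :: "nat \<Rightarrow> nat \<Rightarrow> (nat \<Rightarrow> nat) \<Rightarrow> gpoint set" where
  "degenerate_flags n s d =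
     {x \<in> Gr_prod (n + 1) s d. \<forall>l\<in>{1..<s}. pr_comp (d l) (d (l + 1)) ` x l \<subseteq> x (l + 1)}"


section \<open>Schubert varieties in partial flag varieties\<close>

definition SL :: "nat \<Rightarrow> complex mat set" where
  "SL N = {A \<in> carrier_mat N N. det A = 1}"

definition Borel :: "nat \<Rightarrow> complex mat set" where
  "Borel N = {A \<in> SL N. upper_triangular A}"

definition Torus :: "nat \<Rightarrow> complex mat set" where
  "Torus N = {A \<in> SL N. diagonal_mat A}"

text \<open>Matrix indices start at 0, coordinates of vectors at 1.\<close>

definition mat_act :: "nat \<Rightarrow> complex mat \<Rightarrow> cvec \<Rightarrow> cvec" where
  "mat_act N A v =
     (\<lambda>i. if i \<in> {1..N} then \<Sum>j\<in>{1..N}. A $$ (i - 1, j - 1) * v j else 0)"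

definition flag_act :: "nat \<Rightarrow> nat \<Rightarrow> complex mat \<Rightarrow> gpoint \<Rightarrow> gpoint" where
  "flag_act N s A y = (\<lambda>l\<in>{1..s}. mat_act N A ` y l)"

text \<open>
  For a sum of fundamental weights \<open>\<omega>\<^bsub>r 1\<^esub> + \<dots> + \<omega>\<^bsub>r s\<^esub>\<close> with \<open>r 1 < \<dots> < r s\<close>, the quotient of \<open>SL N\<close> by
  the parabolic subgroup stabilizing it, as the variety of flags with subspaces of dimensions
  \<open>r 1, \<dots>, r s\<close>.
\<close>

definition partial_flags :: "nat \<Rightarrow> nat \<Rightarrow> (nat \<Rightarrow> nat) \<Rightarrow> gpoint set" where
  "partial_flags N s r = {y \<in> Gr_prod N s r. \<forall>l\<in>{1..<s}. y l \<subseteq> y (l + 1)}"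

definition perm_flag :: "nat \<Rightarrow> (nat \<Rightarrow> nat) \<Rightarrow> (nat \<Rightarrow> nat) \<Rightarrow> gpoint" where
  "perm_flag s r \<tau> = (\<lambda>l\<in>{1..s}. cvs.span ((\<lambda>k. basis_vec (\<tau> k)) ` {1..r l}))"

definition schubert :: "nat \<Rightarrow> nat \<Rightarrow> (nat \<Rightarrow> nat) \<Rightarrow> (nat \<Rightarrow> nat) \<Rightarrow> gpoint set" where
  "schubert N s r \<tau> =
     zariski N s r (partial_flags N s r) closure_of
       ((\<lambda>A. flag_act N s A (perm_flag s r \<tau>)) ` Borel N)"


section \<open>The torus action on the degenerate flag variety\<close>

definition torus_vec_act :: "nat \<Rightarrow> nat \<Rightarrow> complex mat \<Rightarrow> cvec \<Rightarrow> cvec" where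
  "torus_vec_act n m A v =
     (\<lambda>k. if k \<in> {m..n + 1} then A $$ (k - 1, k - 1) * v k
          else if k \<in> {1..m - 1} then A $$ (n + 1 + k - 1, n + 1 + k - 1) * v k
          else 0)"

definition torus_degenerate_act ::
  "nat \<Rightarrow> nat \<Rightarrow> (nat \<Rightarrow> nat) \<Rightarrow> complex mat \<Rightarrow> gpoint \<Rightarrow> gpoint" where
  "torus_degenerate_act n s d A x = (\<lambda>l\<in>{1..s}. torus_vec_act n (d l) A ` x l)"


section \<open>The permutation\<close>

text \<open>The sequence \<open>d\<close> extended by \<open>d 0 = 0\<close> and \<open>d (s + 1) = n + 1\<close>.\<close>

definition dext :: "nat \<Rightarrow> nat \<Rightarrow> (nat \<Rightarrow> nat) \<Rightarrow> nat \<Rightarrow> nat" where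
  "dext n s d i = (if i = 0 then 0 else if i = s + 1 then n + 1 else d i)"

text \<open>
  The case distinction of the definition on \<open>{1..2 * n}\<close>, with the index \<open>i\<close> of the case determined by
  \<open>2 d\<^sub>i \<le> k < 2 d\<^bsub>i+1\<^esub>\<close>; see \<open>sigma_perm_eq1\<close>, \<open>sigma_perm_eq2\<close> and \<open>sigma_perm_permutes\<close> below.
\<close>

definition sigma_perm :: "nat \<Rightarrow> nat \<Rightarrow> (nat \<Rightarrow> nat) \<Rightarrow> nat \<Rightarrow> nat" where
  "sigma_perm n s d k =
     (if k \<in> {1..2 * n} then
        let D = dext n s d; i = (THE i. i \<le> s \<and> k \<in> {2 * D i..<2 * D (i + 1)})
        in if k < D i + D (i + 1) then k - D i else n + 1 + k - D (i + 1)
      else k)"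

context
  fixes n s :: nat and d :: "nat \<Rightarrow> nat"
  assumes d_pos: "\<forall>l\<in>{1..s}. 0 < d l"
    and d_mono: "strict_mono_on {1..s} d"
    and d_le: "d s \<le> n"
begin

lemma dext_mono:
  assumes "i < j" "j \<le> s + 1"
  shows "dext n s d i < dext n s d j"
proof -
  have *: "d i < d j" if "1 \<le> i" "i < j" "j \<le> s" for i j
    using d_mono that by (auto simp: strict_mono_on_def)
  have "d i < n + 1" if "1 \<le> i" "i \<le> s" for i
    using *[of i s] d_le that by (cases "i = s") auto
  then show ?thesis
    using assms * d_pos by (auto simp: dext_def)
qed

lemma dext_mono_le: "i \<le> j \<Longrightarrow> j \<le> s + 1 \<Longrightarrow> dext n s d i \<le> dext n s d j"
  using dext_mono[of i j] by (cases "i = j") auto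

lemma sigma_perm_index_unique:
  assumes "i \<le> s" "j \<le> s"
    and "k \<in> {c * dext n s d i..<c * dext n s d (i + 1)}"
    and "k \<in> {c * dext n s d j..<c * dext n s d (j + 1)}"
  shows "i = j"
proof (rule ccontr)
  assume "i \<noteq> j"
  then consider "i + 1 \<le> j" | "j + 1 \<le> i" by linarith
  then show False
  proof cases
    case 1
    then have "c * dext n s d (i + 1) \<le> c * dext n s d j"
      using dext_mono_le assms(2) by (intro mult_le_mono2) auto
    then show ?thesis using assms(3,4) unfolding atLeastLessThan_iff by linarith
  next
    case 2
    then have "c * dext n s d (j + 1) \<le> c * dext n s d i"
      using dext_mono_le assms(1) by (intro mult_le_mono2) auto
    then show ?thesis using assms(3,4) unfolding atLeastLessThan_iff by linarith
  qed
qed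

lemma sigma_perm_index:
  assumes "i \<le> s" "k \<in> {2 * dext n s d i..<2 * dext n s d (i + 1)}"
  shows "(THE i. i \<le> s \<and> k \<in> {2 * dext n s d i..<2 * dext n s d (i + 1)}) = i"
  using assms sigma_perm_index_unique by (intro the_equality) blast+

lemma sigma_perm_eq1:
  assumes "k \<in> {1..2 * n}" "i \<le> s"
    and "k \<in> {2 * dext n s d i..<dext n s d i + dext n s d (i + 1)}"
  shows "sigma_perm n s d k = k - dext n s d i"
proof -
  have "dext n s d i < dext n s d (i + 1)"
    using dext_mono assms(2) by simp
  then have "k \<in> {2 * dext n s d i..<2 * dext n s d (i + 1)}"
    using assms(3) by auto
  then show ?thesis
    unfolding sigma_perm_def Let_def using assms sigma_perm_index[OF assms(2)] by simp
qed

lemma sigma_perm_eq2: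
  assumes "k \<in> {1..2 * n}" "i \<le> s"
    and "k \<in> {dext n s d i + dext n s d (i + 1)..<2 * dext n s d (i + 1)}"
  shows "sigma_perm n s d k = n + 1 + k - dext n s d (i + 1)"
proof -
  have "dext n s d i < dext n s d (i + 1)"
    using dext_mono assms(2) by simp
  then have "k \<in> {2 * dext n s d i..<2 * dext n s d (i + 1)}"
    using assms(3) by auto
  then show ?thesis
    unfolding sigma_perm_def Let_def using assms sigma_perm_index[OF assms(2)] by simp
qed

lemma dext_interval:
  assumes "m \<le> n"
  obtains i where "i \<le> s" "dext n s d i \<le> m" "m < dext n s d (i + 1)"
proof -
  define i where "i = Max {i. i \<le> s \<and> dext n s d i \<le> m}"
  have fin: "finite {i. i \<le> s \<and> dext n s d i \<le> m}" by simp
  have "0 \<in> {i. i \<le> s \<and> dext n s d i \<le> m}" by (simp add: dext_def)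
  then have i: "i \<le> s" "dext n s d i \<le> m"
    using Max_in[OF fin] unfolding i_def by blast+
  have "m < dext n s d (i + 1)"
  proof (rule ccontr)
    assume *: "\<not> m < dext n s d (i + 1)"
    then have "i \<noteq> s" using assms by (auto simp: dext_def)
    then have "i + 1 \<in> {i. i \<le> s \<and> dext n s d i \<le> m}" using * i by auto
    then have "i + 1 \<le> i" unfolding i_def by (rule Max_ge[OF fin])
    then show False by simp
  qed
  with i show ?thesis using that by blast
qed

lemma sigma_perm_permutes: "sigma_perm n s d permutes {1..2 * n}"
proof -
  let ?D = "dext n s d" and ?\<sigma> = "sigma_perm n s d"
  have surj: "m \<in> ?\<sigma> ` {1..2 * n}" if m: "m \<in> {1..2 * n}" for m
  proof (cases "m \<le> n")
    case True
    then obtain i where i: "i \<le> s" "?D i \<le> m" "m < ?D (i + 1)" by (rule dext_interval)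
    have "?\<sigma> (m + ?D i) = m + ?D i - ?D i"
      using i m True by (intro sigma_perm_eq1) auto
    moreover have "m + ?D i \<in> {1..2 * n}" using i m True by auto
    ultimately show ?thesis by (auto intro!: image_eqI[of _ _ "m + ?D i"])
  next
    case False
    define m' where "m' = m - n - 1"
    have m': "m = n + 1 + m'" "m' \<le> n" using False m by (auto simp: m'_def)
    obtain i where i: "i \<le> s" "?D i \<le> m'" "m' < ?D (i + 1)"
      using dext_interval[OF m'(2)] by blast
    have "?D (i + 1) \<le> ?D (s + 1)" by (rule dext_mono_le) (use i in auto)
    then have le: "?D (i + 1) \<le> n + 1" by (simp add: dext_def)
    have "m' + ?D (i + 1) \<in> {1..2 * n}" using i m m' le by auto
    moreover have "?\<sigma> (m' + ?D (i + 1)) = n + 1 + (m' + ?D (i + 1)) - ?D (i + 1)"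
      using calculation i by (intro sigma_perm_eq2) auto
    ultimately show ?thesis using m' by (auto intro!: image_eqI[of _ _ "m' + ?D (i + 1)"])
  qed
  then have sub: "{1..2 * n} \<subseteq> ?\<sigma> ` {1..2 * n}" by blast
  have "card (?\<sigma> ` {1..2 * n}) \<le> card {1..2 * n}" by (intro card_image_le) simp
  then have eq: "?\<sigma> ` {1..2 * n} = {1..2 * n}"
    using card_seteq[OF _ sub] by auto
  then have "inj_on ?\<sigma> {1..2 * n}" by (intro eq_card_imp_inj_on) auto
  with eq have "bij_betw ?\<sigma> {1..2 * n} {1..2 * n}" by (simp add: bij_betw_def)
  then show ?thesis
    by (rule bij_imp_permutes) (simp only: sigma_perm_def if_False)
qed

end

end

theory Submission
  imports Defs
begin

text \<open>
  The isomorphism is explicit. Identify \<open>V\<close> with the span of \<open>e\<^sub>k\<close>, \<open>d\<^sub>l \<le> k \<le> n + d\<^sub>l\<close>, by a map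
  \<open>\<phi>\<^sub>l\<close> that sends \<open>f\<^sub>k\<close> to \<open>e\<^sub>k\<close> for \<open>k \<ge> d\<^sub>l\<close> and wraps the remaining \<open>f\<^sub>k\<close> around to
  \<open>e\<^bsub>n+1+k\<^esub>\<close>, and put \<open>W\<^sub>l = \<langle>e\<^sub>1, \<dots>, e\<^bsub>d\<^sub>l - 1\<^esub>\<rangle> \<oplus> \<phi>\<^sub>l(V\<^sub>l)\<close>. Modulo the span of the \<open>e\<^sub>k\<close> with
  \<open>k < d\<^bsub>l+1\<^esub>\<close>, the map \<open>\<phi>\<^sub>l\<close> agrees with \<open>\<phi>\<^bsub>l+1\<^esub>\<close> after the coordinates between \<open>d\<^sub>l\<close> and
  \<open>d\<^bsub>l+1\<^esub> - 1\<close> have been killed; so the incidence relations of the degenerate flag variety say exactly that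
  \<open>W\<^sub>l \<subseteq> W\<^bsub>l+1\<^esub>\<close> (\<open>pr_comp_fold_vec\<close>). The torus acts on \<open>V\<close> in such a way that \<open>\<phi>\<^sub>l\<close> is equivariant.
  The flags that arise are the sandwiched ones, those with
  \<open>\<langle>e\<^sub>1, \<dots>, e\<^bsub>d\<^sub>l - 1\<^esub>\<rangle> \<subseteq> W\<^sub>l \<subseteq> \<langle>e\<^sub>1, \<dots>, e\<^bsub>n + d\<^sub>l\<^esub>\<rangle>\<close>. In Pluecker coordinates the construction and its
  inverse relabel coordinates, change signs and insert zeros (\<open>plucker_lift\<close>, \<open>plucker_drop\<close>), so both are
  morphisms (\<open>coordinate_morphism\<close>).

  What remains is that the sandwiched flags form the Schubert variety of \<open>\<sigma>\<close>. They form a closed set, because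
  each of the two inclusions amounts to the vanishing of Pluecker coordinates, and this set is stable under the
  Borel group and contains the coordinate flag of \<open>\<sigma>\<close>. Write \<open>E = \<langle>e\<^sub>1, \<dots>, e\<^sub>n\<rangle>\<close>. A sandwiched flag with
  \<open>W\<^sub>l \<inter> E = \<langle>e\<^sub>1, \<dots>, e\<^bsub>d\<^sub>l - 1\<^esub>\<rangle>\<close> for all \<open>l\<close> lies in the orbit: it
  contains vectors of the form \<open>e\<^bsub>n+k\<^esub> + (element of E)\<close>, and these are columns of a unipotent matrix that
  produces the flag (\<open>generic_in_orbit\<close>).

  The orbit is dense by a descent on \<open>\<Sum>\<^sub>l dim (W\<^sub>l \<inter> E)\<close>. If a sandwiched flag is not generic, there are
  a vector \<open>u\<close> and a linear form \<open>\<xi>\<close> such that the maps \<open>v \<mapsto> v + t \<xi>(v) u\<close> keep the flag sandwiched for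
  almost all \<open>t\<close> and make this sum smaller when \<open>t \<noteq> 0\<close> (\<open>deformation_data\<close>, \<open>deformation\<close>). Pluecker coordinates,
  hence multihomogeneous polynomials, are continuous along such a curve, so every Zariski neighbourhood of the
  flag contains the points of the curve with small \<open>t\<close> (\<open>curve_eventually_in_open\<close>). For a coordinate flag, \<open>u\<close>
  is a basis vector and \<open>\<xi>\<close> a coordinate, and the deformation aims at the flag in which two basis vectors
  are exchanged; that a suitable pair exists is the combinatorial core (\<open>balanced_pair_exists\<close>), and takes the place of the Bruhat order here.
\<close>

section \<open>Linear algebra in coordinate spaces\<close>

global_interpretation cvp: vector_space_pair cscale cscale ..

abbreviation clinear :: "(cvec \<Rightarrow> cvec) \<Rightarrow> bool" where
  "clinear \<equiv> Vector_Spaces.linear cscale cscale"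

lemma clinearI:
  assumes "\<And>v w. f (v + w) = f v + f w" "\<And>c v. f (cscale c v) = cscale c (f v)"
  shows "clinear f"
  using assms by (simp add: Vector_Spaces.linear_iff cvs.vector_space_axioms)

lemma sum_fun_apply: "(\<Sum>a\<in>A. f a) x = (\<Sum>a\<in>A. (f a x :: complex))"
  by (induction A rule: infinite_finite_induct) auto

lemma subspace_cspace: "cvs.subspace (cspace N)"
  by (auto simp: cvs.subspace_def cspace_def cscale_def)

lemma cspace_mono: "M \<le> N \<Longrightarrow> cspace M \<subseteq> cspace N"
  by (auto simp: cspace_def)

definition coord_space :: "nat set \<Rightarrow> cvec set" where
  "coord_space S = {v. \<forall>k. k \<notin> S \<longrightarrow> v k = 0}"

lemma subspace_coord_space: "cvs.subspace (coord_space S)"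
  by (auto simp: cvs.subspace_def cscale_def coord_space_def)

lemma cspace_eq_coord_space: "cspace N = coord_space {1..N}"
  by (simp add: coord_space_def cspace_def)

lemma coord_space_mono: "S \<subseteq> T \<Longrightarrow> coord_space S \<subseteq> coord_space T"
  by (auto simp: coord_space_def)

lemma coord_space_expand:
  assumes "finite S" "v \<in> coord_space S"
  shows "v = (\<Sum>i\<in>S. cscale (v i) (basis_vec i))"
proof
  fix k
  have "(\<Sum>i\<in>S. v i * (if k = i then 1 else 0)) = (if k \<in> S then v k else 0)"
    using assms(1) by (simp add: if_distrib cong: if_cong)
  then show "v k = (\<Sum>i\<in>S. cscale (v i) (basis_vec i)) k"
    using assms(2) by (auto simp: sum_fun_apply cscale_def basis_vec_def coord_space_def)
qed

lemma basis_vec_in_cspace: "k \<in> {1..N} \<Longrightarrow> basis_vec k \<in> cspace N"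
  by (auto simp: basis_vec_def cspace_def)

lemma basis_vec_neq_0: "basis_vec k \<noteq> 0"
proof
  assume "basis_vec k = 0"
  then have "basis_vec k k = 0 k" by (rule fun_cong)
  then show False by (simp add: basis_vec_def)
qed

lemma span_basis_vec:
  assumes "finite S"
  shows "cvs.span (basis_vec ` S) = coord_space S"
proof
  show "cvs.span (basis_vec ` S) \<subseteq> coord_space S"
    by (intro cvs.span_minimal subspace_coord_space) (auto simp: basis_vec_def coord_space_def)
  show "coord_space S \<subseteq> cvs.span (basis_vec ` S)"
  proof
    fix v assume v: "v \<in> coord_space S"
    have "(\<Sum>i\<in>S. cscale (v i) (basis_vec i)) \<in> cvs.span (basis_vec ` S)"
      by (intro cvs.span_sum cvs.span_scale cvs.span_base) auto
    with coord_space_expand[OF assms v] show "v \<in> cvs.span (basis_vec ` S)" by simp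
  qed
qed

lemma span_basis_vec_cspace: "cvs.span (basis_vec ` {1..N}) = cspace N"
  unfolding cspace_eq_coord_space by (rule span_basis_vec) simp

lemma inj_basis_vec: "inj basis_vec"
  by (rule injI) (auto simp: basis_vec_def fun_eq_iff split: if_splits)

lemma independent_basis_vec:
  assumes "finite S"
  shows "cvs.independent (basis_vec ` S)"
proof
  assume "cvs.dependent (basis_vec ` S)"
  then obtain u k where u: "k \<in> S" "u (basis_vec k) \<noteq> 0" "(\<Sum>w\<in>basis_vec ` S. cscale (u w) w) = 0"
    using cvs.dependent_finite[of "basis_vec ` S"] assms by auto
  have "(\<Sum>i\<in>S. cscale (u (basis_vec i)) (basis_vec i)) = 0"
    using u(3) inj_on_subset[OF inj_basis_vec, of S] by (simp add: sum.reindex)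
  then have "(\<Sum>i\<in>S. cscale (u (basis_vec i)) (basis_vec i)) k = 0" by simp
  moreover have "(\<Sum>i\<in>S. u (basis_vec i) * (if k = i then 1 else 0)) = u (basis_vec k)"
    using u(1) assms by (simp add: if_distrib cong: if_cong)
  ultimately show False using u(2) by (simp add: sum_fun_apply cscale_def basis_vec_def)
qed

lemma dim_coord_space:
  assumes "finite S"
  shows "cvs.dim (coord_space S) = card S"
  using cvs.dim_span_eq_card_independent[OF independent_basis_vec[OF assms]]
  by (simp add: span_basis_vec[OF assms] card_image inj_on_subset[OF inj_basis_vec])

lemma dim_cspace: "cvs.dim (cspace N) = N"
  by (simp add: cspace_eq_coord_space dim_coord_space)

lemma finite_basisE:
  assumes "cvs.subspace U" "U \<subseteq> cspace N"
  obtains B where "finite B" "cvs.independent B" "cvs.span B = U" "card B = cvs.dim U"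
proof -
  obtain B where B: "B \<subseteq> U" "cvs.independent B" "U \<subseteq> cvs.span B" "card B = cvs.dim U"
    using cvs.basis_exists by blast
  have "B \<subseteq> cvs.span (basis_vec ` {1..N})" using B(1) assms(2) span_basis_vec_cspace by auto
  then have "finite B" using cvs.independent_span_bound B(2) by blast
  moreover have "cvs.span B = U"
    using B(1,3) assms(1) cvs.span_minimal by blast
  ultimately show ?thesis using B that by blast
qed

lemma independent_card_le:
  assumes "cvs.independent B" "B \<subseteq> U" "cvs.subspace U" "U \<subseteq> cspace N"
  shows "finite B" "card B \<le> cvs.dim U"
proof -
  obtain C where C: "finite C" "cvs.independent C" "cvs.span C = U" "card C = cvs.dim U"
    using finite_basisE assms by blast
  have "finite B \<and> card B \<le> card C"
    using cvs.independent_span_bound[of C B] assms C by blast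
  then show "finite B" "card B \<le> cvs.dim U" using C by auto
qed

lemma dim_mono:
  assumes "cvs.subspace U" "cvs.subspace U'" "U \<subseteq> U'" "U' \<subseteq> cspace N"
  shows "cvs.dim U \<le> cvs.dim U'"
proof -
  obtain B where B: "finite B" "cvs.independent B" "cvs.span B = U" "card B = cvs.dim U"
    using finite_basisE[of U N] assms by blast
  have "B \<subseteq> U'" using B assms(3) cvs.span_superset by blast
  then show ?thesis using independent_card_le[of B U' N] B assms by auto
qed

lemma dim_subspace_eq:
  assumes "cvs.subspace U" "cvs.subspace U'" "U \<subseteq> U'" "U' \<subseteq> cspace N" "cvs.dim U' \<le> cvs.dim U"
  shows "U = U'"
proof (rule ccontr)
  assume "U \<noteq> U'"
  then obtain v where v: "v \<in> U'" "v \<notin> U" using assms by blast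
  obtain B where B: "finite B" "cvs.independent B" "cvs.span B = U" "card B = cvs.dim U"
    using finite_basisE[of U N] assms by blast
  have "cvs.independent (insert v B)" using B v cvs.independent_insertI by auto
  moreover have "insert v B \<subseteq> U'" using B v assms(3) cvs.span_superset by blast
  ultimately have "card (insert v B) \<le> cvs.dim U'"
    using independent_card_le assms by blast
  moreover have "v \<notin> B" using v B cvs.span_superset by blast
  ultimately show False using B assms by simp
qed

lemma rank_nullity:
  assumes f: "clinear f" and U: "cvs.subspace U" "U \<subseteq> cspace N"
  shows "cvs.dim U = cvs.dim {v \<in> U. f v = 0} + cvs.dim (f ` U)"
proof -
  interpret f: Vector_Spaces.linear cscale cscale f by (rule f)
  let ?K = "{v \<in> U. f v = 0}"
  have K: "cvs.subspace ?K"
    using U(1) by (auto simp: cvs.subspace_def f.add f.scale f.zero)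
  obtain A where A: "finite A" "cvs.independent A" "cvs.span A = ?K" "card A = cvs.dim ?K"
    using finite_basisE[OF K] U(2) by blast
  have AU: "A \<subseteq> U" using A(3) cvs.span_superset by blast
  obtain B where B: "A \<subseteq> B" "B \<subseteq> U" "cvs.independent B" "U \<subseteq> cvs.span B"
    using cvs.maximal_independent_subset_extend[OF AU A(2)] by blast
  have finB: "finite B" using independent_card_le B U by blast
  have spanB: "cvs.span B = U" using B U(1) cvs.span_minimal by blast
  have dimU: "cvs.dim U = card B"
    using cvs.dim_span_eq_card_independent[OF B(3)] spanB by simp
  let ?C = "B - A"
  have indC: "cvs.independent ?C" using B(3) cvs.independent_mono by blast
  have inter: "v = 0" if v: "v \<in> cvs.span ?C" "f v = 0" for v
  proof -
    have "v \<in> U" using v(1) spanB cvs.span_mono[of ?C B] by auto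
    then have "v \<in> cvs.span A" using v A(3) by blast
    then obtain a where a: "v = (\<Sum>w\<in>A. cscale (a w) w)"
      using cvs.span_finite[OF A(1)] by auto
    obtain c where c: "v = (\<Sum>w\<in>?C. cscale (c w) w)"
      using v(1) cvs.span_finite[of ?C] finB by auto
    define u where "u w = (if w \<in> A then - a w else c w)" for w
    have "(\<Sum>w\<in>?C. cscale (u w) w) = v"
      unfolding c by (rule sum.cong) (simp_all add: u_def)
    moreover have "(\<Sum>w\<in>A. cscale (u w) w) = - v"
      unfolding a sum_negf[symmetric] by (rule sum.cong) (simp_all add: u_def)
    ultimately have "(\<Sum>w\<in>B. cscale (u w) w) = 0"
      unfolding sum.subset_diff[OF B(1) finB] by (simp only: right_minus)
    moreover have "\<forall>u. \<not> ((\<exists>w\<in>B. u w \<noteq> 0) \<and> (\<Sum>w\<in>B. cscale (u w) w) = 0)"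
      using B(3) unfolding cvs.dependent_finite[OF finB] not_ex .
    ultimately have "\<forall>w\<in>B. u w = 0" by (elim allE[of _ u]) simp
    then have "\<forall>w\<in>?C. c w = 0" by (auto simp: u_def)
    then have "(\<Sum>w\<in>?C. cscale (c w) w) = 0" by (intro sum.neutral) auto
    then show "v = 0" using c by (rule trans[rotated])
  qed
  have inj: "inj_on f (cvs.span ?C)"
    using inter by (subst f.inj_on_iff_eq_0) auto
  have "cvs.independent (f ` ?C)"
    using indC inj f.independent_injective_image by blast
  moreover have "cvs.span (f ` ?C) = f ` U"
  proof -
    have "cvs.span (f ` B) = f ` U" using f.span_image spanB by simp
    moreover have "f ` B \<subseteq> insert 0 (f ` ?C)"
      using A(3) cvs.span_superset[of A] by auto
    then have "cvs.span (f ` B) \<subseteq> cvs.span (f ` ?C)"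
      by (metis cvs.span_insert_0 cvs.span_mono)
    moreover have "cvs.span (f ` ?C) \<subseteq> cvs.span (f ` B)"
      by (intro cvs.span_mono) auto
    ultimately show ?thesis by auto
  qed
  ultimately have "cvs.dim (f ` U) = card (f ` ?C)"
    using cvs.dim_span_eq_card_independent by metis
  also have "\<dots> = card ?C"
    by (rule card_image, rule inj_on_subset[OF inj]) (rule cvs.span_superset)
  finally show ?thesis
    using dimU A(4) B(1) finB card_mono[OF finB B(1)] by (simp add: card_Diff_subset A(1))
qed

lemma dim_linear_image:
  assumes f: "clinear f" and U: "cvs.subspace U" "U \<subseteq> cspace N" and inj: "\<And>v. v \<in> U \<Longrightarrow> f v = 0 \<Longrightarrow> v = 0"
  shows "cvs.dim (f ` U) = cvs.dim U"
proof -
  interpret f: Vector_Spaces.linear cscale cscale f by (rule f)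
  have "{v \<in> U. f v = 0} = {0}" using inj U(1) f.zero by (auto simp: cvs.subspace_def)
  moreover have "cvs.dim {0} = card ({} :: cvec set)"
    by (rule cvs.dim_unique) (auto simp: cvs.independent_empty)
  ultimately have "cvs.dim {v \<in> U. f v = 0} = 0" by (simp only: card.empty)
  then show ?thesis using rank_nullity[OF f U] by simp
qed

text \<open>
  Coordinates with respect to the index set \<open>{1..m}\<close> instead of sums over the set of basis vectors: this is
  the form in which bases are changed, mapped and assembled below.
\<close>

lemma ordered_basis_iff:
  "ordered_basis m b U \<longleftrightarrow> cvs.subspace U \<and> (\<forall>i\<in>{1..m}. b i \<in> U) \<and>
     (\<forall>v\<in>U. \<exists>c. v = (\<Sum>i\<in>{1..m}. cscale (c i) (b i))) \<and>
     (\<forall>c. (\<Sum>i\<in>{1..m}. cscale (c i) (b i)) = 0 \<longrightarrow> (\<forall>i\<in>{1..m}. c i = 0))"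
    (is "?L \<longleftrightarrow> ?R")
proof
  assume L: ?L
  then have inj: "inj_on b {1..m}" and ind: "cvs.independent (b ` {1..m})"
    and sp: "cvs.span (b ` {1..m}) = U" by (auto simp: ordered_basis_def)
  have "cvs.subspace U" using sp cvs.subspace_span by blast
  moreover have "\<forall>i\<in>{1..m}. b i \<in> U" using sp cvs.span_superset by blast
  moreover have "\<exists>c. v = (\<Sum>i\<in>{1..m}. cscale (c i) (b i))" if v: "v \<in> U" for v
  proof -
    obtain u where "v = (\<Sum>w\<in>b ` {1..m}. cscale (u w) w)"
      using v sp cvs.span_finite[of "b ` {1..m}"] by auto
    then have "v = (\<Sum>i\<in>{1..m}. cscale ((u \<circ> b) i) (b i))"
      by (simp only: sum.reindex[OF inj] o_def)
    then show ?thesis by blast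
  qed
  moreover have "c i = 0" if c: "(\<Sum>i\<in>{1..m}. cscale (c i) (b i)) = 0" and i: "i \<in> {1..m}" for c i
  proof (rule ccontr)
    assume ne: "c i \<noteq> 0"
    define u where "u = c \<circ> the_inv_into {1..m} b"
    have u: "u (b j) = c j" if "j \<in> {1..m}" for j
      using inj that by (simp add: u_def the_inv_into_f_f)
    have "(\<Sum>w\<in>b ` {1..m}. cscale (u w) w) = (\<Sum>i\<in>{1..m}. cscale (u (b i)) (b i))"
      by (simp only: sum.reindex[OF inj] o_def)
    also have "\<dots> = (\<Sum>i\<in>{1..m}. cscale (c i) (b i))"
      using u by (intro sum.cong) auto
    finally have "(\<Sum>w\<in>b ` {1..m}. cscale (u w) w) = 0" using c by simp
    moreover have "\<exists>w\<in>b ` {1..m}. u w \<noteq> 0" using i ne u[OF i] by (intro bexI[of _ "b i"]) auto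
    ultimately have "cvs.dependent (b ` {1..m})"
      using cvs.dependent_finite[of "b ` {1..m}"] by auto
    then show False using ind by simp
  qed
  ultimately show ?R by blast
next
  assume R: ?R
  have inj: "inj_on b {1..m}"
  proof (rule inj_onI, rule ccontr)
    fix i j assume ij: "i \<in> {1..m}" "j \<in> {1..m}" "b i = b j" "i \<noteq> j"
    define c :: "nat \<Rightarrow> complex" where "c = (\<lambda>k. if k = i then 1 else if k = j then -1 else 0)"
    have "(\<Sum>k\<in>{1..m}. cscale (c k) (b k)) = (\<Sum>k\<in>{i,j}. cscale (c k) (b k))"
      using ij by (intro sum.mono_neutral_right) (auto simp: c_def)
    also have "\<dots> = 0" using ij by (simp add: c_def)
    finally have "c i = 0" using R ij by blast
    then show False by (simp add: c_def)
  qed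
  moreover have "cvs.independent (b ` {1..m})"
  proof
    assume "cvs.dependent (b ` {1..m})"
    then obtain u i where u: "i \<in> {1..m}" "u (b i) \<noteq> 0" "(\<Sum>w\<in>b ` {1..m}. cscale (u w) w) = 0"
      using cvs.dependent_finite[of "b ` {1..m}"] by auto
    then have "(\<Sum>i\<in>{1..m}. cscale ((u \<circ> b) i) (b i)) = 0"
      by (simp only: sum.reindex[OF inj] o_def)
    then have "(u \<circ> b) i = 0" using R u(1) by blast
    then show False using u by simp
  qed
  moreover have "cvs.span (b ` {1..m}) = U"
  proof
    show "cvs.span (b ` {1..m}) \<subseteq> U" using R by (intro cvs.span_minimal) auto
    show "U \<subseteq> cvs.span (b ` {1..m})"
    proof
      fix v assume "v \<in> U"
      then obtain c where c: "v = (\<Sum>i\<in>{1..m}. cscale (c i) (b i))" using R by blast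
      show "v \<in> cvs.span (b ` {1..m})"
        unfolding c by (intro cvs.span_sum cvs.span_scale cvs.span_base imageI)
    qed
  qed
  ultimately show ?L by (simp add: ordered_basis_def)
qed

lemma ordered_basis_dim:
  assumes "ordered_basis m b U"
  shows "cvs.subspace U" "cvs.dim U = m" "\<And>i. i \<in> {1..m} \<Longrightarrow> b i \<in> U"
proof -
  show "cvs.subspace U" "\<And>i. i \<in> {1..m} \<Longrightarrow> b i \<in> U"
    using assms by (auto simp: ordered_basis_iff)
  have b: "inj_on b {1..m}" "cvs.independent (b ` {1..m})" "cvs.span (b ` {1..m}) = U"
    using assms by (auto simp: ordered_basis_def)
  show "cvs.dim U = m"
    using cvs.dim_span_eq_card_independent[OF b(2)] card_image[OF b(1)] unfolding b(3) by simp
qed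

lemma ordered_basis_exists:
  assumes "U \<in> Gr N m"
  obtains b where "ordered_basis m b U"
proof -
  obtain B where B: "finite B" "cvs.independent B" "cvs.span B = U" "card B = m"
    using finite_basisE[of U N] assms by (auto simp: Gr_def)
  obtain b where "bij_betw b {1..m} B"
    using B ex_bij_betw_nat_finite_1 by blast
  then show ?thesis using B that[of b] by (simp add: ordered_basis_def bij_betw_def)
qed

lemma ordered_basis_image:
  assumes f: "clinear f" and b: "ordered_basis m b U" and inj: "\<And>v. v \<in> U \<Longrightarrow> f v = 0 \<Longrightarrow> v = 0"
  shows "ordered_basis m (f \<circ> b) (f ` U)"
proof -
  interpret f: Vector_Spaces.linear cscale cscale f by (rule f)
  have fs: "(\<Sum>i\<in>{1..m}. cscale (c i) ((f \<circ> b) i)) = f (\<Sum>i\<in>{1..m}. cscale (c i) (b i))" for c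
    by (simp add: f.sum f.scale)
  note B = b[unfolded ordered_basis_iff]
  have "(\<Sum>i\<in>{1..m}. cscale (c i) (b i)) \<in> U" for c
    using B by (intro cvs.subspace_sum cvs.subspace_scale) auto
  then have "(\<Sum>i\<in>{1..m}. cscale (c i) (b i)) = 0" if "f (\<Sum>i\<in>{1..m}. cscale (c i) (b i)) = 0" for c
    using inj that by blast
  moreover have "cvs.subspace (f ` U)" using B f.subspace_image by blast
  ultimately show ?thesis unfolding ordered_basis_iff fs using B by fastforce
qed

text \<open>
  The restrictions to \<open>U\<close> of the coordinate functions form a matroid on \<open>J\<close>; an independent set \<open>A\<close> extends to
  a basis \<open>I\<close>. The vectors \<open>v i\<close> are the basis of \<open>U\<close> dual to the coordinates in \<open>I\<close>. A maximal independent set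
  separates the points of \<open>U\<close>: a coordinate \<open>k\<close> that does not vanish on some \<open>w \<in> U\<close> with \<open>w = 0\<close> on \<open>I\<close>
  could be added to \<open>I\<close>, since multiples of \<open>w\<close> correct the other witnesses at \<open>k\<close>.
\<close>

lemma coordinate_basis_extend:
  fixes U :: "cvec set"
  assumes U: "cvs.subspace U" and fin: "finite J" and A: "A \<subseteq> J"
    and Aind: "\<And>i. i \<in> A \<Longrightarrow> \<exists>v\<in>U. v i \<noteq> 0 \<and> (\<forall>k\<in>A - {i}. v k = 0)"
    and inj: "\<And>v. v \<in> U \<Longrightarrow> (\<forall>k\<in>J. v k = 0) \<Longrightarrow> v = 0"
  obtains I v where "A \<subseteq> I" "I \<subseteq> J" "\<And>i. i \<in> I \<Longrightarrow> v i \<in> U"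
    "\<And>i k. i \<in> I \<Longrightarrow> k \<in> I \<Longrightarrow> v i k = (if i = k then 1 else 0)"
    "\<And>u. u \<in> U \<Longrightarrow> u = (\<Sum>i\<in>I. cscale (u i) (v i))"
proof -
  define ind where "ind I \<longleftrightarrow> A \<subseteq> I \<and> I \<subseteq> J \<and> (\<forall>i\<in>I. \<exists>v\<in>U. v i \<noteq> 0 \<and> (\<forall>k\<in>I - {i}. v k = 0))" for I
  have "{I. ind I} \<subseteq> Pow J" by (auto simp: ind_def)
  then have finI: "finite {I. ind I}" using fin finite_subset by blast
  moreover have "ind A" using A Aind by (auto simp: ind_def)
  ultimately obtain I where I: "ind I" and max: "\<And>I'. ind I' \<Longrightarrow> I \<subseteq> I' \<Longrightarrow> I' = I"
    using finite_has_maximal[OF finI] by auto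
  have finite: "finite I" using I fin finite_subset by (auto simp: ind_def)
  have "\<forall>i\<in>I. \<exists>v\<in>U. v i = 1 \<and> (\<forall>k\<in>I - {i}. v k = 0)"
  proof
    fix i assume "i \<in> I"
    then obtain v where v: "v \<in> U" "v i \<noteq> 0" "\<forall>k\<in>I - {i}. v k = 0"
      using I by (auto simp: ind_def)
    have "cscale (1 / v i) v \<in> U" using v U cvs.subspace_scale by blast
    then show "\<exists>v\<in>U. v i = 1 \<and> (\<forall>k\<in>I - {i}. v k = 0)"
      using v by (intro bexI[of _ "cscale (1 / v i) v"]) (auto simp: cscale_def)
  qed
  then obtain v where v: "\<And>i. i \<in> I \<Longrightarrow> v i \<in> U" "\<And>i. i \<in> I \<Longrightarrow> v i i = 1"
    "\<And>i k. i \<in> I \<Longrightarrow> k \<in> I - {i} \<Longrightarrow> v i k = 0" by metis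
  have vd: "v i k = (if i = k then 1 else 0)" if "i \<in> I" "k \<in> I" for i k
    using v that by auto
  have zero: "w = 0" if w: "w \<in> U" "\<forall>k\<in>I. w k = 0" for w
  proof (rule ccontr)
    assume "w \<noteq> 0"
    then obtain k where k: "k \<in> J" "w k \<noteq> 0" using inj w by blast
    have kI: "k \<notin> I" using k w by blast
    have "ind (insert k I)"
      unfolding ind_def
    proof (intro conjI ballI)
      show "A \<subseteq> insert k I" "insert k I \<subseteq> J" using I k by (auto simp: ind_def)
      fix i assume i: "i \<in> insert k I"
      show "\<exists>v\<in>U. v i \<noteq> 0 \<and> (\<forall>j\<in>insert k I - {i}. v j = 0)"
      proof (cases "i = k")
        case True
        then show ?thesis using w k by (intro bexI[of _ w]) auto
      next
        case False
        then have iI: "i \<in> I" using i by blast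
        let ?u = "v i - cscale (v i k / w k) w"
        have "?u \<in> U" using v(1)[OF iI] w(1) U cvs.subspace_diff cvs.subspace_scale by blast
        moreover have "?u i \<noteq> 0" using v(2)[OF iI] w iI by (simp add: cscale_def)
        moreover have "\<forall>j\<in>insert k I - {i}. ?u j = 0"
        proof
          fix j assume j: "j \<in> insert k I - {i}"
          show "?u j = 0"
          proof (cases "j = k")
            case True
            have "?u k = v i k - v i k / w k * w k"
              unfolding cscale_def by (rule fun_diff_def[THEN fun_cong])
            then show ?thesis unfolding True using k(2) by (simp del: fun_diff_def)
          next
            case False
            then have jI: "j \<in> I" "i \<noteq> j" using j by blast+
            have "?u j = v i j - v i k / w k * w j"
              unfolding cscale_def by (rule fun_diff_def[THEN fun_cong])
            then show ?thesis unfolding vd[OF iI jI(1)] using w(2) jI by simp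
          qed
        qed
        ultimately show ?thesis by (intro bexI[of _ ?u] conjI)
      qed
    qed
    then have "insert k I = I" by (rule max) blast
    then show False using kI by blast
  qed
  have "u = (\<Sum>i\<in>I. cscale (u i) (v i))" if u: "u \<in> U" for u
  proof -
    let ?w = "u - (\<Sum>i\<in>I. cscale (u i) (v i))"
    have "?w \<in> U" using u U v(1) by (intro cvs.subspace_diff cvs.subspace_sum cvs.subspace_scale)
    moreover have "\<forall>k\<in>I. ?w k = 0"
    proof
      fix k assume k: "k \<in> I"
      have "(\<Sum>i\<in>I. u i * v i k) = (\<Sum>i\<in>I. if i = k then u i else 0)"
        using k by (intro sum.cong) (auto simp: vd)
      then show "?w k = 0" using k finite by (simp add: sum_fun_apply cscale_def)
    qed
    ultimately have "?w = 0" by (rule zero)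
    then show ?thesis by (rule eq_iff_diff_eq_0[THEN iffD2])
  qed
  moreover have "A \<subseteq> I" "I \<subseteq> J" using I by (auto simp: ind_def)
  ultimately show ?thesis using that[of I v] v(1) vd by blast
qed

lemma functional_exists:
  assumes S: "cvs.subspace S" and x: "x \<notin> S"
  obtains \<xi> where "\<And>v w. \<xi> (v + w) = \<xi> v + \<xi> w" "\<And>c v. \<xi> (cscale c v) = c * \<xi> v"
    "\<And>v. v \<in> S \<Longrightarrow> \<xi> v = (0 :: complex)" "\<xi> x = 1"
proof -
  obtain B where B: "B \<subseteq> S" "cvs.independent B" "S \<subseteq> cvs.span B"
    using cvs.maximal_independent_subset by blast
  have SB: "cvs.span B = S" using B S cvs.span_minimal by blast
  have ind: "cvs.independent (insert x B)" using B x SB cvs.independent_insertI by auto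
  obtain f where f: "clinear f" "\<And>y. y \<in> insert x B \<Longrightarrow> f y = (if y = x then basis_vec 1 else 0)"
    using cvp.linear_independent_extend[OF ind, of "\<lambda>y. if y = x then basis_vec 1 else 0"] by blast
  interpret f: Vector_Spaces.linear cscale cscale f by (rule f)
  have xB: "x \<notin> B" using x B by blast
  have fS: "f v = 0" if "v \<in> S" for v
  proof -
    have "v \<in> cvs.span B" using that SB by simp
    then show ?thesis
    proof (rule f.eq_0_on_span[rotated])
      show "\<And>x. x \<in> B \<Longrightarrow> f x = 0" using f(2) xB by auto
    qed
  qed
  show ?thesis
  proof (rule that[of "\<lambda>v. f v 1"])
    show "f (v + w) 1 = f v 1 + f w 1" for v w
      unfolding f.add by (rule plus_fun_apply)
    show "f (cscale c v) 1 = c * f v 1" for c v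
      unfolding f.scale by (rule fun_cong[OF cscale_def])
    show "f v 1 = 0" if "v \<in> S" for v
      unfolding fS[OF that] by (rule zero_fun_apply)
    have "f x = basis_vec 1" using f(2)[of x] by simp
    then show "f x 1 = 1" by (simp add: basis_vec_def)
  qed
qed

section \<open>Pluecker coordinates and multihomogeneous polynomials\<close>

lemma sum_Suc_lessThan: "(\<Sum>k\<in>{1..m}. f k) = (\<Sum>k\<in>{0..<m}. f (Suc k))"
  by (simp add: sum.atLeast1_atMost_eq atLeast0LessThan)

lemma ordered_basis_coeffs_0:
  assumes "ordered_basis m b U" "(\<Sum>i\<in>{1..m}. cscale (c i) (b i)) = 0" "i \<in> {1..m}"
  shows "c i = 0"
proof -
  have "\<forall>c. (\<Sum>i\<in>{1..m}. cscale (c i) (b i)) = 0 \<longrightarrow> (\<forall>i\<in>{1..m}. c i = 0)"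
    using assms(1) unfolding ordered_basis_iff by (elim conjE)
  from this[THEN spec, THEN mp, OF assms(2)] assms(3) show ?thesis by (rule bspec)
qed

lemma ordered_basis_expand:
  assumes "ordered_basis m b U" "v \<in> U"
  obtains c where "v = (\<Sum>i\<in>{1..m}. cscale (c i) (b i))"
proof -
  have "\<forall>v\<in>U. \<exists>c. v = (\<Sum>i\<in>{1..m}. cscale (c i) (b i))"
    using assms(1) unfolding ordered_basis_iff by (elim conjE)
  from bspec[OF this assms(2)] that show ?thesis by (elim exE)
qed

text \<open>
  The factor is the determinant of the base change matrix, which is nonzero because the vectors \<open>b' i\<close> are
  linearly independent.
\<close>

lemma plucker_base_change:
  assumes b: "ordered_basis m b U" and b': "ordered_basis m b' U"
  obtains c where "c \<noteq> 0" "\<And>I. plucker m b' I = c * plucker m b I"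
proof -
  have "\<forall>i\<in>{1..m}. \<exists>c. b' i = (\<Sum>k\<in>{1..m}. cscale (c k) (b k))"
  proof
    fix i assume "i \<in> {1..m}"
    from ordered_basis_expand[OF b ordered_basis_dim(3)[OF b' this]]
    obtain c where "b' i = (\<Sum>k\<in>{1..m}. cscale (c k) (b k))" .
    then show "\<exists>c. b' i = (\<Sum>k\<in>{1..m}. cscale (c k) (b k))" by (rule exI[of _ c])
  qed
  from bchoice[OF this] obtain M
    where M: "\<And>i. i \<in> {1..m} \<Longrightarrow> b' i = (\<Sum>k\<in>{1..m}. cscale (M i k) (b k))"
    by (elim exE) (rule that, erule bspec)
  let ?M = "mat m m (\<lambda>(i, k). M (Suc i) (Suc k))"
  have entry: "b' (Suc i) x = (\<Sum>k\<in>{0..<m}. M (Suc i) (Suc k) * b (Suc k) x)" if "i < m" for i x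
    using M[of "Suc i"] that
    by (simp add: sum_fun_apply cscale_def sum_Suc_lessThan[unfolded One_nat_def])
  have "plucker m b' I = det ?M * plucker m b I" for I
  proof -
    let ?B = "mat m m (\<lambda>(i, j). b (Suc i) (sorted_list_of_set I ! j))"
    have "mat m m (\<lambda>(i, j). b' (Suc i) (sorted_list_of_set I ! j)) = ?M * ?B"
      by (rule eq_matI) (auto simp: entry scalar_prod_def)
    then show ?thesis unfolding plucker_def by (simp add: det_mult[of _ m])
  qed
  moreover have "det ?M \<noteq> 0"
  proof
    assume "det ?M = 0"
    then have "det (transpose_mat ?M) = 0" by (subst det_transpose[of _ m]) auto
    then obtain v where v: "v \<in> carrier_vec m" "v \<noteq> 0\<^sub>v m" "transpose_mat ?M *\<^sub>v v = 0\<^sub>v m"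
      using det_0_iff_vec_prod_zero[of "transpose_mat ?M" m] by auto
    have vk: "(\<Sum>i\<in>{0..<m}. v $ i * M (Suc i) (Suc k)) = 0" if "k < m" for k
    proof -
      have "(transpose_mat ?M *\<^sub>v v) $ k = 0" using v(3) that by simp
      then show ?thesis using that v(1) by (simp add: scalar_prod_def mult.commute)
    qed
    have "(\<Sum>i\<in>{1..m}. cscale (v $ (i - 1)) (b' i)) = 0"
    proof
      fix x
      have "(\<Sum>i\<in>{1..m}. cscale (v $ (i - 1)) (b' i)) x = (\<Sum>i\<in>{0..<m}. v $ i * b' (Suc i) x)"
        by (simp add: sum_fun_apply cscale_def sum_Suc_lessThan[unfolded One_nat_def])
      also have "\<dots> = (\<Sum>i\<in>{0..<m}. \<Sum>k\<in>{0..<m}. (v $ i * M (Suc i) (Suc k)) * b (Suc k) x)"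
        by (intro sum.cong) (auto simp: entry sum_distrib_left mult.assoc)
      also have "\<dots> = (\<Sum>k\<in>{0..<m}. (\<Sum>i\<in>{0..<m}. v $ i * M (Suc i) (Suc k)) * b (Suc k) x)"
        by (subst sum.swap) (simp add: sum_distrib_right)
      also have "\<dots> = 0" by (intro sum.neutral) (auto simp: vk)
      finally show "(\<Sum>i\<in>{1..m}. cscale (v $ (i - 1)) (b' i)) x = 0 x" by simp
    qed
    then have z: "\<forall>i\<in>{1..m}. v $ (i - 1) = 0"
      using ordered_basis_coeffs_0[OF b', of "\<lambda>i. v $ (i - 1)"] by blast
    have "v = 0\<^sub>v m"
    proof (rule eq_vecI)
      fix i assume "i < dim_vec (0\<^sub>v m :: complex vec)"
      then show "v $ i = 0\<^sub>v m $ i" using z[rule_format, of "Suc i"] by simp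
    qed (use v(1) in auto)
    then show False using v(2) by simp
  qed
  ultimately show ?thesis using that by blast
qed

text \<open>
  The coefficients of \<open>w\<close> in the basis are a linear relation between the rows of the minor.
\<close>

lemma plucker_eq_0_row:
  assumes b: "ordered_basis m b U" and I: "card I = m" "finite I"
    and w: "w \<in> U" "w \<noteq> 0" "\<And>k. k \<in> I \<Longrightarrow> w k = 0"
  shows "plucker m b I = 0"
proof -
  let ?A = "mat m m (\<lambda>(i, j). b (Suc i) (sorted_list_of_set I ! j))"
  obtain c where c: "w = (\<Sum>i\<in>{1..m}. cscale (c i) (b i))"
    using ordered_basis_expand[OF b w(1)] .
  let ?v = "vec m (\<lambda>i. c (Suc i))"
  have wx: "w x = (\<Sum>i\<in>{0..<m}. c (Suc i) * b (Suc i) x)" for x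
    unfolding c by (simp add: sum_fun_apply cscale_def sum_Suc_lessThan[unfolded One_nat_def])
  have "?v \<noteq> 0\<^sub>v m"
  proof
    assume z: "?v = 0\<^sub>v m"
    have "c (Suc i) = 0" if "i < m" for i
      using arg_cong[OF z, of "\<lambda>u. u $ i"] that by simp
    then have "w x = 0" for x unfolding wx by (intro sum.neutral) auto
    then show False using w(2) by (auto simp: fun_eq_iff)
  qed
  moreover have "transpose_mat ?A *\<^sub>v ?v = 0\<^sub>v m"
  proof (rule eq_vecI)
    fix j assume "j < dim_vec (0\<^sub>v m :: complex vec)"
    then have j: "j < m" by simp
    then have "sorted_list_of_set I ! j \<in> I"
      using I nth_mem[of j "sorted_list_of_set I"] by simp
    from w(3)[OF this] j show "(transpose_mat ?A *\<^sub>v ?v) $ j = 0\<^sub>v m $ j"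
      unfolding wx by (simp add: scalar_prod_def mult.commute)
  qed simp
  ultimately have "det (transpose_mat ?A) = 0"
    using det_0_iff_vec_prod_zero[of "transpose_mat ?A" m] by (auto intro!: exI[of _ ?v])
  then show ?thesis unfolding plucker_def by (subst (asm) det_transpose[of _ m]) auto
qed

lemma plucker_eq_0_column:
  assumes b: "ordered_basis m b U" and I: "card I = m" "finite I"
    and k: "k \<in> I" "\<And>u. u \<in> U \<Longrightarrow> u k = 0"
  shows "plucker m b I = 0"
proof -
  let ?A = "mat m m (\<lambda>(i, j). b (Suc i) (sorted_list_of_set I ! j))"
  obtain j where j: "j < m" "sorted_list_of_set I ! j = k"
    using k(1) I in_set_conv_nth[of k "sorted_list_of_set I"] by auto
  have "det ?A = (\<Sum>i<m. ?A $$ (i, j) * cofactor ?A i j)"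
    by (rule laplace_expansion_column) (use j in auto)
  also have "\<dots> = 0"
    using j k(2) ordered_basis_dim(3)[OF b] by (intro sum.neutral) auto
  finally show ?thesis by (simp add: plucker_def)
qed

text \<open>
  In the basis dual to the coordinates in \<open>I\<close>, the minor at \<open>I\<close> is the identity matrix.
\<close>

lemma nonzero_minor_exists:
  assumes U: "U \<in> Gr N m" and J: "J \<subseteq> {1..N}" and A: "A \<subseteq> J"
    and Aind: "\<And>i. i \<in> A \<Longrightarrow> \<exists>v\<in>U. v i \<noteq> 0 \<and> (\<forall>k\<in>A - {i}. v k = 0)"
    and inj: "\<And>v. v \<in> U \<Longrightarrow> (\<forall>k\<in>J. v k = 0) \<Longrightarrow> v = 0"
  obtains I b where "A \<subseteq> I" "I \<subseteq> J" "card I = m" "ordered_basis m b U" "plucker m b I = 1"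
proof -
  have sub: "cvs.subspace U" and dimU: "cvs.dim U = m" using U by (auto simp: Gr_def)
  have finJ: "finite J" using J finite_subset by blast
  obtain I v where I: "A \<subseteq> I" "I \<subseteq> J" and vU: "\<And>i. i \<in> I \<Longrightarrow> v i \<in> U"
    and vd: "\<And>i k. i \<in> I \<Longrightarrow> k \<in> I \<Longrightarrow> v i k = (if i = k then 1 else 0)"
    and ex: "\<And>u. u \<in> U \<Longrightarrow> u = (\<Sum>i\<in>I. cscale (u i) (v i))"
    by (rule coordinate_basis_extend[OF sub finJ A], erule Aind, erule inj, assumption, rule that)
  have finI: "finite I" using I finJ finite_subset by blast
  define xs where "xs = sorted_list_of_set I"
  define p where "p i = xs ! (i - 1)" for i
  define b where "b = v \<circ> p"
  have xs: "length xs = card I" "distinct xs" "set xs = I"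
    using finI by (auto simp: xs_def)
  have p: "bij_betw p {1..card I} I"
  proof -
    have "bij_betw (\<lambda>i. xs ! i) {0..<card I} I"
      unfolding atLeast0LessThan by (rule bij_betw_nth[OF xs(2)]) (simp_all only: xs)
    moreover have "bij_betw (\<lambda>i. i - 1) {1..card I} {0..<card I}"
      by (rule bij_betw_byWitness[of _ Suc]) auto
    ultimately have "bij_betw ((\<lambda>i. xs ! i) \<circ> (\<lambda>i. i - 1)) {1..card I} I"
      by (rule bij_betw_trans[rotated])
    then show ?thesis by (simp add: p_def[abs_def] comp_def)
  qed
  have pI: "p i \<in> I" if "i \<in> {1..card I}" for i using bij_betwE[OF p] that by blast
  have "ordered_basis (card I) b U"
    unfolding ordered_basis_iff
  proof (intro conjI ballI allI impI)
    show "cvs.subspace U" by (rule sub)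
    show "b i \<in> U" if "i \<in> {1..card I}" for i using vU[OF pI[OF that]] by (simp add: b_def)
  next
    fix u assume "u \<in> U"
    then have "u = (\<Sum>i\<in>I. cscale (u i) (v i))" by (rule ex)
    also have "\<dots> = (\<Sum>i\<in>{1..card I}. cscale (u (p i)) (v (p i)))"
      by (rule sum.reindex_bij_betw[OF p, symmetric])
    finally show "\<exists>c. u = (\<Sum>i\<in>{1..card I}. cscale (c i) (b i))"
      by (intro exI[of _ "u \<circ> p"]) (simp only: b_def o_def)
  next
    fix c i assume c: "(\<Sum>i\<in>{1..card I}. cscale (c i) (b i)) = 0" and i: "i \<in> {1..card I}"
    have "(\<Sum>j\<in>{1..card I}. cscale (c j) (b j)) (p i) = (\<Sum>j\<in>{1..card I}. c j * v (p j) (p i))"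
      by (simp add: sum_fun_apply cscale_def b_def)
    also have "\<dots> = (\<Sum>j\<in>{1..card I}. if j = i then c j else 0)"
    proof (rule sum.cong[OF refl])
      fix j assume j: "j \<in> {1..card I}"
      have "p j = p i \<longleftrightarrow> j = i" using inj_on_eq_iff[OF bij_betw_imp_inj_on[OF p] j i] .
      then show "c j * v (p j) (p i) = (if j = i then c j else 0)"
        using vd[OF pI[OF j] pI[OF i]] by simp
    qed
    also have "\<dots> = c i" using i by simp
    finally show "c i = 0" unfolding c by simp
  qed
  moreover from ordered_basis_dim(2)[OF this] have cardI: "card I = m" using dimU by simp
  moreover have "plucker m b I = 1"
  proof -
    have "mat m m (\<lambda>(i, j). b (Suc i) (sorted_list_of_set I ! j)) = 1\<^sub>m m"
    proof (rule eq_matI)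
      fix i j assume "i < dim_row (1\<^sub>m m :: complex mat)" "j < dim_col (1\<^sub>m m :: complex mat)"
      then have ijm: "i < m" "j < m" by simp_all
      then have ij: "i < length xs" "j < length xs" using xs(1) cardI by simp_all
      have "xs ! i \<in> I" "xs ! j \<in> I"
        using nth_mem[OF ij(1)] nth_mem[OF ij(2)] unfolding xs(3) .
      moreover have "xs ! i = xs ! j \<longleftrightarrow> i = j" using xs(2) ij by (rule nth_eq_iff_index_eq)
      ultimately have "b (Suc i) (xs ! j) = (if i = j then 1 else 0)"
        using vd[of "xs ! i" "xs ! j"] by (simp add: b_def p_def)
      then show "mat m m (\<lambda>(i, j). b (Suc i) (sorted_list_of_set I ! j)) $$ (i, j) = 1\<^sub>m m $$ (i, j)"
        using ijm unfolding xs_def by simp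
    qed auto
    then show ?thesis by (simp add: plucker_def)
  qed
  ultimately show ?thesis using I by (intro that[of I b]) simp_all
qed

text \<open>
  The sign belongs to the permutation that takes one list of columns to the other, so it serves all
  matrices at once; this makes it usable as a coefficient of a morphism.
\<close>

lemma det_column_reorder:
  assumes "distinct xs" "distinct ys" "set xs = set ys" "length xs = m"
  shows "\<exists>\<epsilon>::complex. \<epsilon> * \<epsilon> = 1 \<and>
    (\<forall>f. det (mat m m (\<lambda>(i, j). f i (xs ! j))) = \<epsilon> * det (mat m m (\<lambda>(i, j). f i (ys ! j))))"
proof -
  have len: "length ys = m" using assms distinct_card by metis
  have bx: "bij_betw ((!) xs) {0..<m} (set xs)" and by': "bij_betw ((!) ys) {0..<m} (set xs)"
    using bij_betw_nth[OF assms(1), of "{0..<m}" "set xs"] bij_betw_nth[OF assms(2), of "{0..<m}" "set xs"]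
      assms len by (auto simp: atLeast0LessThan)
  define q where "q j = (if j \<in> {0..<m} then the_inv_into {0..<m} ((!) ys) (xs ! j) else j)" for j
  have "bij_betw (the_inv_into {0..<m} ((!) ys) \<circ> (!) xs) {0..<m} {0..<m}"
    using bx bij_betw_the_inv_into[OF by'] by (rule bij_betw_trans)
  then have "bij_betw q {0..<m} {0..<m}"
    by (rule bij_betw_cong[THEN iffD1, rotated]) (simp add: q_def)
  then have q: "q permutes {0..<m}"
    by (rule bij_imp_permutes) (simp only: q_def if_False)
  have yq: "ys ! q j = xs ! j" if "j < m" for j
  proof -
    have "xs ! j \<in> (!) ys ` {0..<m}" using that bx by' bij_betwE[OF bx] by (simp add: bij_betw_def)
    then show ?thesis using by' that by (simp add: q_def bij_betw_def f_the_inv_into_f)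
  qed
  have eq: "det (mat m m (\<lambda>(i, j). f i (xs ! j))) = signof q * det (mat m m (\<lambda>(i, j). f i (ys ! j)))"
    for f :: "nat \<Rightarrow> 'a \<Rightarrow> complex"
  proof -
    let ?Y = "mat m m (\<lambda>(i, j). f i (ys ! j))"
    have ql: "q i < m" if "i < m" for i using permutes_in_image[OF q, of i] that by simp
    have "det (mat m m (\<lambda>(i, j). transpose_mat ?Y $$ (q i, j))) = signof q * det (transpose_mat ?Y)"
      by (rule det_permute_rows[OF _ q]) simp
    also have "det (transpose_mat ?Y) = det ?Y" by (rule det_transpose[of _ m]) simp
    also have "mat m m (\<lambda>(i, j). transpose_mat ?Y $$ (q i, j)) =
        transpose_mat (mat m m (\<lambda>(i, j). f i (xs ! j)))"
      by (rule eq_matI) (auto simp: yq ql)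
    also have "det \<dots> = det (mat m m (\<lambda>(i, j). f i (xs ! j)))" by (rule det_transpose[of _ m]) simp
    finally show ?thesis .
  qed
  have "signof q * signof q = (1 :: complex)" by (simp add: sign_def)
  then show ?thesis by (intro exI[of _ "signof q"] conjI allI eq)
qed

lemma multihom_scale:
  assumes "multihom s J a F"
    and "\<And>l i. l \<in> {1..s} \<Longrightarrow> i \<in> J l \<Longrightarrow> Q l i = c l * P l i"
  shows "F Q = (\<Prod>l\<in>{1..s}. c l ^ a l) * F P"
  using assms(1)
proof induction
  case (coord l i)
  have "(\<Prod>m\<in>{1..s}. c m ^ (if m = l then 1 else 0)) = (\<Prod>m\<in>{1..s}. if m = l then c m else 1)"
    by (intro prod.cong) auto
  also have "\<dots> = c l" using coord(1) by simp
  finally show ?case using assms(2)[OF coord] by simp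
next
  case (mult a F b G)
  then show ?case by (simp add: power_add prod.distrib)
qed (simp_all add: algebra_simps)

lemma multihom_cong:
  assumes "multihom s J a F"
    and "\<And>l i. l \<in> {1..s} \<Longrightarrow> i \<in> J l \<Longrightarrow> Q l i = P l i"
  shows "F Q = F P"
  using multihom_scale[OF assms(1), of Q "\<lambda>_. 1" P] assms(2) by simp

text \<open>
  Where \<open>C l i = 0\<close> the substituted coordinate is the zero polynomial, which has every multidegree; so \<open>\<kappa>\<close> may
  take arbitrary values there.
\<close>

lemma multihom_substitute:
  assumes "multihom s J' a F"
    and \<kappa>: "\<And>l i. l \<in> {1..s} \<Longrightarrow> i \<in> J' l \<Longrightarrow> C l i \<noteq> 0 \<Longrightarrow> \<kappa> l i \<in> J l"
  shows "multihom s J a (\<lambda>P. F (\<lambda>l i. C l i * P l (\<kappa> l i)))"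
  using assms(1)
proof induction
  case (coord l i)
  show ?case
  proof (cases "C l i = 0")
    case True
    then show ?thesis by (simp add: multihom.zero)
  next
    case False
    then have "multihom s J (\<lambda>m. 0 + (if m = l then 1 else 0)) (\<lambda>P. C l i * P l (\<kappa> l i))"
      using coord \<kappa> by (intro multihom.mult multihom.const multihom.coord) auto
    then show ?thesis by simp
  qed
qed (auto intro: multihom.intros)

lemma multihom_isCont:
  assumes "multihom s J a F"
    and "\<And>l i. l \<in> {1..s} \<Longrightarrow> i \<in> J l \<Longrightarrow> isCont (\<lambda>t. P t l i) (z :: complex)"
  shows "isCont (\<lambda>t. F (P t)) z"
  using assms(1) by induction (auto intro!: continuous_intros assms(2))

lemma hcoords_bases:
  assumes "P \<in> hcoords s r x"
  obtains b where "\<And>l. l \<in> {1..s} \<Longrightarrow> ordered_basis (r l) (b l) (x l)"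
    "\<And>l. l \<in> {1..s} \<Longrightarrow> P l = plucker (r l) (b l)"
proof -
  obtain b where "\<forall>l\<in>{1..s}. ordered_basis (r l) (b l) (x l) \<and> P l = plucker (r l) (b l)"
    using assms unfolding hcoords_def by (elim CollectE exE) (rule that)
  then show ?thesis by (intro that[of b]) simp_all
qed

lemma hcoords_scale:
  assumes "P \<in> hcoords s r x" "Q \<in> hcoords s r x"
  obtains c where "\<And>l. l \<in> {1..s} \<Longrightarrow> c l \<noteq> 0" "\<And>l I. l \<in> {1..s} \<Longrightarrow> Q l I = c l * P l I"
proof -
  obtain b where b: "\<And>l. l \<in> {1..s} \<Longrightarrow> ordered_basis (r l) (b l) (x l)"
    "\<And>l. l \<in> {1..s} \<Longrightarrow> P l = plucker (r l) (b l)"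
    by (rule hcoords_bases[OF assms(1)], rule that)
  obtain b' where b': "\<And>l. l \<in> {1..s} \<Longrightarrow> ordered_basis (r l) (b' l) (x l)"
    "\<And>l. l \<in> {1..s} \<Longrightarrow> Q l = plucker (r l) (b' l)"
    by (rule hcoords_bases[OF assms(2)], rule that)
  define c where "c l = (SOME c. c \<noteq> 0 \<and> (\<forall>I. Q l I = c * P l I))" for l
  have c: "c l \<noteq> 0 \<and> (\<forall>I. Q l I = c l * P l I)" if l: "l \<in> {1..s}" for l
  proof -
    obtain k where k: "k \<noteq> 0" "\<And>I. plucker (r l) (b' l) I = k * plucker (r l) (b l) I"
      by (rule plucker_base_change[OF b(1)[OF l] b'(1)[OF l]], rule that)
    have "k \<noteq> 0 \<and> (\<forall>I. Q l I = k * P l I)"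
      unfolding b(2)[OF l] b'(2)[OF l] using k by simp
    then show ?thesis unfolding c_def by (rule someI)
  qed
  show ?thesis
  proof (rule that)
    show "c l \<noteq> 0" if "l \<in> {1..s}" for l using c[OF that] by simp
    show "Q l I = c l * P l I" if "l \<in> {1..s}" for l I using c[OF that] by simp
  qed
qed

lemma hcoords_exists:
  assumes "x \<in> Gr_prod N s r"
  obtains P where "P \<in> hcoords s r x"
proof -
  have "\<forall>l\<in>{1..s}. \<exists>b. ordered_basis (r l) b (x l)"
  proof
    fix l assume "l \<in> {1..s}"
    then have "x l \<in> Gr N (r l)" using assms by (auto simp: Gr_prod_def)
    then obtain b where "ordered_basis (r l) b (x l)" by (rule ordered_basis_exists)
    then show "\<exists>b. ordered_basis (r l) b (x l)" by (rule exI[of _ b])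
  qed
  from bchoice[OF this] obtain b where "\<forall>l\<in>{1..s}. ordered_basis (r l) (b l) (x l)"
    by (elim exE) (rule that)
  then have "(\<lambda>l. plucker (r l) (b l)) \<in> hcoords s r x" by (auto simp: hcoords_def)
  then show ?thesis using that by blast
qed

lemma hcoords_multihom_scale:
  assumes "P \<in> hcoords s r x" "Q \<in> hcoords s r x"
  obtains c where "\<And>a. (\<Prod>l\<in>{1..s}. c l ^ a l) \<noteq> (0 :: complex)"
    "\<And>J a F. multihom s J a F \<Longrightarrow> F Q = (\<Prod>l\<in>{1..s}. c l ^ a l) * F P"
proof -
  obtain c where c: "\<And>l. l \<in> {1..s} \<Longrightarrow> c l \<noteq> 0" "\<And>l I. l \<in> {1..s} \<Longrightarrow> Q l I = c l * P l I"
    by (rule hcoords_scale[OF assms], rule that)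
  show ?thesis
  proof (rule that)
    show "(\<Prod>l\<in>{1..s}. c l ^ a l) \<noteq> 0" for a
      using c(1) by (simp add: prod_zero_iff)
    show "F Q = (\<Prod>l\<in>{1..s}. c l ^ a l) * F P" if "multihom s J a F" for J a F
      by (rule multihom_scale[OF that c(2)])
  qed
qed

text \<open>
  Two points of \<open>hcoords s r x\<close> differ by a nonzero scalar in each group of coordinates, and a multihomogeneous
  polynomial picks up a monomial in these scalars.
\<close>

lemma multihom_nonzero_indep:
  assumes F: "multihom s J a F" and P: "P \<in> hcoords s r x"
  shows "(\<forall>Q\<in>hcoords s r x. F Q \<noteq> 0) \<longleftrightarrow> F P \<noteq> 0"
proof
  assume *: "F P \<noteq> 0"
  show "\<forall>Q\<in>hcoords s r x. F Q \<noteq> 0"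
  proof
    fix Q assume Q: "Q \<in> hcoords s r x"
    obtain c where c: "\<And>a. (\<Prod>l\<in>{1..s}. c l ^ a l) \<noteq> (0 :: complex)"
      and cF: "\<And>J a F. multihom s J a F \<Longrightarrow> F Q = (\<Prod>l\<in>{1..s}. c l ^ a l) * F P"
      by (rule hcoords_multihom_scale[OF P Q], rule that)
    show "F Q \<noteq> 0"
      using no_zero_divisors[OF c *, of a] cF[OF F] by (simp only: not_False_eq_True)
  qed
qed (use P in blast)

lemma openin_nonvanishing:
  assumes "multihom s (plucker_index N r) a F"
  shows "openin (zariski N s r X) {x \<in> X. \<forall>P\<in>hcoords s r x. F P \<noteq> 0}"
  unfolding zariski_def using assms by (intro topology_generated_by_Basis) blast

lemma plucker_nonzero:
  assumes "ordered_basis m b U" "ordered_basis m b' U" "plucker m b I \<noteq> 0"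
  shows "plucker m b' I \<noteq> 0"
proof -
  obtain c where "c \<noteq> 0" "\<And>I. plucker m b' I = c * plucker m b I"
    by (rule plucker_base_change[OF assms(1,2)], rule that)
  then show ?thesis using assms(3) by simp
qed

text \<open>
  If \<open>e\<^sub>k\<close> is not in \<open>U\<close>, the coordinates other than the \<open>k\<close>-th one separate the points of \<open>U\<close>. Thus
  \<open>e\<^sub>k \<in> U\<close> is expressed by the vanishing of the Pluecker coordinates whose index set omits \<open>k\<close>.
\<close>

lemma minor_avoiding:
  assumes U: "U \<in> Gr N m" and k: "k \<in> {1..N}" "basis_vec k \<notin> U"
  obtains I b where "I \<subseteq> {1..N}" "k \<notin> I" "card I = m" "ordered_basis m b U" "plucker m b I = 1"
proof -
  have sub: "cvs.subspace U" and UN: "U \<subseteq> cspace N" using U by (auto simp: Gr_def)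
  have inj: "v = 0" if v: "v \<in> U" "\<forall>i\<in>{1..N} - {k}. v i = 0" for v
  proof (rule ccontr)
    assume "v \<noteq> 0"
    have vi: "v i = 0" if "i \<noteq> k" for i
      using v UN that by (cases "i \<in> {1..N}") (auto simp: cspace_def)
    have "v k \<noteq> 0"
    proof
      assume "v k = 0"
      then have "v i = 0" for i using vi by (cases "i = k") auto
      then show False using \<open>v \<noteq> 0\<close> by (auto simp: fun_eq_iff)
    qed
    then have "basis_vec k = cscale (1 / v k) v"
      using vi by (auto simp: fun_eq_iff basis_vec_def cscale_def)
    then show False using k(2) v(1) cvs.subspace_scale[OF sub] by simp
  qed
  show ?thesis
  proof (rule nonzero_minor_exists[OF U, of "{1..N} - {k}" "{}"])
    fix I b assume "I \<subseteq> {1..N} - {k}" "card I = m" "ordered_basis m b U" "plucker m b I = 1"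
    then show ?thesis by (intro that[of I b]) auto
  qed (use inj in auto)
qed

text \<open>
  The dual statement: the \<open>k\<close>-th coordinate vanishes on \<open>U\<close> if and only if all Pluecker coordinates whose index
  set contains \<open>k\<close> do.
\<close>

lemma minor_containing:
  assumes U: "U \<in> Gr N m" and v: "v \<in> U" "v k \<noteq> 0"
  obtains I b where "I \<subseteq> {1..N}" "k \<in> I" "card I = m" "ordered_basis m b U" "plucker m b I = 1"
proof -
  have UN: "U \<subseteq> cspace N" using U by (auto simp: Gr_def)
  then have k: "k \<in> {1..N}" using v by (auto simp: cspace_def)
  have inj: "w = 0" if w: "w \<in> U" "\<forall>i\<in>{1..N}. w i = 0" for w
  proof
    fix i show "w i = 0 i" using w UN by (cases "i \<in> {1..N}") (auto simp: cspace_def)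
  qed
  show ?thesis
  proof (rule nonzero_minor_exists[OF U, of "{1..N}" "{k}"])
    show "\<exists>v\<in>U. v i \<noteq> 0 \<and> (\<forall>j\<in>{k} - {i}. v j = 0)" if "i \<in> {k}" for i
      using v that by auto
    fix I b assume "{k} \<subseteq> I" "I \<subseteq> {1..N}" "card I = m" "ordered_basis m b U" "plucker m b I = 1"
    then show ?thesis by (intro that[of I b]) auto
  qed (use inj k in auto)
qed

lemma hcoordsI:
  assumes "\<And>l. l \<in> {1..s} \<Longrightarrow> ordered_basis (r l) (b l) (x l)"
  shows "(\<lambda>l. plucker (r l) (b l)) \<in> hcoords s r x"
  unfolding hcoords_def by (intro CollectI exI[of _ b] ballI conjI refl assms)

lemma hcoords_basis_at:
  assumes "P \<in> hcoords s r x" "l \<in> {1..s}"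
  obtains b where "ordered_basis (r l) b (x l)" "P l = plucker (r l) b"
proof (rule hcoords_bases[OF assms(1)])
  fix b assume "\<And>l. l \<in> {1..s} \<Longrightarrow> ordered_basis (r l) (b l) (x l)"
    "\<And>l. l \<in> {1..s} \<Longrightarrow> P l = plucker (r l) (b l)"
  from this[OF assms(2)] show thesis by (rule that)
qed

section \<open>Curves and the Zariski topology\<close>

lemma isCont_plucker:
  assumes "\<And>i k. i \<in> {1..m} \<Longrightarrow> isCont (\<lambda>t. b t i k) (z :: complex)"
  shows "isCont (\<lambda>t. plucker m (b t) I) z"
proof -
  let ?A = "\<lambda>t. mat m m (\<lambda>(i, j). b t (Suc i) (sorted_list_of_set I ! j))"
  have "plucker m (b t) I = (\<Sum>p\<in>{p. p permutes {0..<m}}. signof p *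
      (\<Prod>i\<in>{0..<m}. b t (Suc i) (sorted_list_of_set I ! p i)))" for t
  proof -
    have "plucker m (b t) I = (\<Sum>p\<in>{p. p permutes {0..<m}}. signof p * (\<Prod>i\<in>{0..<m}. ?A t $$ (i, p i)))"
      unfolding plucker_def by (rule det_def') simp
    also have "\<dots> = (\<Sum>p\<in>{p. p permutes {0..<m}}. signof p *
        (\<Prod>i\<in>{0..<m}. b t (Suc i) (sorted_list_of_set I ! p i)))"
    proof (intro sum.cong arg_cong2[of _ _ _ _ "(*)"] prod.cong refl)
      fix p i assume p: "p \<in> {p. p permutes {0..<m}}" and i: "i \<in> {0..<m}"
      then have "p i \<in> {0..<m}" using permutes_in_image[of p "{0..<m}" i] by simp
      then show "?A t $$ (i, p i) = b t (Suc i) (sorted_list_of_set I ! p i)" using i by simp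
    qed
    finally show ?thesis .
  qed
  then have "(\<lambda>t. plucker m (b t) I) = (\<lambda>t. \<Sum>p\<in>{p. p permutes {0..<m}}. signof p *
      (\<Prod>i\<in>{0..<m}. b t (Suc i) (sorted_list_of_set I ! p i)))" by (simp add: fun_eq_iff)
  then show ?thesis by (simp only:) (auto intro!: continuous_intros assms)
qed

text \<open>
  The Zariski topology is coarser than the classical one: a polynomial in the Pluecker coordinates that does not
  vanish at \<open>y\<close> does not vanish at \<open>c t\<close> for small \<open>t\<close>, by continuity. Instead of \<open>c 0\<close>, the
  limit \<open>y\<close> is given by the bases \<open>b 0 l\<close>; the flags \<open>c t\<close> may degenerate for exceptional values of \<open>t\<close>.
\<close>

lemma curve_eventually_in_open:
  fixes c :: "complex \<Rightarrow> gpoint" and b :: "complex \<Rightarrow> nat \<Rightarrow> nat \<Rightarrow> cvec"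
  assumes ev: "\<forall>\<^sub>F t in at 0. c t \<in> X \<and> (\<forall>l\<in>{1..s}. ordered_basis (r l) (b t l) (c t l))"
    and y: "\<And>l. l \<in> {1..s} \<Longrightarrow> ordered_basis (r l) (b 0 l) (y l)"
    and cont: "\<And>l i k. l \<in> {1..s} \<Longrightarrow> i \<in> {1..r l} \<Longrightarrow> isCont (\<lambda>t. b t l i k) 0"
    and O: "openin (zariski N s r X) U" "y \<in> U"
  shows "\<forall>\<^sub>F t in at 0. c t \<in> U"
proof -
  have "generate_topology_on {{x \<in> X. \<forall>P\<in>hcoords s r x. F P \<noteq> 0} | F a. multihom s (plucker_index N r) a F} U"
    using O(1) unfolding zariski_def by (rule openin_topology_generated_by)
  from this O(2) show ?thesis
  proof induction
    case Empty
    then show ?case by simp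
  next
    case (Int A B)
    then have "\<forall>\<^sub>F t in at 0. c t \<in> A" "\<forall>\<^sub>F t in at 0. c t \<in> B" by auto
    then show ?case by eventually_elim simp
  next
    case (UN K)
    then obtain A where A: "A \<in> K" "y \<in> A" by auto
    then have "\<forall>\<^sub>F t in at 0. c t \<in> A" using UN by blast
    then show ?case using A(1) by (auto elim: eventually_mono)
  next
    case (Basis A)
    then obtain F a where A: "A = {x \<in> X. \<forall>P\<in>hcoords s r x. F P \<noteq> 0}"
      and F: "multihom s (plucker_index N r) a F"
      unfolding mem_Collect_eq by (elim exE conjE) (rule that)
    define P where "P t = (\<lambda>l. plucker (r l) (b t l))" for t
    have "P 0 \<in> hcoords s r y" unfolding P_def by (rule hcoordsI[OF y])
    then have F0: "F (P 0) \<noteq> 0" using Basis(2) unfolding A by auto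
    have "isCont (\<lambda>t. F (P t)) 0"
      by (rule multihom_isCont[OF F]) (unfold P_def, intro isCont_plucker cont)
    then have "((\<lambda>t. F (P t)) \<longlongrightarrow> F (P 0)) (at 0)" by (simp only: isCont_def)
    then have "\<forall>\<^sub>F t in at 0. F (P t) \<noteq> 0" using F0 by (rule tendsto_imp_eventually_ne)
    with ev show ?case
    proof eventually_elim
      case (elim t)
      then have "P t \<in> hcoords s r (c t)" unfolding P_def by (intro hcoordsI) simp
      then show ?case using elim multihom_nonzero_indep[OF F, of "P t" r "c t"] unfolding A by blast
    qed
  qed
qed

section \<open>Linear images of flags\<close>

lemma clinear_mat_act: "clinear (mat_act N A)"
  by (rule clinearI)
    (auto simp: mat_act_def cscale_def fun_eq_iff algebra_simps sum.distrib sum_distrib_left)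

lemma mat_act_inj:
  assumes A: "A \<in> SL N" and v: "v \<in> cspace N" "mat_act N A v = 0"
  shows "v = 0"
proof (rule ccontr)
  assume "v \<noteq> 0"
  have Ac: "A \<in> carrier_mat N N" "det A = 1" using A by (auto simp: SL_def)
  let ?v = "vec N (\<lambda>i. v (Suc i))"
  have "A *\<^sub>v ?v = 0\<^sub>v N"
  proof (rule eq_vecI)
    fix i assume "i < dim_vec (0\<^sub>v N :: complex vec)"
    then have i: "i < N" by simp
    have "mat_act N A v (Suc i) = (\<Sum>j\<in>{0..<N}. A $$ (i, j) * v (Suc j))"
      using i by (simp add: mat_act_def sum_Suc_lessThan[unfolded One_nat_def])
    then show "(A *\<^sub>v ?v) $ i = 0\<^sub>v N $ i"
      using i v(2) Ac(1) by (simp add: scalar_prod_def row_def)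
  qed (use Ac in auto)
  moreover have "?v \<noteq> 0\<^sub>v N"
  proof
    assume z: "?v = 0\<^sub>v N"
    have "v k = 0" for k
    proof (cases "k \<in> {1..N}")
      case True
      then have "k - 1 < N" "Suc (k - 1) = k" by auto
      then show ?thesis using arg_cong[OF z, of "\<lambda>u. u $ (k - 1)"] by (simp del: One_nat_def)
    next
      case False
      then show ?thesis using v(1) by (simp add: cspace_def)
    qed
    then show False using \<open>v \<noteq> 0\<close> by (auto simp: fun_eq_iff)
  qed
  moreover have "?v \<in> carrier_vec N" by simp
  ultimately have "det A = 0"
    using det_0_iff_vec_prod_zero[OF Ac(1)] by blast
  then show False using Ac(2) by simp
qed

lemma mat_act_Borel_cspace:
  assumes A: "A \<in> Borel N" and v: "v \<in> cspace k"
  shows "mat_act N A v \<in> cspace k"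
proof -
  have "mat_act N A v i = 0" if i: "i \<notin> {1..k}" for i
  proof (cases "i \<in> {1..N}")
    case True
    have "A $$ (i - 1, j - 1) * v j = 0" if j: "j \<in> {1..N}" for j
    proof (cases "j \<in> {1..k}")
      case True
      then have "j - 1 < i - 1" using i \<open>i \<in> {1..N}\<close> by auto
      moreover have "i - 1 < dim_row A" using A \<open>i \<in> {1..N}\<close> by (auto simp: Borel_def SL_def)
      ultimately have "A $$ (i - 1, j - 1) = 0"
        using A by (auto simp: Borel_def upper_triangular_def)
      then show ?thesis by simp
    next
      case False
      then show ?thesis using v by (simp add: cspace_def)
    qed
    then show ?thesis using True by (auto simp: mat_act_def intro!: sum.neutral)
  next
    case False
    then show ?thesis unfolding mat_act_def by (simp only: if_False)
  qed
  then show ?thesis by (simp add: cspace_def)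
qed

lemma mat_act_basis_vec:
  assumes "m \<in> {1..N}"
  shows "mat_act N A (basis_vec m) = (\<lambda>i. if i \<in> {1..N} then A $$ (i - 1, m - 1) else 0)"
proof
  fix i
  have "(\<Sum>j\<in>{1..N}. A $$ (i - 1, j - 1) * basis_vec m j) = (\<Sum>j\<in>{1..N}. if j = m then A $$ (i - 1, j - 1) else 0)"
    by (intro sum.cong) (auto simp: basis_vec_def)
  also have "\<dots> = A $$ (i - 1, m - 1)" using assms by simp
  finally show "mat_act N A (basis_vec m) i = (if i \<in> {1..N} then A $$ (i - 1, m - 1) else 0)"
    by (simp add: mat_act_def)
qed

lemma image_subspace_eq:
  assumes f: "clinear f" and U: "cvs.subspace U" "U \<subseteq> cspace N" "f ` U \<subseteq> U"
    and inj: "\<And>v. v \<in> U \<Longrightarrow> f v = 0 \<Longrightarrow> v = 0"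
  shows "f ` U = U"
proof (rule dim_subspace_eq)
  interpret f: Vector_Spaces.linear cscale cscale f by (rule f)
  show "cvs.subspace (f ` U)" using U(1) by (rule f.subspace_image)
  show "cvs.dim U \<le> cvs.dim (f ` U)" using dim_linear_image[OF f U(1,2) inj] by simp
qed (use U in auto)

section \<open>The variety of sandwiched flags\<close>

locale flag_dims =
  fixes n s :: nat and d :: "nat \<Rightarrow> nat"
  assumes d_pos: "\<forall>l\<in>{1..s}. 0 < d l"
    and d_mono: "strict_mono_on {1..s} d"
    and d_le: "d s \<le> n"
begin

abbreviation "N \<equiv> 2 * n"
abbreviation "r \<equiv> \<lambda>l. 2 * d l - 1"
abbreviation "\<sigma> \<equiv> sigma_perm n s d"

text \<open>
  The subspace \<open>y l\<close> of dimension \<open>2 d\<^sub>l - 1\<close> is determined by its image in a space of dimension \<open>n + 1\<close>, namely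
  \<open>cspace (n + d l)\<close> modulo \<open>cspace (d l - 1)\<close>; this image has dimension \<open>d\<^sub>l\<close>.
\<close>

definition sandwiched_flags :: "gpoint set" where
  "sandwiched_flags = {y \<in> partial_flags N s r. \<forall>l\<in>{1..s}. cspace (d l - 1) \<subseteq> y l \<and> y l \<subseteq> cspace (n + d l)}"

lemma d_less: "1 \<le> i \<Longrightarrow> i < j \<Longrightarrow> j \<le> s \<Longrightarrow> d i < d j"
  using d_mono by (auto simp: strict_mono_on_def)

lemma d_le_mono: "1 \<le> i \<Longrightarrow> i \<le> j \<Longrightarrow> j \<le> s \<Longrightarrow> d i \<le> d j"
  using d_less[of i j] by (cases "i = j") auto

lemma d_bounds:
  assumes "l \<in> {1..s}"
  shows "1 \<le> d l" "d l \<le> n"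
  using assms bspec[OF d_pos assms] d_le d_le_mono[of l s] by auto

lemma sandwichedD:
  assumes "y \<in> sandwiched_flags" "l \<in> {1..s}"
  shows "cvs.subspace (y l)" "y l \<subseteq> cspace N" "cvs.dim (y l) = r l"
    "cspace (d l - 1) \<subseteq> y l" "y l \<subseteq> cspace (n + d l)"
  using assms by (auto simp: sandwiched_flags_def partial_flags_def Gr_prod_def Gr_def PiE_def Pi_def)

lemma sandwiched_nested:
  assumes y: "y \<in> sandwiched_flags" and "1 \<le> i" "i \<le> j" "j \<le> s"
  shows "y i \<subseteq> y j"
  using assms(3,4)
proof (induction j rule: dec_induct)
  case base
  then show ?case by simp
next
  case (step j)
  have "\<forall>l\<in>{1..<s}. y l \<subseteq> y (l + 1)" using y by (simp add: sandwiched_flags_def partial_flags_def)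
  then have "y j \<subseteq> y (j + 1)" using step assms(2) by (auto elim!: ballE[of _ _ j])
  then show ?case using step by auto
qed

lemma sandwichedI:
  assumes "y \<in> extensional {1..s}"
    and "\<And>l. l \<in> {1..s} \<Longrightarrow> cvs.subspace (y l)"
    and "\<And>l. l \<in> {1..s} \<Longrightarrow> cvs.dim (y l) = r l"
    and "\<And>l. l \<in> {1..s} \<Longrightarrow> cspace (d l - 1) \<subseteq> y l"
    and "\<And>l. l \<in> {1..s} \<Longrightarrow> y l \<subseteq> cspace (n + d l)"
    and "\<And>l. l \<in> {1..<s} \<Longrightarrow> y l \<subseteq> y (l + 1)"
  shows "y \<in> sandwiched_flags"
proof -
  have "y l \<subseteq> cspace N" if l: "l \<in> {1..s}" for l
    using assms(5)[OF l] d_bounds[OF l] cspace_mono[of "n + d l" N] by auto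
  then show ?thesis using assms
    by (auto simp: sandwiched_flags_def partial_flags_def Gr_prod_def Gr_def PiE_def Pi_def)
qed

text \<open>
  The neighbourhood is the nonvanishing set of one Pluecker coordinate, at an index set that omits some
  \<open>k < d\<^sub>l\<close> or contains some \<open>k > n + d\<^sub>l\<close>; such coordinates vanish on all sandwiched flags.
\<close>

lemma sandwiched_complement_open:
  assumes y: "y \<in> partial_flags N s r" "y \<notin> sandwiched_flags"
  obtains U where "openin (zariski N s r (partial_flags N s r)) U" "y \<in> U" "U \<inter> sandwiched_flags = {}"
proof -
  note found = that
  have key: thesis if l: "l \<in> {1..s}" and I: "I \<subseteq> {1..N}" "card I = r l"
    and b: "ordered_basis (r l) b (y l)" "plucker (r l) b I = 1"
    and van: "\<And>z b. z \<in> sandwiched_flags \<Longrightarrow> ordered_basis (r l) b (z l) \<Longrightarrow> plucker (r l) b I = 0"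
    for l I b
  proof -
    let ?U = "{x \<in> partial_flags N s r. \<forall>P\<in>hcoords s r x. P l I \<noteq> 0}"
    have "multihom s (plucker_index N r) (\<lambda>m. if m = l then 1 else 0) (\<lambda>P. P l I)"
      using l I by (intro multihom.coord) (auto simp: plucker_index_def)
    then have "openin (zariski N s r (partial_flags N s r)) ?U" by (rule openin_nonvanishing)
    moreover have "P l I \<noteq> 0" if P: "P \<in> hcoords s r y" for P
    proof -
      obtain b' where "ordered_basis (r l) b' (y l)" "P l = plucker (r l) b'"
        by (rule hcoords_basis_at[OF P l], rule that)
      then show ?thesis using plucker_nonzero[OF b(1), of b' I] b(2) by simp
    qed
    then have "y \<in> ?U" using y(1) by blast
    moreover have "z \<notin> ?U" if z: "z \<in> sandwiched_flags" for z
    proof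
      assume zU: "z \<in> ?U"
      then have "z \<in> Gr_prod N s r" by (simp add: partial_flags_def)
      then obtain P where P: "P \<in> hcoords s r z" by (rule hcoords_exists)
      obtain b' where "ordered_basis (r l) b' (z l)" "P l = plucker (r l) b'"
        by (rule hcoords_basis_at[OF P l], rule that)
      then have "P l I = 0" using van[OF z] by simp
      then show False using zU P by blast
    qed
    ultimately show thesis by (intro found[of ?U]) blast+
  qed
  obtain l where l: "l \<in> {1..s}" and "\<not> cspace (d l - 1) \<subseteq> y l \<or> \<not> y l \<subseteq> cspace (n + d l)"
    using y unfolding sandwiched_flags_def by blast
  then consider "\<not> cspace (d l - 1) \<subseteq> y l" | "\<not> y l \<subseteq> cspace (n + d l)" by blast
  moreover have U: "y l \<in> Gr N (r l)"
    using y(1) l by (auto simp: partial_flags_def Gr_prod_def PiE_def Pi_def)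
  then have sub: "cvs.subspace (y l)" and UN: "y l \<subseteq> cspace N" by (auto simp: Gr_def)
  ultimately show thesis
  proof cases
    case 1
    then have "\<not> basis_vec ` {1..d l - 1} \<subseteq> y l"
      using cvs.span_minimal[OF _ sub] unfolding span_basis_vec_cspace[symmetric] by blast
    then obtain k where k: "k \<in> {1..d l - 1}" "basis_vec k \<notin> y l" by blast
    have kN: "k \<in> {1..N}" using k(1) d_bounds[OF l] by auto
    obtain I b where I: "I \<subseteq> {1..N}" "k \<notin> I" "card I = r l"
      and b: "ordered_basis (r l) b (y l)" "plucker (r l) b I = 1"
      by (rule minor_avoiding[OF U kN k(2)], rule that)
    show thesis
    proof (rule key[OF l I(1,3) b])
      fix z b assume z: "z \<in> sandwiched_flags" and b: "ordered_basis (r l) b (z l)"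
      have "basis_vec k \<in> z l"
        using sandwichedD(4)[OF z l] basis_vec_in_cspace[OF k(1)] by blast
      moreover have "basis_vec k i = 0" if "i \<in> I" for i
        using that I(2) by (auto simp: basis_vec_def)
      moreover have "finite I" using I(1) finite_subset by blast
      ultimately show "plucker (r l) b I = 0"
        using basis_vec_neq_0 by (intro plucker_eq_0_row[OF b I(3)])
    qed
  next
    case 2
    then obtain v k where v: "v \<in> y l" "v k \<noteq> 0" "k \<notin> {1..n + d l}" by (auto simp: cspace_def)
    obtain I b where I: "I \<subseteq> {1..N}" "k \<in> I" "card I = r l"
      and b: "ordered_basis (r l) b (y l)" "plucker (r l) b I = 1"
      by (rule minor_containing[OF U v(1,2)], rule that)
    show thesis
    proof (rule key[OF l I(1,3) b])
      fix z b assume z: "z \<in> sandwiched_flags" and b: "ordered_basis (r l) b (z l)"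
      show "plucker (r l) b I = 0"
        using I finite_subset[OF I(1)] sandwichedD(5)[OF z l] v(3)
        by (intro plucker_eq_0_column[OF b, of I k]) (auto simp: cspace_def)
    qed
  qed
qed

lemma closure_sandwiched_subset:
  assumes S: "S \<subseteq> sandwiched_flags"
  shows "zariski N s r (partial_flags N s r) closure_of S \<subseteq> sandwiched_flags"
proof
  fix y assume y: "y \<in> zariski N s r (partial_flags N s r) closure_of S"
  then have yX: "y \<in> partial_flags N s r" by (simp add: in_closure_of topspace_zariski)
  show "y \<in> sandwiched_flags"
  proof (rule ccontr)
    assume "y \<notin> sandwiched_flags"
    then obtain U where U: "openin (zariski N s r (partial_flags N s r)) U" "y \<in> U"
      "U \<inter> sandwiched_flags = {}" by (rule sandwiched_complement_open[OF yX])
    then obtain x where "x \<in> S" "x \<in> U" using y unfolding in_closure_of by blast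
    then show False using U(3) S by blast
  qed
qed

section \<open>The Borel orbit of the permutation flag\<close>

lemma dext_eq_d: "l \<in> {1..s} \<Longrightarrow> dext n s d l = d l"
  by (auto simp: dext_def)

text \<open>
  The blocks of the definition of \<open>\<sigma>\<close> that lie below \<open>2 d\<^sub>l\<close> are those with \<open>i < l\<close>. Their first parts are mapped
  to the numbers below \<open>d\<^sub>l\<close>, their second parts to numbers between \<open>n + 1\<close> and \<open>n + d\<^sub>l\<close>. One inclusion is
  enough, since both sets have \<open>2 d\<^sub>l - 1\<close> elements.
\<close>

lemma sigma_image:
  assumes l: "l \<in> {1..s}"
  shows "\<sigma> ` {1..r l} = {1..d l - 1} \<union> {n + 1..n + d l}"
proof (rule card_subset_eq)
  let ?D = "dext n s d"
  note dl = d_bounds[OF l]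
  have mono: "?D i \<le> ?D j" if "i \<le> j" "j \<le> s + 1" for i j
    using dext_mono_le[OF d_pos d_mono d_le that] .
  show "\<sigma> ` {1..r l} \<subseteq> {1..d l - 1} \<union> {n + 1..n + d l}"
  proof
    fix x assume "x \<in> \<sigma> ` {1..r l}"
    then obtain k where k: "k \<in> {1..r l}" "x = \<sigma> k" by blast
    have kN: "k \<in> {1..N}" using k(1) dl by auto
    have "k div 2 \<le> n" using kN by auto
    then obtain i where i: "i \<le> s" "?D i \<le> k div 2" "k div 2 < ?D (i + 1)"
      by (rule dext_interval[OF d_pos d_mono d_le])
    have "i < l"
    proof (rule ccontr)
      assume "\<not> i < l"
      then have "?D l \<le> ?D i" using mono[of l i] i(1) by simp
      then show False using i(2) k(1) dl dext_eq_d[OF l] by auto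
    qed
    then have D1: "?D (i + 1) \<le> d l" using mono[of "i + 1" l] l dext_eq_d[OF l] by simp
    have D0: "?D i < ?D (i + 1)" using dext_mono[OF d_pos d_mono d_le, of i "i + 1"] i(1) by simp
    show "x \<in> {1..d l - 1} \<union> {n + 1..n + d l}"
    proof (cases "k < ?D i + ?D (i + 1)")
      case True
      then have "\<sigma> k = k - ?D i"
        using sigma_perm_eq1[OF d_pos d_mono d_le kN i(1)] i(2) by auto
      then show ?thesis using True k D1 i(2) by auto
    next
      case False
      then have "\<sigma> k = n + 1 + k - ?D (i + 1)"
        using sigma_perm_eq2[OF d_pos d_mono d_le kN i(1)] i(3) by auto
      then show ?thesis using False k D1 D0 i(3) by auto
    qed
  qed
  have "inj_on \<sigma> {1..r l}"
    using permutes_inj[OF sigma_perm_permutes[OF d_pos d_mono d_le]] by (rule inj_on_subset) simp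
  then have "card (\<sigma> ` {1..r l}) = r l" by (simp add: card_image)
  moreover have "card ({1..d l - 1} \<union> {n + 1..n + d l}) = (d l - 1) + d l"
    using dl by (subst card_Un_disjoint) auto
  ultimately show "card (\<sigma> ` {1..r l}) = card ({1..d l - 1} \<union> {n + 1..n + d l})"
    using dl by simp
qed simp

lemma perm_flag_eq:
  assumes l: "l \<in> {1..s}"
  shows "perm_flag s r \<sigma> l = coord_space ({1..d l - 1} \<union> {n + 1..n + d l})"
proof -
  have "(\<lambda>k. basis_vec (\<sigma> k)) ` {1..r l} = basis_vec ` (\<sigma> ` {1..r l})" by auto
  then show ?thesis
    using l span_basis_vec[of "{1..d l - 1} \<union> {n + 1..n + d l}"]
    unfolding perm_flag_def sigma_image[OF l] by simp
qed

lemma perm_flag_sandwiched: "perm_flag s r \<sigma> \<in> sandwiched_flags"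
proof (rule sandwichedI)
  show "perm_flag s r \<sigma> \<in> extensional {1..s}" by (simp add: perm_flag_def)
  fix l assume l: "l \<in> {1..s}"
  note dl = d_bounds[OF l]
  show "cvs.subspace (perm_flag s r \<sigma> l)"
    unfolding perm_flag_eq[OF l] by (rule subspace_coord_space)
  have "card ({1..d l - 1} \<union> {n + 1..n + d l}) = (d l - 1) + d l"
    using dl by (subst card_Un_disjoint) auto
  then show "cvs.dim (perm_flag s r \<sigma> l) = r l"
    unfolding perm_flag_eq[OF l] using dl by (subst dim_coord_space) auto
  show "cspace (d l - 1) \<subseteq> perm_flag s r \<sigma> l"
    unfolding perm_flag_eq[OF l] cspace_eq_coord_space by (intro coord_space_mono) auto
  show "perm_flag s r \<sigma> l \<subseteq> cspace (n + d l)"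
    unfolding perm_flag_eq[OF l] cspace_eq_coord_space using dl by (intro coord_space_mono) auto
next
  fix l assume l: "l \<in> {1..<s}"
  then have l1: "l \<in> {1..s}" "l + 1 \<in> {1..s}" by auto
  have "d l \<le> d (l + 1)" using d_le_mono[of l "l + 1"] l by auto
  then show "perm_flag s r \<sigma> l \<subseteq> perm_flag s r \<sigma> (l + 1)"
    unfolding perm_flag_eq[OF l1(1)] perm_flag_eq[OF l1(2)] by (intro coord_space_mono) auto
qed

text \<open>
  Upper triangular matrices preserve each of the spaces \<open>cspace k\<close>.
\<close>

lemma flag_act_sandwiched:
  assumes A: "A \<in> Borel N" and y: "y \<in> sandwiched_flags"
  shows "flag_act N s A y \<in> sandwiched_flags"
proof (rule sandwichedI)
  have SL: "A \<in> SL N" using A by (simp add: Borel_def)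
  interpret f: Vector_Spaces.linear cscale cscale "mat_act N A" by (rule clinear_mat_act)
  show "flag_act N s A y \<in> extensional {1..s}" by (simp add: flag_act_def)
  fix l assume l: "l \<in> {1..s}"
  note yl = sandwichedD[OF y l] and dl = d_bounds[OF l]
  have eq: "flag_act N s A y l = mat_act N A ` y l" using l by (simp add: flag_act_def)
  show "cvs.subspace (flag_act N s A y l)" unfolding eq using yl(1) by (rule f.subspace_image)
  show "cvs.dim (flag_act N s A y l) = r l"
    unfolding eq yl(3)[symmetric] using mat_act_inj[OF SL] yl(2)
    by (intro dim_linear_image[OF clinear_mat_act yl(1,2)]) blast
  have "mat_act N A ` cspace (d l - 1) = cspace (d l - 1)"
  proof (rule image_subspace_eq[OF clinear_mat_act subspace_cspace order_refl])
    show "mat_act N A ` cspace (d l - 1) \<subseteq> cspace (d l - 1)"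
      using mat_act_Borel_cspace[OF A] by blast
    show "v = 0" if "v \<in> cspace (d l - 1)" "mat_act N A v = 0" for v
      using mat_act_inj[OF SL, of v] that yl(2,4) by blast
  qed
  then show "cspace (d l - 1) \<subseteq> flag_act N s A y l" unfolding eq using yl(4) by blast
  show "flag_act N s A y l \<subseteq> cspace (n + d l)"
    unfolding eq using yl(5) mat_act_Borel_cspace[OF A] by blast
next
  fix l assume l: "l \<in> {1..<s}"
  then have "y l \<subseteq> y (l + 1)" using sandwiched_nested[OF y, of l "l + 1"] by auto
  then show "flag_act N s A y l \<subseteq> flag_act N s A y (l + 1)" using l by (auto simp: flag_act_def)
qed

text \<open>
  The projection of \<open>\<complex>\<^bsup>2n\<^esup>\<close> along \<open>cspace n\<close>.
\<close>

definition high_part :: "cvec \<Rightarrow> cvec" where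
  "high_part v = (\<lambda>k. if k \<le> n then 0 else v k)"

lemma clinear_high_part: "clinear high_part"
  by (rule clinearI) (auto simp: high_part_def cscale_def fun_eq_iff)

lemma high_part_kernel: "U \<subseteq> cspace N \<Longrightarrow> {v \<in> U. high_part v = 0} = U \<inter> cspace n"
  by (auto simp: high_part_def cspace_def fun_eq_iff)

lemma high_part_image:
  assumes "v \<in> cspace (n + m)"
  shows "high_part v \<in> coord_space {n + 1..n + m}"
  using assms by (auto simp: high_part_def coord_space_def cspace_def)

text \<open>
  The kernel of the projection \<open>y l \<rightarrow> coord_space {n + 1..n + d l}\<close> is \<open>y l \<inter> cspace n\<close> and contains
  \<open>cspace (d l - 1)\<close>. As \<open>dim (y l) = (d\<^sub>l - 1) + d\<^sub>l\<close>, the kernel is minimal exactly when the image is maximal.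
\<close>

lemma low_high_duality:
  assumes y: "y \<in> sandwiched_flags" and l: "l \<in> {1..s}"
  shows "y l \<inter> cspace n \<subseteq> cspace (d l - 1) \<longleftrightarrow> coord_space {n + 1..n + d l} \<subseteq> high_part ` y l"
proof -
  interpret f: Vector_Spaces.linear cscale cscale high_part by (rule clinear_high_part)
  note yl = sandwichedD[OF y l] and dl = d_bounds[OF l]
  let ?K = "y l \<inter> cspace n" and ?H = "high_part ` y l" and ?C = "coord_space {n + 1..n + d l}"
  have rn: "r l = cvs.dim ?K + cvs.dim ?H"
    using rank_nullity[OF clinear_high_part yl(1,2)] unfolding high_part_kernel[OF yl(2)] yl(3) .
  have K: "cvs.subspace ?K" using yl(1) subspace_cspace by (rule cvs.subspace_inter)
  have EK: "cspace (d l - 1) \<subseteq> ?K" using yl(4) cspace_mono[of "d l - 1" n] dl by auto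
  have HC: "?H \<subseteq> ?C" using yl(5) high_part_image by blast
  have H: "cvs.subspace ?H" using yl(1) by (rule f.subspace_image)
  have CN: "?C \<subseteq> cspace N"
    unfolding cspace_eq_coord_space using dl by (intro coord_space_mono) auto
  have dC: "cvs.dim ?C = d l" by (simp add: dim_coord_space)
  show ?thesis
  proof
    assume "?K \<subseteq> cspace (d l - 1)"
    then have "?K = cspace (d l - 1)" using EK by blast
    then have "cvs.dim ?K = d l - 1" by (simp add: dim_cspace)
    then have "cvs.dim ?C \<le> cvs.dim ?H" using rn dC dl by simp
    then show "?C \<subseteq> ?H" using dim_subspace_eq[OF H subspace_coord_space HC CN] by simp
  next
    assume "?C \<subseteq> ?H"
    then have "?H = ?C" using HC by blast
    then have "cvs.dim ?K \<le> cvs.dim (cspace (d l - 1))" using rn dC dl by (simp add: dim_cspace)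
    moreover have "?K \<subseteq> cspace N" using yl(2) by blast
    ultimately have "cspace (d l - 1) = ?K"
      by (intro dim_subspace_eq[OF subspace_cspace K EK])
    then show "?K \<subseteq> cspace (d l - 1)" by simp
  qed
qed

definition borel_orbit :: "gpoint set" where
  "borel_orbit = (\<lambda>A. flag_act N s A (perm_flag s r \<sigma>)) ` Borel N"

lemma orbit_sandwiched: "borel_orbit \<subseteq> sandwiched_flags"
  unfolding borel_orbit_def using flag_act_sandwiched perm_flag_sandwiched by blast

text \<open>
  Let \<open>u\<^sub>k\<close> be a vector with high part \<open>e\<^bsub>n+k\<^esub>\<close> in the smallest member of the flag whose high part
  contains \<open>e\<^bsub>n+k\<^esub>\<close>. The matrix with columns \<open>e\<^sub>1, \<dots>, e\<^sub>n, u\<^sub>1, u\<^sub>2, \<dots>\<close>, completed by basis vectors,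
  is unipotent and maps the coordinate flag of \<open>\<sigma>\<close> into \<open>y\<close>; equality follows by dimension.
\<close>

lemma generic_in_orbit:
  assumes s1: "1 \<le> s" and y: "y \<in> sandwiched_flags"
    and gen: "\<And>l. l \<in> {1..s} \<Longrightarrow> y l \<inter> cspace n \<subseteq> cspace (d l - 1)"
  shows "y \<in> borel_orbit"
proof -
  have "\<exists>u. high_part u = basis_vec (n + k) \<and> u \<in> cspace N \<and> (\<forall>l\<in>{1..s}. k \<le> d l \<longrightarrow> u \<in> y l)"
    if k: "k \<in> {1..d s}" for k
  proof -
    \<comment> \<open>a vector chosen in the first possible member lies in all later ones\<close>
    define l where "l = (LEAST l. 1 \<le> l \<and> k \<le> d l)"
    have ls: "1 \<le> s \<and> k \<le> d s" using s1 k by simp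
    have l: "1 \<le> l \<and> k \<le> d l" unfolding l_def using ls by (rule LeastI)
    have "l \<le> s" unfolding l_def using ls by (rule Least_le)
    then have l1: "l \<in> {1..s}" using l by simp
    have "basis_vec (n + k) \<in> coord_space {n + 1..n + d l}"
      using l k by (auto simp: basis_vec_def coord_space_def)
    then have "basis_vec (n + k) \<in> high_part ` y l"
      using low_high_duality[OF y l1] gen[OF l1] by blast
    then obtain u where u: "u \<in> y l" "high_part u = basis_vec (n + k)" by auto
    have "u \<in> y l'" if l': "l' \<in> {1..s}" "k \<le> d l'" for l'
    proof -
      have "l \<le> l'" unfolding l_def using l' by (intro Least_le) simp
      then show ?thesis using sandwiched_nested[OF y, of l l'] l l' u(1) by auto
    qed
    then show ?thesis using u sandwichedD(2)[OF y l1] by (intro exI[of _ u]) auto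
  qed
  then have "\<forall>k\<in>{1..d s}. \<exists>u. high_part u = basis_vec (n + k) \<and> u \<in> cspace N \<and>
      (\<forall>l\<in>{1..s}. k \<le> d l \<longrightarrow> u \<in> y l)" by (intro ballI)
  from bchoice[OF this] obtain u where u: "\<forall>k\<in>{1..d s}. high_part (u k) = basis_vec (n + k) \<and>
      u k \<in> cspace N \<and> (\<forall>l\<in>{1..s}. k \<le> d l \<longrightarrow> u k \<in> y l)"
    by (elim exE) (rule that)
  have uh: "u k i = (if i = n + k then 1 else 0)" if k: "k \<in> {1..d s}" and i: "n < i" for k i
  proof -
    have "high_part (u k) i = basis_vec (n + k) i" using u k by simp
    then show ?thesis using i by (simp add: high_part_def basis_vec_def)
  qed
  \<comment> \<open>matrix indices start at 0, so column \<open>j = n + k - 1\<close> is \<open>u k\<close>\<close>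
  let ?c = "\<lambda>i j. if n \<le> j \<and> j < n + d s then u (j + 1 - n) (i + 1) else if i = j then 1 else 0"
  define A where "A = mat N N (\<lambda>(i, j). ?c i j)"
  have Ac: "A \<in> carrier_mat N N" by (simp add: A_def)
  have Aij: "A $$ (i, j) = ?c i j" if "i < N" "j < N" for i j
    using that by (simp add: A_def)
  have ut: "upper_triangular A"
    unfolding upper_triangular_def
  proof (intro allI impI)
    fix i j assume "i < dim_row A" "j < i"
    then have ij: "i < N" "j < N" "j < i" using Ac by auto
    show "A $$ (i, j) = 0"
    proof (cases "n \<le> j \<and> j < n + d s")
      case True
      then have "j + 1 - n \<in> {1..d s}" by auto
      then have "u (j + 1 - n) (i + 1) = 0" using uh[of "j + 1 - n" "i + 1"] ij True by auto
      then show ?thesis using Aij[OF ij(1,2)] True by simp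
    next
      case False
      then show ?thesis using Aij[OF ij(1,2)] ij(3) by auto
    qed
  qed
  have diag: "A $$ (i, i) = 1" if i: "i < N" for i
  proof (cases "n \<le> i \<and> i < n + d s")
    case True
    then have "i + 1 - n \<in> {1..d s}" by auto
    then have "u (i + 1 - n) (i + 1) = 1" using uh[of "i + 1 - n" "i + 1"] True by auto
    then show ?thesis using Aij[OF i i] True by simp
  qed (use Aij[OF i i] in auto)
  have "det A = prod_list (diag_mat A)" by (rule det_upper_triangular[OF ut Ac])
  also have "diag_mat A = replicate N 1"
    using Ac diag by (intro nth_equalityI) (auto simp: diag_mat_def)
  finally have "det A = 1" by simp
  then have AB: "A \<in> Borel N" using Ac ut by (simp add: Borel_def SL_def)
  then have SL: "A \<in> SL N" by (simp add: Borel_def)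
  interpret f: Vector_Spaces.linear cscale cscale "mat_act N A" by (rule clinear_mat_act)
  have col: "mat_act N A (basis_vec (n + k)) = u k" if k: "k \<in> {1..d s}" for k
  proof
    fix i
    have ds: "d s \<le> n" by (rule d_le)
    have kN: "n + k \<in> {1..N}" using k ds by auto
    show "mat_act N A (basis_vec (n + k)) i = u k i"
    proof (cases "i \<in> {1..N}")
      case True
      have "A $$ (i - 1, n + k - 1) = ?c (i - 1) (n + k - 1)"
        using True kN by (intro Aij) auto
      also have "\<dots> = u k i" using k True by auto
      finally show ?thesis using True unfolding mat_act_basis_vec[OF kN] by simp
    next
      case False
      then have "u k i = 0" using u k by (auto simp: cspace_def)
      then show ?thesis unfolding mat_act_basis_vec[OF kN] using False by (simp only: if_False)
    qed
  qed
  have "mat_act N A ` perm_flag s r \<sigma> l = y l" if l: "l \<in> {1..s}" for l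
  proof (rule dim_subspace_eq)
    note yl = sandwichedD[OF y l] and dl = d_bounds[OF l]
      and pl = sandwichedD[OF perm_flag_sandwiched l]
    let ?S = "{1..d l - 1} \<union> {n + 1..n + d l}"
    have dls: "d l \<le> d s" using d_le_mono[of l s] l by auto
    show "cvs.subspace (mat_act N A ` perm_flag s r \<sigma> l)" using pl(1) by (rule f.subspace_image)
    show "cvs.subspace (y l)" "y l \<subseteq> cspace N" by (rule yl)+
    have "cvs.dim (mat_act N A ` perm_flag s r \<sigma> l) = r l"
      unfolding pl(3)[symmetric] using mat_act_inj[OF SL] pl(2)
      by (intro dim_linear_image[OF clinear_mat_act pl(1,2)]) blast
    then show "cvs.dim (y l) \<le> cvs.dim (mat_act N A ` perm_flag s r \<sigma> l)" using yl(3) by simp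
    have "mat_act N A (basis_vec k) \<in> y l" if k: "k \<in> ?S" for k
    proof (cases "k \<le> n")
      case True
      then have "k \<in> {1..d l - 1}" using k by auto
      then show ?thesis
        using mat_act_Borel_cspace[OF AB basis_vec_in_cspace] yl(4) by blast
    next
      case False
      define m where "m = k - n"
      have m: "k = n + m" "m \<in> {1..d l}" using False k dl by (auto simp: m_def)
      then have "m \<in> {1..d s}" using dls by auto
      then show ?thesis using col[of m] u m l by auto
    qed
    then have "mat_act N A ` basis_vec ` ?S \<subseteq> y l" by blast
    then have "cvs.span (mat_act N A ` basis_vec ` ?S) \<subseteq> y l" by (rule cvs.span_minimal[OF _ yl(1)])
    moreover have "cvs.span (mat_act N A ` basis_vec ` ?S) = mat_act N A ` cvs.span (basis_vec ` ?S)"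
      by (rule f.span_image)
    ultimately show "mat_act N A ` perm_flag s r \<sigma> l \<subseteq> y l"
      unfolding perm_flag_eq[OF l] using span_basis_vec[of ?S] by simp
  qed
  moreover have "y \<in> extensional {1..s}"
    using y by (auto simp: sandwiched_flags_def partial_flags_def Gr_prod_def PiE_def)
  ultimately have "y = flag_act N s A (perm_flag s r \<sigma>)"
    by (intro extensionalityI[of _ "{1..s}"]) (auto simp: flag_act_def)
  then show ?thesis unfolding borel_orbit_def using AB by blast
qed

section \<open>Density of the Borel orbit\<close>

text \<open>
  The flag completed by \<open>0\<close> and the whole space, so that its first and last members need no special treatment.
\<close>

definition ext_flag :: "gpoint \<Rightarrow> nat \<Rightarrow> cvec set" where
  "ext_flag y l = (if l = 0 then {0} else if l = s + 1 then cspace N else y l)"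

lemma ext_flag_eq: "l \<in> {1..s} \<Longrightarrow> ext_flag y l = y l"
  by (auto simp: ext_flag_def)

lemma ext_flag_mono:
  assumes y: "y \<in> sandwiched_flags" and "i \<le> j" "j \<le> s + 1"
  shows "ext_flag y i \<subseteq> ext_flag y j"
proof -
  consider "i = 0" | "j = s + 1" | "1 \<le> i" "j \<le> s" using assms by linarith
  then show ?thesis
  proof cases
    case 1
    have "0 \<in> ext_flag y j"
    proof (cases "j \<in> {1..s}")
      case True
      then show ?thesis using sandwichedD(1)[OF y True] by (simp add: ext_flag_eq cvs.subspace_0)
    next
      case False
      then have "j = 0 \<or> j = s + 1" using assms by auto
      then show ?thesis using cvs.subspace_0[OF subspace_cspace] by (auto simp: ext_flag_def)
    qed
    then show ?thesis using 1 by (simp add: ext_flag_def)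
  next
    case 2
    then have j: "ext_flag y j = cspace N" by (simp add: ext_flag_def)
    show ?thesis
    proof (cases "i \<in> {1..s}")
      case True
      then show ?thesis using sandwichedD(2)[OF y True] j by (simp add: ext_flag_eq)
    next
      case False
      then have "i = 0 \<or> i = s + 1" using assms by auto
      then show ?thesis using j cvs.subspace_0[OF subspace_cspace] by (auto simp: ext_flag_def)
    qed
  next
    case 3
    then show ?thesis using sandwiched_nested[OF y, of i j] assms by (simp add: ext_flag_def)
  qed
qed

lemma subspace_ext_flag:
  assumes y: "y \<in> sandwiched_flags" and "i \<le> s + 1"
  shows "cvs.subspace (ext_flag y i)" "ext_flag y i \<subseteq> cspace N"
proof -
  consider "i = 0" | "i = s + 1" | "i \<in> {1..s}" using assms by force
  then have "cvs.subspace (ext_flag y i) \<and> ext_flag y i \<subseteq> cspace N"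
  proof cases
    case 1
    then show ?thesis using cvs.subspace_0[OF subspace_cspace] by (simp add: ext_flag_def)
  next
    case 2
    then show ?thesis by (simp add: ext_flag_def subspace_cspace)
  next
    case 3
    then show ?thesis using sandwichedD(1,2)[OF y 3] by (simp add: ext_flag_eq)
  qed
  then show "cvs.subspace (ext_flag y i)" "ext_flag y i \<subseteq> cspace N" by auto
qed

text \<open>
  For a coordinate flag, a basis vector \<open>e\<^bsub>n+k\<^esub>\<close> may belong to the members \<open>y l\<close> with \<open>k \<le> d\<^sub>l\<close> but may join
  the flag later than at the first of them; the members that it misses form an interval. For \<open>i \<le> j\<close> the predicate
  says that such an interval begins at or before \<open>i\<close> and contains \<open>j\<close>.
\<close>

definition high_gap :: "gpoint \<Rightarrow> nat \<Rightarrow> nat \<Rightarrow> bool" where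
  "high_gap y i j \<longleftrightarrow> \<not> coord_space {n + 1..n + d i} \<subseteq> high_part ` ext_flag y j"

text \<open>
  For a coordinate flag, a basis vector \<open>e\<^sub>k\<close> with \<open>k \<le> n\<close> has to belong to the members \<open>y l\<close> with \<open>k < d\<^sub>l\<close>, but
  may join the flag earlier; the members where it is superfluous form an interval. For \<open>i \<le> j\<close> the predicate
  says that such an interval begins at or before \<open>i\<close> and contains \<open>j\<close>.
\<close>

definition low_excess :: "gpoint \<Rightarrow> nat \<Rightarrow> nat \<Rightarrow> bool" where
  "low_excess y i j \<longleftrightarrow> \<not> ext_flag y i \<inter> cspace n \<subseteq> cspace (d j - 1)"

lemma high_gap_mono:
  assumes y: "y \<in> sandwiched_flags" and "high_gap y i j" "1 \<le> i" "i \<le> i'" "i' \<le> s" "j' \<le> j" "j \<le> s + 1"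
  shows "high_gap y i' j'"
proof -
  have "coord_space {n + 1..n + d i} \<subseteq> coord_space {n + 1..n + d i'}"
    using d_le_mono[of i i'] assms by (intro coord_space_mono) auto
  moreover have "high_part ` ext_flag y j' \<subseteq> high_part ` ext_flag y j"
    using ext_flag_mono[OF y, of j' j] assms by blast
  ultimately show ?thesis using assms(2) unfolding high_gap_def by blast
qed

lemma low_excess_mono:
  assumes y: "y \<in> sandwiched_flags" and "low_excess y i j" "i \<le> i'" "i' \<le> s + 1" "1 \<le> j'" "j' \<le> j" "j \<le> s"
  shows "low_excess y i' j'"
proof -
  have "cspace (d j' - 1) \<subseteq> cspace (d j - 1)"
    using d_le_mono[of j' j] assms by (intro cspace_mono) auto
  moreover have "ext_flag y i \<subseteq> ext_flag y i'" using ext_flag_mono[OF y] assms by blast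
  ultimately show ?thesis using assms(2) unfolding low_excess_def by blast
qed

lemma low_excess_0: "\<not> low_excess y 0 j"
  using cvs.subspace_0[OF subspace_cspace] by (auto simp: low_excess_def ext_flag_def)

lemma high_gap_iff_low_excess:
  assumes y: "y \<in> sandwiched_flags" and l: "l \<in> {1..s}"
  shows "high_gap y l l \<longleftrightarrow> low_excess y l l"
  using low_high_duality[OF y l] by (simp add: high_gap_def low_excess_def ext_flag_eq[OF l])

lemma not_high_gap_top: 
  assumes "i \<in> {1..s}"
  shows "\<not> high_gap y i (s + 1)"
proof -
  have "coord_space {n + 1..n + d i} \<subseteq> high_part ` cspace N"
  proof
    fix v assume v: "v \<in> coord_space {n + 1..n + d i}"
    have "v \<in> cspace N" using v d_bounds[OF assms] by (auto simp: coord_space_def cspace_def)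
    moreover have "high_part v = v" using v by (auto simp: coord_space_def high_part_def fun_eq_iff)
    ultimately show "v \<in> high_part ` cspace N" by (intro image_eqI[of _ _ v]) simp_all
  qed
  then show ?thesis by (simp add: high_gap_def ext_flag_def)
qed

text \<open>
  In terms of the intervals described at \<open>high_gap\<close> and \<open>low_excess\<close>, an interval of missing high vectors that begins
  at or before \<open>i\<close> and ends at \<open>j\<close>, and an interval of superfluous low vectors that begins between \<open>i\<close> and \<open>j\<close>
  and contains \<open>m \<ge> j\<close>. Exchanging the two vectors on the common members of the intervals gives another
  sandwiched flag, with fewer superfluous low vectors.

  By \<open>high_gap_iff_low_excess\<close> every index that is covered by an interval of one kind is covered by an interval of
  the other kind. Take a longest high interval \<open>[i, j]\<close> and the low intervals that contain \<open>j\<close>. If none of them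
  begins before \<open>i\<close>, the pair is found. Otherwise let \<open>i' < i\<close> be the smallest number at which one of
  them begins. Some high interval contains \<open>i'\<close>, and it ends before \<open>j\<close> because \<open>[i, j]\<close> is a longest one; it forms
  the desired pair with the low interval that begins at \<open>i'\<close>.
\<close>

lemma balanced_pair_exists:
  assumes y: "y \<in> sandwiched_flags" and l: "l \<in> {1..s}" and bad: "low_excess y l l"
  obtains i j m where "1 \<le> i" "i \<le> j" "j \<le> m" "m \<le> s" "high_gap y i j" "\<not> high_gap y i (j + 1)"
    "low_excess y j m" "\<not> low_excess y (i - 1) m"
proof -
  define M where "M = {p. 1 \<le> fst p \<and> fst p \<le> snd p \<and> snd p \<le> s \<and> high_gap y (fst p) (snd p)}"
  have "M \<subseteq> {1..s} \<times> {1..s}" by (auto simp: M_def)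
  then have finM: "finite M" by (rule finite_subset) simp
  have "(l, l) \<in> M" using l bad high_gap_iff_low_excess[OF y l] by (simp add: M_def)
  then have neM: "M \<noteq> {}" by blast
  \<comment> \<open>the length of a longest interval of missing high vectors\<close>
  define K where "K = Max ((\<lambda>p. snd p - fst p) ` M)"
  have "K \<in> (\<lambda>p. snd p - fst p) ` M" unfolding K_def using finM neM by (intro Max_in) auto
  then obtain i j where ij: "(i, j) \<in> M" "K = j - i" by auto
  have max: "j' - i' \<le> j - i" if "(i', j') \<in> M" for i' j'
  proof -
    have "snd (i', j') - fst (i', j') \<le> K"
      unfolding K_def using finM that by (intro Max_ge) (auto simp del: fst_conv snd_conv)
    then show ?thesis using ij(2) by simp
  qed
  have i: "1 \<le> i" "i \<le> j" "j \<le> s" and gap: "high_gap y i j" using ij(1) by (auto simp: M_def)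
  have nogap: "\<not> high_gap y i (j + 1)"
  proof
    assume g: "high_gap y i (j + 1)"
    show False
    proof (cases "j = s")
      case True
      then show False using g not_high_gap_top[of i y] i by simp
    next
      case False
      then have "(i, j + 1) \<in> M" using g i by (simp add: M_def)
      then show False using max[of i "j + 1"] i by simp
    qed
  qed
  have "high_gap y j j" using high_gap_mono[OF y gap, of j j] i by simp
  then have exc: "low_excess y j j" using high_gap_iff_low_excess[OF y, of j] i by simp
  show thesis
  proof (cases "low_excess y (i - 1) j")
    case False
    then show thesis using that[of i j j] i gap nogap exc by simp
  next
    case True
    \<comment> \<open>the earliest start of an interval of superfluous low vectors that contains \<open>j\<close>\<close>
    define i' where "i' = (LEAST i'. low_excess y i' j)"
    have i'e: "low_excess y i' j" unfolding i'_def using True by (rule LeastI)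
    have i'i: "i' \<le> i - 1" unfolding i'_def using True by (rule Least_le)
    have i'1: "1 \<le> i'" using i'e low_excess_0 by (cases "i' = 0") auto
    have prev: "\<not> low_excess y (i' - 1) j"
      using not_less_Least[of "i' - 1" "\<lambda>i'. low_excess y i' j"] i'1 unfolding i'_def[symmetric] by simp
    have "low_excess y i' i'" using low_excess_mono[OF y i'e, of i' i'] i'1 i'i i by simp
    then have g0: "high_gap y i' i'" using high_gap_iff_low_excess[OF y, of i'] i'1 i'i i by simp
    have ng: "\<not> high_gap y i' j"
    proof
      assume "high_gap y i' j"
      then have "(i', j) \<in> M" using i'1 i'i i by (simp add: M_def)
      then show False using max[of i' j] i'1 i'i i by simp
    qed
    \<comment> \<open>the intervals of missing high vectors that contain \<open>i'\<close> extend up to \<open>m - 1\<close>\<close>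
    define m where "m = (LEAST m. i' \<le> m \<and> \<not> high_gap y i' m)"
    have ex: "i' \<le> j \<and> \<not> high_gap y i' j" using ng i'i i by simp
    have m: "i' \<le> m \<and> \<not> high_gap y i' m" unfolding m_def using ex by (rule LeastI)
    have mj: "m \<le> j" unfolding m_def using ex by (rule Least_le)
    have mi: "i' < m" using m g0 by (cases "i' = m") auto
    have gm: "high_gap y i' (m - 1)"
      using not_less_Least[of "m - 1" "\<lambda>m. i' \<le> m \<and> \<not> high_gap y i' m"] mi unfolding m_def[symmetric] by simp
    have "low_excess y (m - 1) j" using low_excess_mono[OF y i'e, of "m - 1" j] mi mj i by simp
    then show thesis using that[of i' "m - 1" j] i'1 mi mj i gm m prev by simp
  qed
qed

text \<open>
  The vector \<open>u\<close> is the high vector that is missing up to the index \<open>j\<close>, and \<open>\<xi>\<close> selects the superfluous low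
  vector \<open>x\<close>. The form \<open>\<xi>\<close> exists because \<open>x\<close> is not in \<open>ext_flag y (i - 1) + cspace (d j - 1)\<close>: the second summand
  lies in \<open>cspace n\<close>, so a decomposition of \<open>x\<close> would take place inside \<open>cspace n\<close>, where both
  summands are contained in \<open>cspace (d m - 1)\<close>.
\<close>

lemma deformation_data:
  assumes y: "y \<in> sandwiched_flags" and l: "l \<in> {1..s}" and bad: "low_excess y l l"
  obtains i j u \<xi> x where "1 \<le> i" "i \<le> j" "j \<le> s"
    "u \<in> cspace (n + d i)" "u \<in> ext_flag y (j + 1)" "high_part u \<notin> high_part ` y j"
    "\<And>v w. \<xi> (v + w) = \<xi> v + \<xi> w" "\<And>c v. \<xi> (cscale c v) = c * \<xi> v"
    "\<And>v. v \<in> ext_flag y (i - 1) \<Longrightarrow> \<xi> v = (0 :: complex)" "\<And>v. v \<in> cspace (d j - 1) \<Longrightarrow> \<xi> v = 0"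
    "x \<in> y j" "x \<in> cspace n" "\<xi> x = 1"
proof -
  obtain i j m where ij: "1 \<le> i" "i \<le> j" "j \<le> m" "m \<le> s"
    and g: "high_gap y i j" "\<not> high_gap y i (j + 1)"
    and e: "low_excess y j m" "\<not> low_excess y (i - 1) m"
    by (rule balanced_pair_exists[OF y l bad], rule that)
  have j: "j \<in> {1..s}" using ij by simp
  obtain c where c: "c \<in> coord_space {n + 1..n + d i}" "c \<notin> high_part ` y j"
    using g(1) unfolding high_gap_def ext_flag_eq[OF j] by blast
  then have "c \<in> high_part ` ext_flag y (j + 1)" using g(2) unfolding high_gap_def by blast
  then obtain u where u: "c = high_part u" "u \<in> ext_flag y (j + 1)" by blast
  have uN: "u \<in> cspace N" using subspace_ext_flag(2)[OF y, of "j + 1"] u(2) ij by auto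
  have "u k = 0" if k: "k \<notin> {1..n + d i}" for k
  proof (cases "k = 0")
    case True
    then show ?thesis using uN by (simp add: cspace_def)
  next
    case False
    then have "n + d i < k" using k by auto
    then have "c k = 0" "u k = high_part u k" using c(1) by (auto simp: coord_space_def high_part_def)
    then show ?thesis using u(1) by simp
  qed
  then have ui: "u \<in> cspace (n + d i)" by (simp add: cspace_def)
  obtain x where x: "x \<in> y j" "x \<in> cspace n" "x \<notin> cspace (d m - 1)"
    using e(1) unfolding low_excess_def ext_flag_eq[OF j] by blast
  let ?S = "{v + w | v w. v \<in> ext_flag y (i - 1) \<and> w \<in> cspace (d j - 1)}"
  have sub: "cvs.subspace (ext_flag y (i - 1))" using subspace_ext_flag(1)[OF y, of "i - 1"] ij by simp
  have S: "cvs.subspace ?S" by (rule cvs.subspace_sums[OF sub subspace_cspace])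
  have dm: "d m \<le> n" "d j \<le> d m" using d_bounds[of m] d_le_mono[of j m] ij by auto
  have xS: "x \<notin> ?S"
  proof
    assume "x \<in> ?S"
    then obtain v w where vw: "x = v + w" "v \<in> ext_flag y (i - 1)" "w \<in> cspace (d j - 1)" by blast
    have "cspace (d j - 1) \<subseteq> cspace (d m - 1)" "cspace (d m - 1) \<subseteq> cspace n"
      using dm by (intro cspace_mono; simp)+
    then have wm: "w \<in> cspace (d m - 1)" and wn: "w \<in> cspace n" using vw(3) by blast+
    have "v = x - w" using vw(1) by simp
    then have "v \<in> cspace n" using cvs.subspace_diff[OF subspace_cspace x(2) wn] by simp
    then have "v \<in> cspace (d m - 1)" using e(2) vw(2) unfolding low_excess_def by blast
    then have "x \<in> cspace (d m - 1)" unfolding vw(1) using wm cvs.subspace_add[OF subspace_cspace] by blast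
    then show False using x(3) by simp
  qed
  obtain \<xi> where \<xi>: "\<And>v w. \<xi> (v + w) = \<xi> v + \<xi> w" "\<And>c v. \<xi> (cscale c v) = c * \<xi> v"
    "\<And>v. v \<in> ?S \<Longrightarrow> \<xi> v = (0 :: complex)" "\<xi> x = 1"
    by (rule functional_exists[OF S xS], rule that)
  have "\<xi> v = 0" if "v \<in> ext_flag y (i - 1)" for v
  proof -
    have "v + 0 \<in> ?S" using that cvs.subspace_0[OF subspace_cspace] by blast
    then show ?thesis using \<xi>(3)[of v] by simp
  qed
  moreover have "\<xi> w = 0" if "w \<in> cspace (d j - 1)" for w
  proof -
    have "0 + w \<in> ?S" using that cvs.subspace_0[OF sub] by blast
    then show ?thesis using \<xi>(3)[of w] by simp
  qed
  ultimately show thesis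
    using ij ui u c(2) x \<xi>(1,2,4) by (intro that[of i j u \<xi> x]) simp_all
qed

definition excess :: "gpoint \<Rightarrow> nat" where
  "excess y = (\<Sum>l\<in>{1..s}. cvs.dim (y l \<inter> cspace n))"

text \<open>
  The maps \<open>v \<mapsto> v + t \<xi>(v) u\<close> do not change the members before \<open>i\<close>, where \<open>\<xi> = 0\<close>, nor those after \<open>j\<close>,
  which contain \<open>u\<close>. In between, \<open>u\<close> respects the upper bound of the sandwich and \<open>\<xi>\<close> vanishes on the lower
  bound. Since \<open>u\<close> has a high part outside that of \<open>y j\<close>, the new members between \<open>i\<close> and \<open>j\<close> meet \<open>cspace n\<close> only in
  vectors of \<open>y l\<close> with \<open>\<xi> = 0\<close>, and \<open>x\<close> is lost from the \<open>j\<close>-th one.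
\<close>

lemma deformation:
  assumes y: "y \<in> sandwiched_flags" and l0: "l0 \<in> {1..s}" and bad: "low_excess y l0 l0"
    and U: "openin (zariski N s r (partial_flags N s r)) U" "y \<in> U"
  obtains z where "z \<in> sandwiched_flags" "z \<in> U" "excess z < excess y"
proof -
  obtain i j u \<xi> x where ij: "1 \<le> i" "i \<le> j" "j \<le> s"
    and u: "u \<in> cspace (n + d i)" "u \<in> ext_flag y (j + 1)" "high_part u \<notin> high_part ` y j"
    and \<xi>: "\<And>v w. \<xi> (v + w) = \<xi> v + \<xi> w" "\<And>c v. \<xi> (cscale c v) = c * \<xi> v"
      "\<And>v. v \<in> ext_flag y (i - 1) \<Longrightarrow> \<xi> v = (0 :: complex)" "\<And>v. v \<in> cspace (d j - 1) \<Longrightarrow> \<xi> v = 0"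
    and x: "x \<in> y j" "x \<in> cspace n" "\<xi> x = 1"
    by (rule deformation_data[OF y l0 bad], rule that)
  define g where "g t v = v + cscale (t * \<xi> v) u" for t v
  have lin: "clinear (g t)" for t
  proof (rule clinearI)
    show "g t (v + w) = g t v + g t w" for v w
      unfolding g_def \<xi>(1) by (simp add: cscale_def fun_eq_iff algebra_simps)
    show "g t (cscale a v) = cscale a (g t v)" for a v
      unfolding g_def \<xi>(2) by (simp add: cscale_def fun_eq_iff algebra_simps)
  qed
  have gid: "g t v = v" if "\<xi> v = 0" for t v using that by (simp add: g_def)
  have ginj: "v = 0" if t: "1 + t * \<xi> u \<noteq> 0" and v: "g t v = 0" for t v
  proof -
    have "\<xi> (g t v) = \<xi> v * (1 + t * \<xi> u)" by (simp add: g_def \<xi>(1,2) algebra_simps)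
    moreover have "\<xi> (0 :: cvec) = 0" using \<xi>(2)[of 0 0] by simp
    ultimately have "\<xi> v = 0" using t v by simp
    then show ?thesis using gid[of v t] v by simp
  qed
  define c where "c t = (\<lambda>l\<in>{1..s}. g t ` y l)" for t
  have cl: "c t l = g t ` y l" if "l \<in> {1..s}" for t l using that by (simp add: c_def)
  have before: "g t ` y l = y l" if l: "l \<in> {1..s}" "l < i" for t l
  proof -
    have "y l \<subseteq> ext_flag y (i - 1)"
      using ext_flag_mono[OF y, of l "i - 1"] l ij ext_flag_eq[OF l(1)] by simp
    then have "g t v = v" if "v \<in> y l" for v using gid \<xi>(3) that by blast
    then show ?thesis by simp
  qed
  have after: "g t ` y l = y l" if l: "l \<in> {1..s}" "j < l" and t: "1 + t * \<xi> u \<noteq> 0" for t l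
  proof (rule image_subspace_eq[OF lin])
    note yl = sandwichedD[OF y l(1)]
    show "cvs.subspace (y l)" "y l \<subseteq> cspace N" by (rule yl)+
    have "u \<in> y l" using ext_flag_mono[OF y, of "j + 1" l] u(2) l ext_flag_eq[OF l(1)] by auto
    then show "g t ` y l \<subseteq> y l"
      using cvs.subspace_add[OF yl(1)] cvs.subspace_scale[OF yl(1)] by (auto simp: g_def)
  qed (use ginj[OF t] in blast)
  have yj: "y l \<subseteq> y j" if "l \<in> {1..s}" "l \<le> j" for l
    using sandwiched_nested[OF y, of l j] that ij by simp
  have cS: "c t \<in> sandwiched_flags" if t: "1 + t * \<xi> u \<noteq> 0" for t
  proof (rule sandwichedI)
    interpret f: Vector_Spaces.linear cscale cscale "g t" by (rule lin)
    show "c t \<in> extensional {1..s}" by (simp add: c_def)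
    fix l assume l: "l \<in> {1..s}"
    note yl = sandwichedD[OF y l] and dl = d_bounds[OF l]
    show "cvs.subspace (c t l)" unfolding cl[OF l] using yl(1) by (rule f.subspace_image)
    show "cvs.dim (c t l) = r l"
      unfolding cl[OF l] yl(3)[symmetric] using ginj[OF t] by (intro dim_linear_image[OF lin yl(1,2)]) blast
    show "cspace (d l - 1) \<subseteq> c t l"
    proof (cases "j < l")
      case True
      then show ?thesis using after[OF l _ t] yl(4) cl[OF l] by simp
    next
      case False
      have "d l \<le> d j" using False d_le_mono[of l j] l ij by simp
      then have "cspace (d l - 1) \<subseteq> cspace (d j - 1)" by (intro cspace_mono) simp
      then have "g t v = v" if "v \<in> cspace (d l - 1)" for v using gid \<xi>(4) that by blast
      then have "cspace (d l - 1) = g t ` cspace (d l - 1)" by simp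
      also have "\<dots> \<subseteq> c t l" unfolding cl[OF l] using yl(4) by blast
      finally show ?thesis .
    qed
    show "c t l \<subseteq> cspace (n + d l)"
    proof (cases "l < i")
      case True
      then show ?thesis using before[OF l] yl(5) cl[OF l] by simp
    next
      case False
      then have "d i \<le> d l" using d_le_mono[of i l] l ij by simp
      then have "u \<in> cspace (n + d l)" using u(1) cspace_mono[of "n + d i" "n + d l"] by auto
      then show ?thesis
        unfolding cl[OF l] using yl(5) cvs.subspace_add[OF subspace_cspace] cvs.subspace_scale[OF subspace_cspace]
        by (auto simp: g_def)
    qed
  next
    fix l assume l: "l \<in> {1..<s}"
    then have "y l \<subseteq> y (l + 1)" using sandwiched_nested[OF y, of l "l + 1"] by simp
    then show "c t l \<subseteq> c t (l + 1)" using l by (auto simp: c_def)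
  qed
  have low: "w \<in> y l \<and> w \<in> cspace n \<and> (i \<le> l \<and> l \<le> j \<longrightarrow> \<xi> w = 0)"
    if t: "t \<noteq> 0" "1 + t * \<xi> u \<noteq> 0" and l: "l \<in> {1..s}" and w: "w \<in> c t l" "w \<in> cspace n" for t l w
  proof (cases "i \<le> l \<and> l \<le> j")
    case False
    have "c t l = y l"
    proof (cases "l < i")
      case True
      then show ?thesis unfolding cl[OF l] by (rule before[OF l])
    next
      case False
      then have "j < l" using \<open>\<not> (i \<le> l \<and> l \<le> j)\<close> by simp
      then show ?thesis unfolding cl[OF l] by (rule after[OF l _ t(2)])
    qed
    then show ?thesis using w False by blast
  next
    case True
    then obtain v where v: "v \<in> y l" "w = g t v" using w(1) cl[OF l] by auto
    interpret h: Vector_Spaces.linear cscale cscale high_part by (rule clinear_high_part)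
    have "\<xi> v = 0"
    proof (rule ccontr)
      assume ne: "\<xi> v \<noteq> 0"
      have "high_part w = 0" using w(2) by (auto simp: high_part_def cspace_def fun_eq_iff)
      then have "high_part v + cscale (t * \<xi> v) (high_part u) = 0"
        unfolding v(2) g_def h.add h.scale .
      then have "cscale (t * \<xi> v) (high_part u) = - high_part v" by (simp add: eq_neg_iff_add_eq_0 add.commute)
      then have "cscale (1 / (t * \<xi> v)) (cscale (t * \<xi> v) (high_part u)) = cscale (1 / (t * \<xi> v)) (- high_part v)" by simp
      moreover have "cscale (1 / (t * \<xi> v)) (cscale (t * \<xi> v) (high_part u)) = high_part u"
        using ne t(1) by (simp add: cscale_def)
      moreover have "cscale (1 / (t * \<xi> v)) (- high_part v) = high_part (cscale (- 1 / (t * \<xi> v)) v)"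
        unfolding h.scale by (simp add: cscale_def fun_eq_iff)
      ultimately have "high_part u = high_part (cscale (- 1 / (t * \<xi> v)) v)" by simp
      moreover have "cscale (- 1 / (t * \<xi> v)) v \<in> y j"
      proof (rule cvs.subspace_scale)
        show "cvs.subspace (y j)" using sandwichedD(1)[OF y, of j] ij by simp
        show "v \<in> y j" using v(1) yj[OF l] True by blast
      qed
      ultimately show False using u(3) by blast
    qed
    then show ?thesis using gid[of v t] v w(2) by simp
  qed
  have less: "excess (c t) < excess y" if t: "t \<noteq> 0" "1 + t * \<xi> u \<noteq> 0" for t
    unfolding excess_def
  proof (rule sum_strict_mono_ex1)
    have ct: "c t l \<inter> cspace n \<subseteq> y l \<inter> cspace n" if l: "l \<in> {1..s}" for l
      using low[OF t l] by blast
    have sb: "cvs.subspace (c t l \<inter> cspace n)" "cvs.subspace (y l \<inter> cspace n)"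
      "y l \<inter> cspace n \<subseteq> cspace n" if l: "l \<in> {1..s}" for l
      using cvs.subspace_inter[OF _ subspace_cspace] sandwichedD(1)[OF y l] sandwichedD(1)[OF cS[OF t(2)] l]
      by auto
    show "\<forall>l\<in>{1..s}. cvs.dim (c t l \<inter> cspace n) \<le> cvs.dim (y l \<inter> cspace n)"
    proof
      fix l assume l: "l \<in> {1..s}"
      show "cvs.dim (c t l \<inter> cspace n) \<le> cvs.dim (y l \<inter> cspace n)"
        by (rule dim_mono[OF sb(1)[OF l] sb(2)[OF l] ct[OF l] sb(3)[OF l]])
    qed
    have j: "j \<in> {1..s}" using ij by simp
    have "x \<notin> c t j"
      using low[OF t j _ x(2)] x(3) ij by auto
    then have "c t j \<inter> cspace n \<noteq> y j \<inter> cspace n" using x by blast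
    then have "cvs.dim (c t j \<inter> cspace n) < cvs.dim (y j \<inter> cspace n)"
      using dim_subspace_eq[OF sb(1)[OF j] sb(2)[OF j] ct[OF j] sb(3)[OF j]] by (meson not_le)
    then show "\<exists>l\<in>{1..s}. cvs.dim (c t l \<inter> cspace n) < cvs.dim (y l \<inter> cspace n)" using j by blast
  qed simp
  have "y \<in> Gr_prod N s r" using y by (simp add: sandwiched_flags_def partial_flags_def)
  then obtain P where P: "P \<in> hcoords s r y" by (rule hcoords_exists)
  obtain b where b: "\<And>l. l \<in> {1..s} \<Longrightarrow> ordered_basis (r l) (b l) (y l)"
    by (rule hcoords_bases[OF P], rule that)
  have "((\<lambda>t. 1 + t * \<xi> u) \<longlongrightarrow> 1 + 0 * \<xi> u) (at 0)" by (intro tendsto_intros)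
  then have ev: "\<forall>\<^sub>F t in at 0. 1 + t * \<xi> u \<noteq> 0" by (rule tendsto_imp_eventually_ne) simp
  have ev0: "\<forall>\<^sub>F t in at (0 :: complex). t \<noteq> 0" by (simp add: eventually_at_filter)
  have "\<forall>\<^sub>F t in at 0. c t \<in> U"
  proof (rule curve_eventually_in_open[where b = "\<lambda>t l. g t \<circ> b l" and y = y and X = "partial_flags N s r"])
    show "\<forall>\<^sub>F t in at 0. c t \<in> partial_flags N s r \<and> (\<forall>l\<in>{1..s}. ordered_basis (r l) (g t \<circ> b l) (c t l))"
      using ev
    proof eventually_elim
      case (elim t)
      have "ordered_basis (r l) (g t \<circ> b l) (c t l)" if l: "l \<in> {1..s}" for l
        unfolding cl[OF l] using ginj[OF elim] by (intro ordered_basis_image[OF lin b[OF l]]) blast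
      moreover have "c t \<in> partial_flags N s r" using cS[OF elim] by (simp add: sandwiched_flags_def)
      ultimately show ?case by blast
    qed
    show "ordered_basis (r l) (g 0 \<circ> b l) (y l)" if l: "l \<in> {1..s}" for l
    proof -
      have "g 0 \<circ> b l = b l" by (simp add: g_def fun_eq_iff cscale_def)
      then show ?thesis using b[OF l] by simp
    qed
    show "isCont (\<lambda>t. (g t \<circ> b l) i k) 0" for l i k
      by (simp add: g_def cscale_def)
  qed (rule U)+
  with ev ev0 have "\<forall>\<^sub>F t in at 0. c t \<in> sandwiched_flags \<and> c t \<in> U \<and> excess (c t) < excess y"
  proof eventually_elim
    case (elim t)
    then show ?case using cS[OF elim(1)] less[OF elim(2,1)] by simp
  qed
  then obtain t where "c t \<in> sandwiched_flags \<and> c t \<in> U \<and> excess (c t) < excess y"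
    using eventually_happens'[OF at_neq_bot] by blast
  then show thesis using that[of "c t"] by simp
qed

lemma orbit_dense:
  assumes s1: "1 \<le> s" and y: "y \<in> sandwiched_flags"
    and U: "openin (zariski N s r (partial_flags N s r)) U" "y \<in> U"
  shows "\<exists>z\<in>borel_orbit. z \<in> U"
  using y U(2)
proof (induction "excess y" arbitrary: y rule: less_induct)
  case less
  show ?case
  proof (cases "\<exists>l\<in>{1..s}. low_excess y l l")
    case True
    then obtain l where l: "l \<in> {1..s}" "low_excess y l l" by blast
    obtain z where z: "z \<in> sandwiched_flags" "z \<in> U" "excess z < excess y"
      by (rule deformation[OF less(2) l U(1) less(3)])
    then show ?thesis using less(1)[of z] by blast
  next
    case False
    then have "y l \<inter> cspace n \<subseteq> cspace (d l - 1)" if "l \<in> {1..s}" for l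
      using that ext_flag_eq[OF that] unfolding low_excess_def by blast
    then have "y \<in> borel_orbit" by (rule generic_in_orbit[OF s1 less(2)])
    then show ?thesis using less(3) by blast
  qed
qed

lemma schubert_eq_sandwiched:
  assumes s1: "1 \<le> s"
  shows "schubert N s r \<sigma> = sandwiched_flags"
proof
  show "schubert N s r \<sigma> \<subseteq> sandwiched_flags"
    using closure_sandwiched_subset[OF orbit_sandwiched] unfolding schubert_def borel_orbit_def .
  show "sandwiched_flags \<subseteq> schubert N s r \<sigma>"
  proof
    fix y assume y: "y \<in> sandwiched_flags"
    then have "y \<in> partial_flags N s r" by (simp add: sandwiched_flags_def)
    moreover have "\<exists>z. z \<in> borel_orbit \<and> z \<in> T"
      if "y \<in> T \<and> openin (zariski N s r (partial_flags N s r)) T" for T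
      using orbit_dense[OF s1 y, of T] that by blast
    ultimately show "y \<in> schubert N s r \<sigma>"
      unfolding schubert_def borel_orbit_def[symmetric] in_closure_of topspace_zariski by blast
  qed
qed

end

section \<open>Morphisms given by monomial substitutions\<close>

text \<open>
  Substituting \<open>P l I \<mapsto> C l I * P l (\<kappa> l I)\<close> pulls multihomogeneous polynomials back to multihomogeneous ones of
  the same degree. So preimages of basic open sets are basic open, and a quotient \<open>G / H\<close> pulls back to
  a quotient. It is enough to know the relation for one choice of coordinates, by \<open>hcoords_multihom_scale\<close>.
\<close>

lemma coordinate_morphism:
  assumes f: "\<And>x. x \<in> X \<Longrightarrow> f x \<in> Y"
    and \<kappa>: "\<And>l I. l \<in> {1..s} \<Longrightarrow> I \<in> plucker_index N' r' l \<Longrightarrow> C l I \<noteq> 0 \<Longrightarrow> \<kappa> l I \<in> plucker_index N r l"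
    and rel: "\<And>x. x \<in> X \<Longrightarrow> \<exists>P\<in>hcoords s r x. \<exists>P'\<in>hcoords s r' (f x).
       \<forall>l\<in>{1..s}. \<forall>I\<in>plucker_index N' r' l. P' l I = C l I * P l (\<kappa> l I)"
  shows "variety_morphism N s r X N' s r' Y f"
proof -
  define pull where "pull F = (\<lambda>P. F (\<lambda>l I. C l I * P l (\<kappa> l I)))"
    for F :: "(nat \<Rightarrow> nat set \<Rightarrow> complex) \<Rightarrow> complex"
  have pull: "multihom s (plucker_index N r) a (pull F)"
    if "multihom s (plucker_index N' r') a F" for a F
    unfolding pull_def by (rule multihom_substitute[OF that \<kappa>])
  have ex: "\<exists>P\<in>hcoords s r x. \<exists>P'\<in>hcoords s r' (f x).
      \<forall>a F. multihom s (plucker_index N' r') a F \<longrightarrow> F P' = pull F P" if x: "x \<in> X" for x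
  proof -
    obtain P P' where P: "P \<in> hcoords s r x" "P' \<in> hcoords s r' (f x)"
      "\<forall>l\<in>{1..s}. \<forall>I\<in>plucker_index N' r' l. P' l I = C l I * P l (\<kappa> l I)"
      using rel[OF x] by blast
    have "\<forall>a F. multihom s (plucker_index N' r') a F \<longrightarrow> F P' = pull F P"
    proof (intro allI impI)
      fix a F assume "multihom s (plucker_index N' r') a F"
      then show "F P' = pull F P"
        unfolding pull_def by (rule multihom_cong) (use P(3) in blast)
    qed
    then show ?thesis using P(1,2) by (intro bexI[of _ P] bexI[of _ P'])
  qed
  have preimage: "(\<forall>P\<in>hcoords s r' (f x). F P \<noteq> 0) \<longleftrightarrow> (\<forall>P\<in>hcoords s r x. pull F P \<noteq> 0)"
    if F: "multihom s (plucker_index N' r') a F" and x: "x \<in> X" for x a F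
  proof -
    from ex[OF x] obtain P P' where P: "P \<in> hcoords s r x" "P' \<in> hcoords s r' (f x)"
      and e: "\<forall>a F. multihom s (plucker_index N' r') a F \<longrightarrow> F P' = pull F P"
      by (elim bexE) (rule that)
    have "F P' = pull F P"
      by (rule e[THEN spec[of _ a], THEN spec[of _ F], THEN mp, OF F])
    then show ?thesis
      by (simp only: multihom_nonzero_indep[OF F P(2)] multihom_nonzero_indep[OF pull[OF F] P(1)])
  qed
  have cont: "continuous_map (zariski N s r X) (zariski N' s r' Y) f"
    unfolding zariski_def[of N' s r' Y] continuous_on_generated_topo_iff topspace_zariski
  proof (intro conjI allI impI)
    fix V assume "V \<in> {{x \<in> Y. \<forall>P\<in>hcoords s r' x. F P \<noteq> 0} |F a. multihom s (plucker_index N' r') a F}"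
    then obtain F a where V: "V = {x \<in> Y. \<forall>P\<in>hcoords s r' x. F P \<noteq> 0}"
      and F: "multihom s (plucker_index N' r') a F"
      unfolding mem_Collect_eq by (elim exE conjE) (rule that)
    have "f -` V \<inter> X = {x \<in> X. \<forall>P\<in>hcoords s r x. pull F P \<noteq> 0}"
      using f preimage[OF F] by (auto simp: V)
    then show "openin (zariski N s r X) (f -` V \<inter> X)"
      using openin_nonvanishing[OF pull[OF F]] by simp
  next
    have "Y \<subseteq> \<Union> {{x \<in> Y. \<forall>P\<in>hcoords s r' x. F P \<noteq> 0} |F a. multihom s (plucker_index N' r') a F}"
      using topspace_zariski[of N' s r' Y] unfolding zariski_def by simp
    then show "f ` X \<subseteq> \<Union> {{x \<in> Y. \<forall>P\<in>hcoords s r' x. F P \<noteq> 0} |F a. multihom s (plucker_index N' r') a F}"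
      using f by blast
  qed
  have "regular_on N s r X {x \<in> X. f x \<in> U} (\<phi> \<circ> f)"
    if \<phi>: "regular_on N' s r' Y U \<phi>" for U \<phi>
    unfolding regular_on_def
  proof
    fix x assume x: "x \<in> {x \<in> X. f x \<in> U}"
    then have fx: "f x \<in> U" by simp
    obtain O' a G H where O': "openin (zariski N' s r' Y) O'" "f x \<in> O'" "O' \<subseteq> U"
      and G: "multihom s (plucker_index N' r') a G" and H: "multihom s (plucker_index N' r') a H"
      and q: "\<forall>y\<in>O'. \<forall>P\<in>hcoords s r' y. H P \<noteq> 0 \<and> \<phi> y = G P / H P"
      using \<phi>[unfolded regular_on_def, rule_format, OF fx]
      by (elim exE conjE) (rule that)
    let ?O = "{x \<in> X. f x \<in> O'}"
    have "openin (zariski N s r X) ?O"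
      using openin_continuous_map_preimage[OF cont O'(1)] by (simp add: topspace_zariski)
    moreover have "pull H P \<noteq> 0 \<and> (\<phi> \<circ> f) y = pull G P / pull H P"
      if y: "y \<in> ?O" and P: "P \<in> hcoords s r y" for y P
    proof -
      have yX: "y \<in> X" using y by simp
      from ex[OF yX] obtain P0 P0' where P0: "P0 \<in> hcoords s r y" "P0' \<in> hcoords s r' (f y)"
        and e0: "\<forall>a F. multihom s (plucker_index N' r') a F \<longrightarrow> F P0' = pull F P0"
        by (elim bexE) (rule that)
      note e = e0[THEN spec[of _ a], THEN spec[of _ G], THEN mp, OF G]
        e0[THEN spec[of _ a], THEN spec[of _ H], THEN mp, OF H]
      obtain c where c0: "\<And>a. (\<Prod>l\<in>{1..s}. c l ^ a l) \<noteq> (0 :: complex)"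
        and cF: "\<And>J a F. multihom s J a F \<Longrightarrow> F P = (\<Prod>l\<in>{1..s}. c l ^ a l) * F P0"
        by (rule hcoords_multihom_scale[OF P0(1) P], rule that)
      define k where "k = (\<Prod>l\<in>{1..s}. c l ^ a l)"
      have c: "k \<noteq> 0" "pull G P = k * pull G P0" "pull H P = k * pull H P0"
        unfolding k_def by (rule c0, rule cF[OF pull[OF G]], rule cF[OF pull[OF H]])
      have "H P0' \<noteq> 0" "\<phi> (f y) = G P0' / H P0'" using q y P0(2) by auto
      then show ?thesis using c e by simp
    qed
    ultimately show "\<exists>O' a G H. openin (zariski N s r X) O' \<and> x \<in> O' \<and> O' \<subseteq> {x \<in> X. f x \<in> U} \<and>
        multihom s (plucker_index N r) a G \<and> multihom s (plucker_index N r) a H \<and>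
        (\<forall>y\<in>O'. \<forall>P\<in>hcoords s r y. H P \<noteq> 0 \<and> (\<phi> \<circ> f) y = G P / H P)"
      using x O' pull[OF G] pull[OF H]
      by (intro exI[of _ ?O] exI[of _ a] exI[of _ "pull G"] exI[of _ "pull H"]) auto
  qed
  with cont show ?thesis by (auto simp: variety_morphism_def)
qed

section \<open>The isomorphism with the degenerate flag variety\<close>

lemma pr_comp_eq: "pr_comp i j v = (\<lambda>k. if k \<in> {i..<j} then 0 else v k)"
proof (induction j)
  case 0
  then show ?case by (simp add: pr_comp_def)
next
  case (Suc j)
  show ?case
  proof (cases "i \<le> j")
    case True
    then have "pr_comp i (Suc j) v = pr j (pr_comp i j v)" by (simp add: pr_comp_def)
    then show ?thesis using True unfolding Suc by (auto simp: pr_def fun_eq_iff)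
  next
    case False
    then show ?thesis by (simp add: pr_comp_def)
  qed
qed

context flag_dims begin

text \<open>
  The embedding of \<open>V\<close> into \<open>W\<close> that sends \<open>f\<^sub>k\<close> to \<open>e\<^sub>k\<close> for \<open>k \<ge> m\<close> and to \<open>e\<^bsub>n+1+k\<^esub>\<close> for \<open>k < m\<close>. Below,
  \<open>fold_vec m\<close> is its left inverse; on \<open>cspace (n + m)\<close> the kernel of the latter is \<open>cspace (m - 1)\<close>.
\<close>

definition unfold_vec :: "nat \<Rightarrow> cvec \<Rightarrow> cvec" where
  "unfold_vec m v = (\<lambda>k. if k \<in> {m..n + 1} then v k else if k \<in> {n + 2..n + m} then v (k - n - 1) else 0)"

definition fold_vec :: "nat \<Rightarrow> cvec \<Rightarrow> cvec" where
  "fold_vec m w = (\<lambda>k. if k \<in> {m..n + 1} then w k else if k \<in> {1..m - 1} then w (n + 1 + k) else 0)"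

lemma clinear_unfold_vec: "clinear (unfold_vec m)"
  by (rule clinearI) (auto simp: unfold_vec_def cscale_def fun_eq_iff)

lemma clinear_fold_vec: "clinear (fold_vec m)"
  by (rule clinearI) (auto simp: fold_vec_def cscale_def fun_eq_iff)

lemma unfold_vec_cspace: "1 \<le> m \<Longrightarrow> unfold_vec m v \<in> cspace (n + m)"
  by (auto simp: unfold_vec_def cspace_def)

lemma fold_vec_cspace: "1 \<le> m \<Longrightarrow> m \<le> n \<Longrightarrow> fold_vec m w \<in> cspace (n + 1)"
  by (auto simp: fold_vec_def cspace_def)

lemma fold_unfold_vec:
  assumes "1 \<le> m" "m \<le> n" "v \<in> cspace (n + 1)"
  shows "fold_vec m (unfold_vec m v) = v"
proof
  fix k
  consider "k = 0" | "k \<in> {m..n + 1}" | "1 \<le> k" "k < m" | "n + 1 < k" by fastforce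
  then show "fold_vec m (unfold_vec m v) k = v k"
    using assms by cases (auto simp: fold_vec_def unfold_vec_def cspace_def)
qed

lemma fold_vec_low:
  assumes "1 \<le> m" "m \<le> n" "w \<in> cspace (m - 1)"
  shows "fold_vec m w = 0"
proof
  fix k
  show "fold_vec m w k = 0 k"
    using assms by (auto simp: fold_vec_def cspace_def)
qed

lemma fold_vec_eq_0:
  assumes m: "1 \<le> m" and w: "w \<in> cspace (n + m)" "fold_vec m w = 0"
  shows "w \<in> cspace (m - 1)"
proof -
  have "w k = 0" if k: "k \<notin> {1..m - 1}" for k
  proof -
    consider "k \<notin> {1..n + m}" | "k \<in> {m..n + 1}" | "k \<in> {n + 2..n + m}" using k by fastforce
    then show ?thesis
    proof cases
      case 1
      then show ?thesis using w(1) by (simp add: cspace_def)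
    next
      case 2
      then show ?thesis using fun_cong[OF w(2), of k] by (simp add: fold_vec_def)
    next
      case 3
      then have "k - n - 1 \<in> {1..m - 1}" "n + 1 + (k - n - 1) = k" by auto
      moreover have "fold_vec m w (k - n - 1) = 0" using fun_cong[OF w(2), of "k - n - 1"] by simp
      moreover have "k - n - 1 \<notin> {m..n + 1}" using 3 by auto
      ultimately show ?thesis unfolding fold_vec_def by (simp only: if_True if_False)
    qed
  qed
  then show ?thesis by (simp add: cspace_def)
qed

text \<open>
  Passing from \<open>m\<close> to \<open>m'\<close> moves the coordinates from \<open>m\<close> to \<open>m' - 1\<close> of \<open>V\<close> from the positions \<open>k\<close> to the
  positions \<open>n + 1 + k\<close>, which exceed \<open>n + m\<close> and where \<open>w\<close> is zero. This is the reason why the projections in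
  the definition of the degenerate flag variety turn into inclusions.
\<close>

lemma pr_comp_fold_vec:
  assumes "1 \<le> m" "m \<le> m'" "m' \<le> n" "w \<in> cspace (n + m)"
  shows "pr_comp m m' (fold_vec m w) = fold_vec m' w"
proof
  fix k
  consider "k < m" | "m \<le> k" "k < m'" | "m' \<le> k" by linarith
  then show "pr_comp m m' (fold_vec m w) k = fold_vec m' w k"
    using assms by cases (auto simp: fold_vec_def cspace_def pr_comp_eq)
qed

definition lift_space :: "nat \<Rightarrow> cvec set \<Rightarrow> cvec set" where
  "lift_space m U = {w \<in> cspace (n + m). fold_vec m w \<in> U}"

definition lift_basis :: "nat \<Rightarrow> (nat \<Rightarrow> cvec) \<Rightarrow> nat \<Rightarrow> cvec" where
  "lift_basis m b i = (if i \<le> m - 1 then basis_vec i else unfold_vec m (b (i - (m - 1))))"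

lemma lift_basis_sum:
  assumes m: "1 \<le> m"
  shows "(\<Sum>i\<in>{1..2 * m - 1}. cscale (c i) (lift_basis m b i)) =
    (\<Sum>i\<in>{1..m - 1}. cscale (c i) (basis_vec i)) +
    unfold_vec m (\<Sum>i\<in>{1..m}. cscale (c (m - 1 + i)) (b i))"
proof -
  interpret f: Vector_Spaces.linear cscale cscale "unfold_vec m" by (rule clinear_unfold_vec)
  have split: "{1..2 * m - 1} = {1..m - 1} \<union> (\<lambda>i. m - 1 + i) ` {1..m}"
  proof (intro equalityI subsetI)
    fix x assume x: "x \<in> {1..2 * m - 1}"
    show "x \<in> {1..m - 1} \<union> (\<lambda>i. m - 1 + i) ` {1..m}"
    proof (cases "x \<le> m - 1")
      case False
      then have "x = m - 1 + (x - (m - 1))" "x - (m - 1) \<in> {1..m}" using x m by auto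
      then show ?thesis by blast
    qed (use x in auto)
  qed (use m in auto)
  have "(\<Sum>i\<in>{1..2 * m - 1}. cscale (c i) (lift_basis m b i)) =
      (\<Sum>i\<in>{1..m - 1}. cscale (c i) (lift_basis m b i)) +
      (\<Sum>i\<in>(\<lambda>i. m - 1 + i) ` {1..m}. cscale (c i) (lift_basis m b i))"
    unfolding split by (rule sum.union_disjoint) auto
  also have "(\<Sum>i\<in>{1..m - 1}. cscale (c i) (lift_basis m b i)) = (\<Sum>i\<in>{1..m - 1}. cscale (c i) (basis_vec i))"
    by (rule sum.cong) (auto simp: lift_basis_def)
  also have "(\<Sum>i\<in>(\<lambda>i. m - 1 + i) ` {1..m}. cscale (c i) (lift_basis m b i)) =
      (\<Sum>i\<in>{1..m}. cscale (c (m - 1 + i)) (lift_basis m b (m - 1 + i)))"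
    by (subst sum.reindex) (auto simp: inj_on_def o_def)
  also have "\<dots> = (\<Sum>i\<in>{1..m}. unfold_vec m (cscale (c (m - 1 + i)) (b i)))"
    by (rule sum.cong) (auto simp: lift_basis_def f.scale)
  also have "\<dots> = unfold_vec m (\<Sum>i\<in>{1..m}. cscale (c (m - 1 + i)) (b i))"
    by (rule f.sum[symmetric])
  finally show ?thesis .
qed

lemma ordered_basis_lift:
  assumes m: "1 \<le> m" "m \<le> n" and UN: "U \<subseteq> cspace (n + 1)" and b: "ordered_basis m b U"
  shows "ordered_basis (2 * m - 1) (lift_basis m b) (lift_space m U)"
  unfolding ordered_basis_iff
proof (intro conjI ballI allI impI)
  interpret f: Vector_Spaces.linear cscale cscale "fold_vec m" by (rule clinear_fold_vec)
  note bU = ordered_basis_dim[OF b]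
  show sub: "cvs.subspace (lift_space m U)"
    using subspace_cspace[of "n + m"] bU(1)
    by (auto simp: lift_space_def cvs.subspace_def f.add f.scale f.zero)
  show "lift_basis m b i \<in> lift_space m U" if i: "i \<in> {1..2 * m - 1}" for i
  proof (cases "i \<le> m - 1")
    case True
    then have "basis_vec i \<in> cspace (m - 1)" using i by (intro basis_vec_in_cspace) simp
    moreover have "cspace (m - 1) \<subseteq> cspace (n + m)" by (rule cspace_mono) simp
    ultimately show ?thesis
      using True fold_vec_low[OF m] cvs.subspace_0[OF bU(1)] by (auto simp: lift_basis_def lift_space_def)
  next
    case False
    then have "b (i - (m - 1)) \<in> U" using i m by (intro bU(3)) auto
    then show ?thesis
      using False unfold_vec_cspace[OF m(1)] fold_unfold_vec[OF m] UN
      by (auto simp: lift_basis_def lift_space_def)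
  qed
  fix w assume w: "w \<in> lift_space m U"
  then have wU: "fold_vec m w \<in> U" and wc: "w \<in> cspace (n + m)" by (auto simp: lift_space_def)
  obtain a where a: "fold_vec m w = (\<Sum>i\<in>{1..m}. cscale (a i) (b i))"
    by (rule ordered_basis_expand[OF b wU], rule that)
  let ?v = "w - unfold_vec m (fold_vec m w)"
  have "fold_vec m ?v = 0"
    unfolding f.diff fold_unfold_vec[OF m fold_vec_cspace[OF m]] by (rule diff_self)
  moreover have "?v \<in> cspace (n + m)"
    by (rule cvs.subspace_diff[OF subspace_cspace wc unfold_vec_cspace[OF m(1)]])
  ultimately have v: "?v \<in> cspace (m - 1)" by (intro fold_vec_eq_0[OF m(1)])
  then have v': "?v \<in> coord_space {1..m - 1}" unfolding cspace_eq_coord_space .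
  define c where "c i = (if i \<le> m - 1 then ?v i else a (i - (m - 1)))" for i
  have "(\<Sum>i\<in>{1..2 * m - 1}. cscale (c i) (lift_basis m b i)) =
      (\<Sum>i\<in>{1..m - 1}. cscale (?v i) (basis_vec i)) + unfold_vec m (\<Sum>i\<in>{1..m}. cscale (a i) (b i))"
    unfolding lift_basis_sum[OF m(1)] c_def
    by (intro arg_cong2[of _ _ _ _ "(+)"] arg_cong[of _ _ "unfold_vec m"] sum.cong) auto
  also have "\<dots> = ?v + unfold_vec m (fold_vec m w)"
    unfolding a[symmetric] coord_space_expand[OF _ v', symmetric, OF finite_atLeastAtMost] ..
  also have "\<dots> = w" by simp
  finally show "\<exists>c. w = (\<Sum>i\<in>{1..2 * m - 1}. cscale (c i) (lift_basis m b i))"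
    by (intro exI[of _ c]) (rule sym)
next
  fix c i assume z: "(\<Sum>i\<in>{1..2 * m - 1}. cscale (c i) (lift_basis m b i)) = 0" and i: "i \<in> {1..2 * m - 1}"
  interpret f: Vector_Spaces.linear cscale cscale "fold_vec m" by (rule clinear_fold_vec)
  interpret g: Vector_Spaces.linear cscale cscale "unfold_vec m" by (rule clinear_unfold_vec)
  note bU = ordered_basis_dim[OF b]
  let ?u = "\<Sum>i\<in>{1..m - 1}. cscale (c i) (basis_vec i)" and ?v = "\<Sum>i\<in>{1..m}. cscale (c (m - 1 + i)) (b i)"
  have u: "?u \<in> cspace (m - 1)"
    by (intro cvs.subspace_sum cvs.subspace_scale subspace_cspace basis_vec_in_cspace)
  have v: "?v \<in> cspace (n + 1)"
    using bU(3) UN by (intro cvs.subspace_sum cvs.subspace_scale subspace_cspace) blast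
  have sum0: "?u + unfold_vec m ?v = 0" using z unfolding lift_basis_sum[OF m(1)] .
  have "?v = fold_vec m ?u + fold_vec m (unfold_vec m ?v)"
    unfolding fold_vec_low[OF m u] fold_unfold_vec[OF m v] by simp
  also have "\<dots> = fold_vec m 0" unfolding f.add[symmetric] sum0 ..
  finally have v0: "?v = 0" by (simp only: f.zero)
  have cv: "c (m - 1 + k) = 0" if "k \<in> {1..m}" for k
    using ordered_basis_coeffs_0[OF b v0 that] .
  have u0: "?u = 0" using sum0 unfolding v0 g.zero by simp
  show "c i = 0"
  proof (cases "i \<le> m - 1")
    case True
    then have i': "i \<in> {1..m - 1}" using i by simp
    have "?u i = (\<Sum>k\<in>{1..m - 1}. if k = i then c k else 0)"
      unfolding sum_fun_apply by (rule sum.cong) (auto simp: cscale_def basis_vec_def)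
    also have "\<dots> = c i" using i' by simp
    finally show ?thesis unfolding u0 by simp
  next
    case False
    then have "i - (m - 1) \<in> {1..m}" and e: "m - 1 + (i - (m - 1)) = i" using i m by auto
    from cv[OF this(1)] show ?thesis unfolding e .
  qed
qed

text \<open>
  The coordinate of \<open>fold_vec m w\<close> with this index is \<open>w k\<close>, for \<open>k \<in> {m..n + m}\<close>; \<open>up m\<close> is the inverse
  relabelling.
\<close>

definition down :: "nat \<Rightarrow> nat" where
  "down k = (if k \<le> n + 1 then k else k - n - 1)"

definition up :: "nat \<Rightarrow> nat \<Rightarrow> nat" where
  "up m k = (if k < m then n + 1 + k else k)"

text \<open>
  The minor is block triangular with an identity block of size \<open>m - 1\<close>. The other block has the columns
  of \<open>b\<close> at the positions \<open>down k\<close>, \<open>k \<in> I\<close>, in the order of \<open>I\<close>; \<open>down\<close> moves the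
  largest indices to the front, so they have to be sorted, at the price of a sign.
\<close>

lemma lift_plucker_sign:
  assumes m: "1 \<le> m" "m \<le> n" and I: "I \<subseteq> {m..n + m}" "card I = m"
  shows "\<exists>\<epsilon>::complex. \<epsilon> * \<epsilon> = 1 \<and>
    (\<forall>b. plucker (2 * m - 1) (lift_basis m b) ({1..m - 1} \<union> I) = \<epsilon> * plucker m b (down ` I))"
proof -
  have finI: "finite I" using I(1) finite_subset by blast
  define ys where "ys = sorted_list_of_set I"
  have ys: "distinct ys" "set ys = I" "length ys = m" "sorted ys" using finI I(2) by (auto simp: ys_def)
  have sorted: "sorted_list_of_set ({1..m - 1} \<union> I) = [1..<m] @ ys"
  proof (rule sorted_distinct_set_unique)
    show "set (sorted_list_of_set ({1..m - 1} \<union> I)) = set ([1..<m] @ ys)"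
      using finI ys(2) m by auto
    show "sorted ([1..<m] @ ys)" using ys I(1) by (auto simp: sorted_append)
    show "distinct ([1..<m] @ ys)" using ys I(1) by auto
  qed (use finI in auto)
  have inj: "inj_on down {m..n + m}" using m by (auto simp: inj_on_def down_def split: if_splits)
  have "distinct (map down ys)" using ys I(1) inj by (simp add: distinct_map inj_on_subset)
  moreover have "set (map down ys) = set (sorted_list_of_set (down ` I))" using ys finI by simp
  ultimately have "\<exists>\<epsilon>::complex. \<epsilon> * \<epsilon> = 1 \<and> (\<forall>f. det (mat m m (\<lambda>(i, j). f i (map down ys ! j))) =
      \<epsilon> * det (mat m m (\<lambda>(i, j). f i (sorted_list_of_set (down ` I) ! j))))"
    using finI ys(3) by (intro det_column_reorder) simp_all
  then obtain \<epsilon> :: complex where \<epsilon>: "\<epsilon> * \<epsilon> = 1"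
    "\<forall>f. det (mat m m (\<lambda>(i, j). f i (map down ys ! j))) =
      \<epsilon> * det (mat m m (\<lambda>(i, j). f i (sorted_list_of_set (down ` I) ! j)))"
    by (elim exE conjE) (rule that)
  have "plucker (2 * m - 1) (lift_basis m b) ({1..m - 1} \<union> I) = \<epsilon> * plucker m b (down ` I)" for b
  proof -
    let ?M = "mat (2 * m - 1) (2 * m - 1) (\<lambda>(i, j). lift_basis m b (Suc i) (([1..<m] @ ys) ! j))"
    let ?L = "mat m (m - 1) (\<lambda>(i, j). ?M $$ (m - 1 + i, j))"
    let ?D = "mat m m (\<lambda>(i, j). b (Suc i) (map down ys ! j))"
    have ysI: "ys ! j \<in> {m..n + m}" if "j < m" for j
      using nth_mem[of j ys] that ys(2,3) I(1) by auto
    have M: "?M = four_block_mat (1\<^sub>m (m - 1)) (0\<^sub>m (m - 1) m) ?L ?D"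
    proof (rule eq_matI)
      fix i j assume "i < dim_row (four_block_mat (1\<^sub>m (m - 1)) (0\<^sub>m (m - 1) m) ?L ?D)"
        "j < dim_col (four_block_mat (1\<^sub>m (m - 1)) (0\<^sub>m (m - 1) m) ?L ?D)"
      then have ij: "i < m - 1 + m" "j < m - 1 + m" by simp_all
      then have ij2: "i < 2 * m - 1" "j < 2 * m - 1" using m by simp_all
      show "?M $$ (i, j) = four_block_mat (1\<^sub>m (m - 1)) (0\<^sub>m (m - 1) m) ?L ?D $$ (i, j)"
      proof (cases "i < m - 1")
        case True
        then have bi: "lift_basis m b (Suc i) = basis_vec (Suc i)" by (simp add: lift_basis_def)
        show ?thesis
        proof (cases "j < m - 1")
          case True
          then show ?thesis using \<open>i < m - 1\<close> ij ij2 bi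
            by (simp add: nth_append basis_vec_def)
        next
          case False
          then have "ys ! (j - (m - 1)) \<in> {m..n + m}" using ij by (intro ysI) simp
          then have "ys ! (j - (m - 1)) \<noteq> Suc i" using \<open>i < m - 1\<close> by auto
          then show ?thesis using \<open>i < m - 1\<close> False ij ij2 bi
            by (simp add: nth_append basis_vec_def)
        qed
      next
        case i: False
        show ?thesis
        proof (cases "j < m - 1")
          case True
          then show ?thesis using i ij ij2 by simp
        next
          case False
          have e: "Suc i - (m - 1) = Suc (i - (m - 1))" using i by simp
          have jm: "j - (m - 1) < m" using ij by simp
          have "lift_basis m b (Suc i) (ys ! (j - (m - 1))) = b (Suc (i - (m - 1))) (down (ys ! (j - (m - 1))))"
            using i ysI[OF jm] m unfolding lift_basis_def e by (auto simp: unfold_vec_def down_def)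
          then show ?thesis using i False ij ij2 ys(3) jm by (simp add: nth_append)
        qed
      qed
    qed (use m in simp_all)
    have "det ?M = det (four_block_mat (1\<^sub>m (m - 1)) (0\<^sub>m (m - 1) m) ?L ?D)"
      by (rule arg_cong[OF M])
    also have "\<dots> = det (1\<^sub>m (m - 1)) * det ?D"
      by (rule det_four_block_mat_upper_right_zero[OF one_carrier_mat refl mat_carrier mat_carrier])
    also have "\<dots> = det ?D" by simp
    also have "\<dots> = \<epsilon> * plucker m b (down ` I)"
      using \<epsilon>(2)[THEN spec, of "\<lambda>i. b (Suc i)"] unfolding plucker_def .
    finally show ?thesis unfolding plucker_def[of "2 * m - 1"] sorted .
  qed
  then show ?thesis using \<epsilon>(1) by (intro exI[of _ \<epsilon>] conjI allI)
qed

definition lift_sign :: "nat \<Rightarrow> nat set \<Rightarrow> complex" where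
  "lift_sign m I = (SOME \<epsilon>. \<epsilon> * \<epsilon> = 1 \<and>
    (\<forall>b. plucker (2 * m - 1) (lift_basis m b) ({1..m - 1} \<union> I) = \<epsilon> * plucker m b (down ` I)))"

lemma lift_sign_spec:
  assumes m: "1 \<le> m" "m \<le> n" and I: "I \<subseteq> {m..n + m}" "card I = m"
  shows "lift_sign m I * lift_sign m I = 1"
    "plucker (2 * m - 1) (lift_basis m b) ({1..m - 1} \<union> I) = lift_sign m I * plucker m b (down ` I)"
proof -
  have "lift_sign m I * lift_sign m I = 1 \<and> (\<forall>b. plucker (2 * m - 1) (lift_basis m b) ({1..m - 1} \<union> I) =
      lift_sign m I * plucker m b (down ` I))"
    unfolding lift_sign_def by (rule someI_ex[OF lift_plucker_sign[OF m I]])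
  then show "lift_sign m I * lift_sign m I = 1"
    "plucker (2 * m - 1) (lift_basis m b) ({1..m - 1} \<union> I) = lift_sign m I * plucker m b (down ` I)"
    by simp_all
qed

definition lift_coeff :: "nat \<Rightarrow> nat set \<Rightarrow> complex" where
  "lift_coeff m I = (if {1..m - 1} \<subseteq> I \<and> I \<subseteq> {1..n + m} then lift_sign m (I - {1..m - 1}) else 0)"

definition lift_index :: "nat \<Rightarrow> nat set \<Rightarrow> nat set" where
  "lift_index m I = down ` (I - {1..m - 1})"

definition drop_coeff :: "nat \<Rightarrow> nat set \<Rightarrow> complex" where
  "drop_coeff m J = lift_sign m (up m ` J)"

definition drop_index :: "nat \<Rightarrow> nat set \<Rightarrow> nat set" where
  "drop_index m J = {1..m - 1} \<union> up m ` J"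

lemma lift_index_middle:
  assumes m: "1 \<le> m" "m \<le> n" and I: "card I = 2 * m - 1" "{1..m - 1} \<subseteq> I" "I \<subseteq> {1..n + m}"
  shows "I - {1..m - 1} \<subseteq> {m..n + m}" "card (I - {1..m - 1}) = m" "{1..m - 1} \<union> (I - {1..m - 1}) = I"
proof -
  show "I - {1..m - 1} \<subseteq> {m..n + m}" using I by auto
  show "card (I - {1..m - 1}) = m" using I m by (subst card_Diff_subset) auto
  show "{1..m - 1} \<union> (I - {1..m - 1}) = I" using I by auto
qed

lemma lift_index_valid:
  assumes m: "1 \<le> m" "m \<le> n" and I: "card I = 2 * m - 1" and nz: "lift_coeff m I \<noteq> 0"
  shows "lift_index m I \<subseteq> {1..n + 1}" "card (lift_index m I) = m"
proof -
  have g: "{1..m - 1} \<subseteq> I" "I \<subseteq> {1..n + m}" using nz by (auto simp: lift_coeff_def split: if_splits)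
  note J = lift_index_middle[OF m I g]
  show "lift_index m I \<subseteq> {1..n + 1}"
  proof -
    have "down k \<in> {1..n + 1}" if "k \<in> {m..n + m}" for k using that m by (auto simp: down_def)
    then show ?thesis unfolding lift_index_def using J(1) by blast
  qed
  have "inj_on down {m..n + m}" using m by (auto simp: inj_on_def down_def split: if_splits)
  then have "inj_on down (I - {1..m - 1})" using J(1) by (rule inj_on_subset)
  then show "card (lift_index m I) = m" unfolding lift_index_def using J(2) by (simp add: card_image)
qed

lemma up_image:
  assumes m: "1 \<le> m" "m \<le> n" and J: "J \<subseteq> {1..n + 1}" "card J = m"
  shows "up m ` J \<subseteq> {m..n + m}" "card (up m ` J) = m" "down ` up m ` J = J"
proof -
  show "up m ` J \<subseteq> {m..n + m}" using J(1) m by (auto simp: up_def)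
  have "inj_on (up m) {1..n + 1}" using m by (auto simp: inj_on_def up_def split: if_splits)
  then have "inj_on (up m) J" using J(1) by (rule inj_on_subset)
  then show "card (up m ` J) = m" using J(2) by (simp add: card_image)
  have "down (up m k) = k" if "k \<in> J" for k using that J(1) m by (auto simp: up_def down_def)
  then show "down ` up m ` J = J" by (simp add: image_image)
qed

lemma drop_index_valid:
  assumes m: "1 \<le> m" "m \<le> n" and J: "J \<subseteq> {1..n + 1}" "card J = m"
  shows "drop_index m J \<subseteq> {1..N}" "card (drop_index m J) = 2 * m - 1"
proof -
  note u = up_image[OF m J]
  show "drop_index m J \<subseteq> {1..N}" unfolding drop_index_def using u(1) m by auto
  have "finite (up m ` J)" using u(1) finite_subset by blast
  moreover have "{1..m - 1} \<inter> {m..n + m} = {}" by auto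
  then have "{1..m - 1} \<inter> up m ` J = {}" using u(1) by blast
  ultimately have "card (drop_index m J) = (m - 1) + m"
    unfolding drop_index_def using u(2) by (subst card_Un_disjoint) auto
  then show "card (drop_index m J) = 2 * m - 1" using m by simp
qed

text \<open>
  A sign is its own inverse.
\<close>

lemma plucker_drop:
  assumes m: "1 \<le> m" "m \<le> n" and J: "J \<subseteq> {1..n + 1}" "card J = m"
  shows "plucker m b J = drop_coeff m J * plucker (2 * m - 1) (lift_basis m b) (drop_index m J)"
  unfolding drop_coeff_def drop_index_def lift_sign_spec(2)[OF m up_image(1,2)[OF m J]] up_image(3)[OF m J]
  using lift_sign_spec(1)[OF m up_image(1,2)[OF m J]] by (simp add: mult.assoc[symmetric])

text \<open>
  If \<open>I\<close> omits an index below \<open>m\<close> or contains one above \<open>n + m\<close>, the coordinate vanishes because the lifted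
  space is sandwiched; the remaining index sets are those of \<open>lift_plucker_sign\<close>.
\<close>

lemma plucker_lift:
  assumes m: "1 \<le> m" "m \<le> n" and UN: "U \<subseteq> cspace (n + 1)" and b: "ordered_basis m b U"
    and I: "I \<subseteq> {1..N}" "card I = 2 * m - 1"
  shows "plucker (2 * m - 1) (lift_basis m b) I = lift_coeff m I * plucker m b (lift_index m I)"
proof -
  note lb = ordered_basis_lift[OF m UN b]
  have finI: "finite I" using I(1) finite_subset by blast
  consider "{1..m - 1} \<subseteq> I \<and> I \<subseteq> {1..n + m}" | k where "k \<in> {1..m - 1}" "k \<notin> I" | k where "k \<in> I" "k \<notin> {1..n + m}"
    by blast
  then show ?thesis
  proof cases
    case 1
    note J = lift_index_middle[OF m I(2) conjunct1[OF 1] conjunct2[OF 1]]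
    show ?thesis
      using lift_sign_spec(2)[OF m J(1,2), of b] 1 unfolding J(3) lift_coeff_def lift_index_def by simp
  next
    case 2
    have kc: "basis_vec k \<in> cspace (m - 1)" using 2(1) by (rule basis_vec_in_cspace)
    have "cspace (m - 1) \<subseteq> cspace (n + m)" by (rule cspace_mono) simp
    then have "basis_vec k \<in> lift_space m U"
      using kc fold_vec_low[OF m kc] cvs.subspace_0[OF ordered_basis_dim(1)[OF b]]
      by (auto simp: lift_space_def)
    moreover have "basis_vec k i = 0" if "i \<in> I" for i using that 2(2) by (auto simp: basis_vec_def)
    ultimately have "plucker (2 * m - 1) (lift_basis m b) I = 0"
      using basis_vec_neq_0 by (intro plucker_eq_0_row[OF lb I(2) finI])
    moreover have "lift_coeff m I = 0" using 2 by (auto simp: lift_coeff_def)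
    ultimately show ?thesis by simp
  next
    case 3
    have "plucker (2 * m - 1) (lift_basis m b) I = 0"
    proof (rule plucker_eq_0_column[OF lb I(2) finI 3(1)])
      show "u k = 0" if "u \<in> lift_space m U" for u
        using that 3(2) by (auto simp: lift_space_def cspace_def)
    qed
    moreover have "lift_coeff m I = 0" using 3 by (auto simp: lift_coeff_def)
    ultimately show ?thesis by simp
  qed
qed

definition lift_flag :: "gpoint \<Rightarrow> gpoint" where
  "lift_flag x = (\<lambda>l\<in>{1..s}. lift_space (d l) (x l))"

definition drop_flag :: "gpoint \<Rightarrow> gpoint" where
  "drop_flag y = (\<lambda>l\<in>{1..s}. fold_vec (d l) ` y l)"

lemma degenerateD:
  assumes "x \<in> degenerate_flags n s d"
  shows "x \<in> Gr_prod (n + 1) s d" "x \<in> extensional {1..s}"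
    "\<And>l. l \<in> {1..s} \<Longrightarrow> cvs.subspace (x l)" "\<And>l. l \<in> {1..s} \<Longrightarrow> x l \<subseteq> cspace (n + 1)"
    "\<And>l. l \<in> {1..<s} \<Longrightarrow> pr_comp (d l) (d (l + 1)) ` x l \<subseteq> x (l + 1)"
  using assms by (auto simp: degenerate_flags_def Gr_prod_def Gr_def PiE_def Pi_def)

lemma lift_flag_basis:
  assumes x: "x \<in> degenerate_flags n s d" and l: "l \<in> {1..s}" and b: "ordered_basis (d l) b (x l)"
  shows "ordered_basis (r l) (lift_basis (d l) b) (lift_flag x l)"
  using ordered_basis_lift[OF d_bounds[OF l] degenerateD(4)[OF x l] b] l by (simp add: lift_flag_def)

lemma degenerate_bases:
  assumes x: "x \<in> degenerate_flags n s d"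
  obtains b where "\<And>l. l \<in> {1..s} \<Longrightarrow> ordered_basis (d l) (b l) (x l)"
proof -
  obtain P where P: "P \<in> hcoords s d x" by (rule hcoords_exists[OF degenerateD(1)[OF x]])
  obtain b where b: "\<And>l. l \<in> {1..s} \<Longrightarrow> ordered_basis (d l) (b l) (x l)"
    by (rule hcoords_bases[OF P], rule that)
  show thesis by (rule that[OF b])
qed

lemma lift_flag_sandwiched:
  assumes x: "x \<in> degenerate_flags n s d"
  shows "lift_flag x \<in> sandwiched_flags"
proof (rule sandwichedI)
  show "lift_flag x \<in> extensional {1..s}" by (simp add: lift_flag_def)
  obtain b where b: "\<And>l. l \<in> {1..s} \<Longrightarrow> ordered_basis (d l) (b l) (x l)"
    by (rule degenerate_bases[OF x], rule that)
  fix l assume l: "l \<in> {1..s}"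
  note lb = lift_flag_basis[OF x l b[OF l]] and dl = d_bounds[OF l]
  show "cvs.subspace (lift_flag x l)" "cvs.dim (lift_flag x l) = r l"
    using ordered_basis_dim[OF lb] by blast+
  show "lift_flag x l \<subseteq> cspace (n + d l)" using l by (auto simp: lift_flag_def lift_space_def)
  have "cspace (d l - 1) \<subseteq> cspace (n + d l)" by (rule cspace_mono) simp
  moreover have "0 \<in> x l" using degenerateD(3)[OF x l] by (rule cvs.subspace_0)
  ultimately show "cspace (d l - 1) \<subseteq> lift_flag x l"
    using l fold_vec_low[OF dl] by (auto simp: lift_flag_def lift_space_def)
next
  fix l assume l: "l \<in> {1..<s}"
  then have l1: "l \<in> {1..s}" "l + 1 \<in> {1..s}" by auto
  have dd: "d l \<le> d (l + 1)" using d_le_mono[of l "l + 1"] l by simp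
  show "lift_flag x l \<subseteq> lift_flag x (l + 1)"
  proof
    fix w assume "w \<in> lift_flag x l"
    then have w: "w \<in> cspace (n + d l)" "fold_vec (d l) w \<in> x l" using l1 by (auto simp: lift_flag_def lift_space_def)
    have "fold_vec (d (l + 1)) w = pr_comp (d l) (d (l + 1)) (fold_vec (d l) w)"
      using pr_comp_fold_vec[OF _ dd _ w(1)] d_bounds[OF l1(1)] d_bounds[OF l1(2)] by simp
    then have "fold_vec (d (l + 1)) w \<in> x (l + 1)" using degenerateD(5)[OF x l] w(2) by auto
    moreover have "w \<in> cspace (n + d (l + 1))" using w(1) cspace_mono[of "n + d l" "n + d (l + 1)"] dd by auto
    ultimately show "w \<in> lift_flag x (l + 1)" using l1 by (simp add: lift_flag_def lift_space_def)
  qed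
qed

lemma drop_flag_degenerate:
  assumes y: "y \<in> sandwiched_flags"
  shows "drop_flag y \<in> degenerate_flags n s d"
proof -
  have "fold_vec (d l) ` y l \<in> Gr (n + 1) (d l)" if l: "l \<in> {1..s}" for l
  proof -
    interpret f: Vector_Spaces.linear cscale cscale "fold_vec (d l)" by (rule clinear_fold_vec)
    note yl = sandwichedD[OF y l] and dl = d_bounds[OF l]
    have K: "{w \<in> y l. fold_vec (d l) w = 0} = cspace (d l - 1)"
      using yl(4,5) fold_vec_eq_0[OF dl(1)] fold_vec_low[OF dl] by blast
    have "r l = (d l - 1) + cvs.dim (fold_vec (d l) ` y l)"
      using rank_nullity[OF clinear_fold_vec[of "d l"] yl(1,2)] unfolding yl(3) K dim_cspace .
    then have "cvs.dim (fold_vec (d l) ` y l) = d l" using dl by simp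
    moreover have "cvs.subspace (fold_vec (d l) ` y l)" using yl(1) by (rule f.subspace_image)
    moreover have "fold_vec (d l) ` y l \<subseteq> cspace (n + 1)" using fold_vec_cspace[OF dl] by blast
    ultimately show ?thesis by (simp add: Gr_def)
  qed
  then have "drop_flag y \<in> Gr_prod (n + 1) s d" by (auto simp: drop_flag_def Gr_prod_def)
  moreover have "pr_comp (d l) (d (l + 1)) ` drop_flag y l \<subseteq> drop_flag y (l + 1)" if l: "l \<in> {1..<s}" for l
  proof -
    have l1: "l \<in> {1..s}" "l + 1 \<in> {1..s}" using l by auto
    have dd: "d l \<le> d (l + 1)" using d_le_mono[of l "l + 1"] l by simp
    have "pr_comp (d l) (d (l + 1)) (fold_vec (d l) w) \<in> fold_vec (d (l + 1)) ` y (l + 1)" if w: "w \<in> y l" for w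
    proof -
      have "pr_comp (d l) (d (l + 1)) (fold_vec (d l) w) = fold_vec (d (l + 1)) w"
        using pr_comp_fold_vec[OF _ dd] d_bounds[OF l1(1)] d_bounds[OF l1(2)] sandwichedD(5)[OF y l1(1)] w by auto
      moreover have "w \<in> y (l + 1)" using sandwiched_nested[OF y, of l "l + 1"] l w by auto
      ultimately show ?thesis by auto
    qed
    then show ?thesis using l1 by (auto simp: drop_flag_def)
  qed
  ultimately show ?thesis by (simp add: degenerate_flags_def)
qed

lemma drop_lift_flag:
  assumes x: "x \<in> degenerate_flags n s d"
  shows "drop_flag (lift_flag x) = x"
proof (rule extensionalityI[of _ "{1..s}"])
  fix l assume l: "l \<in> {1..s}"
  note dl = d_bounds[OF l]
  have "fold_vec (d l) ` lift_space (d l) (x l) = x l"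
  proof
    show "x l \<subseteq> fold_vec (d l) ` lift_space (d l) (x l)"
    proof
      fix v assume v: "v \<in> x l"
      then have "v \<in> cspace (n + 1)" using degenerateD(4)[OF x l] by blast
      then have e: "fold_vec (d l) (unfold_vec (d l) v) = v" by (rule fold_unfold_vec[OF dl])
      then have "unfold_vec (d l) v \<in> lift_space (d l) (x l)"
        using v unfold_vec_cspace[OF dl(1)] by (simp add: lift_space_def)
      then show "v \<in> fold_vec (d l) ` lift_space (d l) (x l)" using e by (intro image_eqI[of _ _ "unfold_vec (d l) v"]) simp_all
    qed
  qed (auto simp: lift_space_def)
  then show "drop_flag (lift_flag x) l = x l" using l by (simp add: drop_flag_def lift_flag_def)
qed (use degenerateD(2)[OF x] in \<open>simp_all add: drop_flag_def\<close>)

lemma lift_drop_flag: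
  assumes y: "y \<in> sandwiched_flags"
  shows "lift_flag (drop_flag y) = y"
proof (rule extensionalityI[of _ "{1..s}"])
  show "y \<in> extensional {1..s}"
    using y by (auto simp: sandwiched_flags_def partial_flags_def Gr_prod_def PiE_def)
  fix l assume l: "l \<in> {1..s}"
  note dl = d_bounds[OF l] and yl = sandwichedD[OF y l]
  interpret f: Vector_Spaces.linear cscale cscale "fold_vec (d l)" by (rule clinear_fold_vec)
  have "lift_space (d l) (fold_vec (d l) ` y l) = y l"
  proof
    show "lift_space (d l) (fold_vec (d l) ` y l) \<subseteq> y l"
    proof
      fix w assume "w \<in> lift_space (d l) (fold_vec (d l) ` y l)"
      then obtain w' where w: "w \<in> cspace (n + d l)" "w' \<in> y l" "fold_vec (d l) w = fold_vec (d l) w'"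
        by (auto simp: lift_space_def)
      have "fold_vec (d l) (w - w') = 0" unfolding f.diff using w(3) by simp
      moreover have "w - w' \<in> cspace (n + d l)"
        using w(1,2) yl(5) by (intro cvs.subspace_diff[OF subspace_cspace]) auto
      ultimately have "w - w' \<in> y l" using fold_vec_eq_0[OF dl(1)] yl(4) by blast
      then have "(w - w') + w' \<in> y l" using w(2) by (rule cvs.subspace_add[OF yl(1)])
      then show "w \<in> y l" by simp
    qed
  qed (use yl(5) in \<open>auto simp: lift_space_def\<close>)
  then show "lift_flag (drop_flag y) l = y l" using l by (simp add: drop_flag_def lift_flag_def)
qed (simp add: lift_flag_def)

lemma flag_coordinates:
  assumes x: "x \<in> degenerate_flags n s d"
  obtains P P' where "P \<in> hcoords s d x" "P' \<in> hcoords s r (lift_flag x)"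
    "\<forall>l\<in>{1..s}. \<forall>I\<in>plucker_index N r l. P' l I = lift_coeff (d l) I * P l (lift_index (d l) I)"
    "\<forall>l\<in>{1..s}. \<forall>J\<in>plucker_index (n + 1) d l. P l J = drop_coeff (d l) J * P' l (drop_index (d l) J)"
proof -
  obtain b where b: "\<And>l. l \<in> {1..s} \<Longrightarrow> ordered_basis (d l) (b l) (x l)"
    by (rule degenerate_bases[OF x], rule that)
  let ?P = "\<lambda>l. plucker (d l) (b l)" and ?P' = "\<lambda>l. plucker (r l) (lift_basis (d l) (b l))"
  show thesis
  proof (rule that[of ?P ?P'])
    show "?P \<in> hcoords s d x" by (rule hcoordsI[OF b])
    show "?P' \<in> hcoords s r (lift_flag x)" by (rule hcoordsI, rule lift_flag_basis[OF x _ b])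
    show "\<forall>l\<in>{1..s}. \<forall>I\<in>plucker_index N r l. ?P' l I = lift_coeff (d l) I * ?P l (lift_index (d l) I)"
    proof (intro ballI)
      fix l I assume l: "l \<in> {1..s}" and "I \<in> plucker_index N r l"
      then have I: "I \<subseteq> {1..N}" "card I = r l" by (auto simp: plucker_index_def)
      show "?P' l I = lift_coeff (d l) I * ?P l (lift_index (d l) I)"
        by (rule plucker_lift[OF d_bounds[OF l] degenerateD(4)[OF x l] b[OF l] I])
    qed
    show "\<forall>l\<in>{1..s}. \<forall>J\<in>plucker_index (n + 1) d l. ?P l J = drop_coeff (d l) J * ?P' l (drop_index (d l) J)"
    proof (intro ballI)
      fix l J assume l: "l \<in> {1..s}" and "J \<in> plucker_index (n + 1) d l"
      then have J: "J \<subseteq> {1..n + 1}" "card J = d l" by (auto simp: plucker_index_def)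
      show "?P l J = drop_coeff (d l) J * ?P' l (drop_index (d l) J)"
        by (rule plucker_drop[OF d_bounds[OF l] J])
    qed
  qed
qed

lemma lift_flag_isomorphism:
  "variety_isomorphism (n + 1) s d (degenerate_flags n s d) N s r sandwiched_flags lift_flag"
  unfolding variety_isomorphism_def
proof (intro conjI exI[of _ drop_flag] ballI)
  show "variety_morphism (n + 1) s d (degenerate_flags n s d) N s r sandwiched_flags lift_flag"
  proof (rule coordinate_morphism[where C = "\<lambda>l. lift_coeff (d l)" and \<kappa> = "\<lambda>l. lift_index (d l)"])
    show "lift_index (d l) I \<in> plucker_index (n + 1) d l"
      if "l \<in> {1..s}" "I \<in> plucker_index N r l" "lift_coeff (d l) I \<noteq> 0" for l I
      using lift_index_valid[OF d_bounds[OF that(1)] _ that(3)] that(2) by (simp add: plucker_index_def)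
    fix x assume x: "x \<in> degenerate_flags n s d"
    show "lift_flag x \<in> sandwiched_flags" by (rule lift_flag_sandwiched[OF x])
    obtain P P' where P: "P \<in> hcoords s d x" "P' \<in> hcoords s r (lift_flag x)"
      "\<forall>l\<in>{1..s}. \<forall>I\<in>plucker_index N r l. P' l I = lift_coeff (d l) I * P l (lift_index (d l) I)"
      by (rule flag_coordinates[OF x], rule that)
    show "\<exists>P\<in>hcoords s d x. \<exists>P'\<in>hcoords s r (lift_flag x).
        \<forall>l\<in>{1..s}. \<forall>I\<in>plucker_index N r l. P' l I = lift_coeff (d l) I * P l (lift_index (d l) I)"
      by (intro bexI[OF _ P(1)] bexI[OF _ P(2)] P(3))
  qed
  show "variety_morphism N s r sandwiched_flags (n + 1) s d (degenerate_flags n s d) drop_flag"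
  proof (rule coordinate_morphism[where C = "\<lambda>l. drop_coeff (d l)" and \<kappa> = "\<lambda>l. drop_index (d l)"])
    show "drop_index (d l) J \<in> plucker_index N r l"
      if "l \<in> {1..s}" "J \<in> plucker_index (n + 1) d l" for l J
      using drop_index_valid[OF d_bounds[OF that(1)], of J] that(2) by (simp add: plucker_index_def)
    fix y assume y: "y \<in> sandwiched_flags"
    show x: "drop_flag y \<in> degenerate_flags n s d" by (rule drop_flag_degenerate[OF y])
    obtain P P' where P: "P \<in> hcoords s d (drop_flag y)" "P' \<in> hcoords s r (lift_flag (drop_flag y))"
      "\<forall>l\<in>{1..s}. \<forall>J\<in>plucker_index (n + 1) d l. P l J = drop_coeff (d l) J * P' l (drop_index (d l) J)"
      by (rule flag_coordinates[OF x], rule that)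
    show "\<exists>P'\<in>hcoords s r y. \<exists>P\<in>hcoords s d (drop_flag y).
        \<forall>l\<in>{1..s}. \<forall>J\<in>plucker_index (n + 1) d l. P l J = drop_coeff (d l) J * P' l (drop_index (d l) J)"
      by (intro bexI[OF _ P(2)[unfolded lift_drop_flag[OF y]]] bexI[OF _ P(1)] P(3))
  qed
  show "drop_flag (lift_flag x) = x" if "x \<in> degenerate_flags n s d" for x by (rule drop_lift_flag[OF that])
  show "lift_flag (drop_flag y) = y" if "y \<in> sandwiched_flags" for y by (rule lift_drop_flag[OF that])
qed

lemma Torus_diagonal:
  assumes A: "A \<in> Torus N"
  shows "mat_act N A w = (\<lambda>i. if i \<in> {1..N} then A $$ (i - 1, i - 1) * w i else 0)"
    and "i \<in> {1..N} \<Longrightarrow> A $$ (i - 1, i - 1) \<noteq> 0"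
proof -
  have Ac: "A \<in> carrier_mat N N" "det A = 1" and dg: "diagonal_mat A"
    using A by (auto simp: Torus_def SL_def)
  have off: "A $$ (i, j) = 0" if "i < N" "j < N" "i \<noteq> j" for i j
    using dg that Ac(1) unfolding diagonal_mat_def by auto
  show "mat_act N A w = (\<lambda>i. if i \<in> {1..N} then A $$ (i - 1, i - 1) * w i else 0)"
  proof
    fix i
    show "mat_act N A w i = (if i \<in> {1..N} then A $$ (i - 1, i - 1) * w i else 0)"
    proof (cases "i \<in> {1..N}")
      case True
      have "(\<Sum>j\<in>{1..N}. A $$ (i - 1, j - 1) * w j) = (\<Sum>j\<in>{1..N}. if j = i then A $$ (i - 1, i - 1) * w i else 0)"
      proof (rule sum.cong[OF refl])
        fix j assume j: "j \<in> {1..N}"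
        show "A $$ (i - 1, j - 1) * w j = (if j = i then A $$ (i - 1, i - 1) * w i else 0)"
        proof (cases "j = i")
          case False
          then have "A $$ (i - 1, j - 1) = 0" using j True by (intro off) auto
          then show ?thesis using False by simp
        qed simp
      qed
      also have "\<dots> = A $$ (i - 1, i - 1) * w i" using True by simp
      finally show ?thesis using True by (simp add: mat_act_def)
    next
      case False
      then show ?thesis unfolding mat_act_def by (simp only: if_False)
    qed
  qed
  assume i: "i \<in> {1..N}"
  have "upper_triangular A" using off Ac(1) by (auto simp: upper_triangular_def)
  then have "prod_list (diag_mat A) = 1" using det_upper_triangular[OF _ Ac(1)] Ac(2) by simp
  moreover have "A $$ (i - 1, i - 1) \<in> set (diag_mat A)" using i Ac(1) by (auto simp: diag_mat_def)
  ultimately show "A $$ (i - 1, i - 1) \<noteq> 0" by (metis prod_list_zero_iff zero_neq_one)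
qed

lemma fold_vec_torus:
  assumes A: "A \<in> Torus N" and m: "1 \<le> m" "m \<le> n"
  shows "fold_vec m (mat_act N A w) = torus_vec_act n m A (fold_vec m w)"
  using m unfolding Torus_diagonal(1)[OF A] by (auto simp: fold_vec_def torus_vec_act_def fun_eq_iff)

lemma torus_vec_act_inj:
  assumes A: "A \<in> Torus N" and m: "1 \<le> m" "m \<le> n"
    and v: "v \<in> cspace (n + 1)" "w \<in> cspace (n + 1)" "torus_vec_act n m A v = torus_vec_act n m A w"
  shows "v = w"
proof
  fix k
  have e: "torus_vec_act n m A v k = torus_vec_act n m A w k" using v(3) by simp
  consider "k \<in> {m..n + 1}" | "k \<notin> {m..n + 1}" "k \<in> {1..m - 1}" | "k \<notin> {1..n + 1}" by fastforce
  then show "v k = w k"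
  proof cases
    case 1
    then have "A $$ (k - 1, k - 1) \<noteq> 0" using m by (intro Torus_diagonal(2)[OF A]) auto
    then show ?thesis using e 1 by (simp add: torus_vec_act_def)
  next
    case 2
    then have "A $$ (n + 1 + k - 1, n + 1 + k - 1) \<noteq> 0" using m by (intro Torus_diagonal(2)[OF A]) auto
    then show ?thesis using e 2 unfolding torus_vec_act_def by (simp only: if_True if_False mult_cancel_left) simp
  next
    case 3
    then show ?thesis using v(1,2) by (simp add: cspace_def)
  qed
qed

text \<open>
  The weights of the action on \<open>V\<close> that depends on \<open>m\<close> are the weights of the basis vectors of \<open>W\<close> to
  which \<open>unfold_vec m\<close> sends the basis of \<open>V\<close>.
\<close>

lemma lift_space_torus:
  assumes A: "A \<in> Torus N" and m: "1 \<le> m" "m \<le> n" and UN: "U \<subseteq> cspace (n + 1)"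
  shows "lift_space m (torus_vec_act n m A ` U) = mat_act N A ` lift_space m U"
proof
  show "mat_act N A ` lift_space m U \<subseteq> lift_space m (torus_vec_act n m A ` U)"
  proof
    fix z assume "z \<in> mat_act N A ` lift_space m U"
    then obtain w where w: "z = mat_act N A w" "w \<in> cspace (n + m)" "fold_vec m w \<in> U"
      by (auto simp: lift_space_def)
    have "z \<in> cspace (n + m)" using w(2) unfolding w(1) Torus_diagonal(1)[OF A] by (auto simp: cspace_def)
    moreover have "fold_vec m z = torus_vec_act n m A (fold_vec m w)"
      unfolding w(1) by (rule fold_vec_torus[OF A m])
    then have "fold_vec m z \<in> torus_vec_act n m A ` U" using w(3) by simp
    ultimately show "z \<in> lift_space m (torus_vec_act n m A ` U)" by (simp add: lift_space_def)
  qed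
  show "lift_space m (torus_vec_act n m A ` U) \<subseteq> mat_act N A ` lift_space m U"
  proof
    fix z assume "z \<in> lift_space m (torus_vec_act n m A ` U)"
    then obtain v where z: "z \<in> cspace (n + m)" "fold_vec m z = torus_vec_act n m A v" "v \<in> U"
      by (auto simp: lift_space_def)
    define w where "w i = z i / A $$ (i - 1, i - 1)" for i
    have wc: "w \<in> cspace (n + m)" using z(1) by (simp add: w_def cspace_def)
    have zN: "z \<in> cspace N" using z(1) cspace_mono[of "n + m" N] m by auto
    have aw: "mat_act N A w = z"
    proof
      fix i
      show "mat_act N A w i = z i"
      proof (cases "i \<in> {1..N}")
        case True
        then show ?thesis using Torus_diagonal(2)[OF A True] unfolding Torus_diagonal(1)[OF A] by (simp add: w_def)
      next
        case False
        then show ?thesis using zN unfolding Torus_diagonal(1)[OF A] by (auto simp: cspace_def)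
      qed
    qed
    have "torus_vec_act n m A (fold_vec m w) = torus_vec_act n m A v"
      unfolding fold_vec_torus[OF A m, symmetric] aw by (rule z(2))
    then have "fold_vec m w = v"
      using torus_vec_act_inj[OF A m fold_vec_cspace[OF m]] z(3) UN by blast
    then have "w \<in> lift_space m U" using wc z(3) by (simp add: lift_space_def)
    then show "z \<in> mat_act N A ` lift_space m U" using aw by blast
  qed
qed

lemma lift_flag_equivariant:
  assumes A: "A \<in> Torus N" and x: "x \<in> degenerate_flags n s d"
  shows "lift_flag (torus_degenerate_act n s d A x) = flag_act N s A (lift_flag x)"
proof (rule extensionalityI[of _ "{1..s}"])
  fix l assume l: "l \<in> {1..s}"
  then show "lift_flag (torus_degenerate_act n s d A x) l = flag_act N s A (lift_flag x) l"
    using lift_space_torus[OF A d_bounds[OF l] degenerateD(4)[OF x l]]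
    by (simp add: lift_flag_def torus_degenerate_act_def flag_act_def)
qed (simp_all add: lift_flag_def flag_act_def)

end

theorem theorem3p1:
  fixes n s :: nat and d :: "nat \<Rightarrow> nat"
  assumes "1 \<le> n" and "1 \<le> s"
    and "\<forall>l\<in>{1..s}. 0 < d l"
    and "strict_mono_on {1..s} d"
    and "d s \<le> n"
  shows "\<exists>\<zeta>.
    variety_isomorphism
      (n + 1) s d (degenerate_flags n s d)
      (2 * n) s (\<lambda>l. 2 * d l - 1) (schubert (2 * n) s (\<lambda>l. 2 * d l - 1) (sigma_perm n s d))
      \<zeta> \<and>
    (\<forall>A\<in>Torus (2 * n). \<forall>x\<in>degenerate_flags n s d.
       \<zeta> (torus_degenerate_act n s d A x) = flag_act (2 * n) s A (\<zeta> x))"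
proof -
  interpret flag_dims n s d
    using assms(3-5) by unfold_locales
  show ?thesis
    unfolding schubert_eq_sandwiched[OF assms(2)]
    using lift_flag_isomorphism lift_flag_equivariant by (intro exI[of _ lift_flag] conjI ballI)
qed

end
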